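(* Let $\alpha>1$, $m\ge 2$ an integer and $f\in\mathcal{M}_{\alpha,m}$. Then for all $s$ with $\frac12<\operatorname{Re}(s)<1$, $$\frac{\zeta(s)}{\zeta(2s)}f^*(s)=\int_0^\infty\left(\sum_{n=1}^\infty|\mu(n)|f(nx)-\frac{6f^*(1)}{\pi^2x}\right)x^{s-1}\,dx$$ and $$\frac{\zeta^2(s)}{\zeta(2s)}f^*(s)=\int_0^\infty\left(\sum_{n=1}^\infty 2^{\omega(n)}f(nx)+\frac{6}{\pi^2x}\left(f^*(1)\ln\!\left(\frac{4\pi^2x}{A^{24}}\right)-(f^* )'(1)\right)\right)x^{s-1}\,dx.$$
   Context: For $\alpha>1$ and $m\in\mathbb{N}_0$, the class $\mathcal{M}_{\alpha,m}$ consists of the functions $f$ defined on $[0,\infty)$ such that $f\in\mathcal{C}^{(m)}([0,\infty))$ and $f^{(j)}(x)=\mathcal{O}(x^{-\alpha-j})$ as $x\to\infty$, for all $j=0,1,\dots,m$. $f^*(s)=\int_0^\infty f(x)x^{s-1}dx$ is the Mellin transform of $f$, so $f^*(1)=\int_0^\infty f(t)dt$ and $(f^* )'(1)=\int_0^\infty f(t)\ln t\,dt$. $\zeta$ is the Riemann zeta function, $\mu$ the M\"obius function, $\omega(n)$ the number of distinct prime factors of $n$, and $A$ the Glaisher–Kinkelin constant. *)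

theory Defs
  imports "HOL-Analysis.Analysis" "HOL-Library.Landau_Symbols"
    "HOL-Computational_Algebra.Squarefree"
begin

text \<open>Riemann zeta function: value at s (s \<noteq> 1) of the (unique) holomorphic
  continuation to the punctured plane of the Dirichlet series sum n^(-s), Re s > 1.\<close>
definition zeta :: "complex \<Rightarrow> complex" where
  "zeta s = (THE z. \<exists>g. g holomorphic_on (- {1}) \<and>
      (\<forall>w. 1 < Re w \<longrightarrow> g w = (\<Sum>n. 1 / (of_nat (Suc n)) powr w)) \<and> g s = z)"

definition moebius_mu :: "nat \<Rightarrow> int" where
  "moebius_mu n = (if squarefree n then (-1) ^ card (prime_factors n) else 0)"

definition omega :: "nat \<Rightarrow> nat" where
  "omega n = card (prime_factors n)"

definition glaisher :: real where
  "glaisher = lim (\<lambda>n. (\<Prod>k=1..n. real k ^ k) /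
      (real n powr (real n ^ 2 / 2 + real n / 2 + 1 / 12) * exp (- (real n ^ 2) / 4)))"

definition mellin :: "(real \<Rightarrow> real) \<Rightarrow> complex \<Rightarrow> complex" where
  "mellin f s = integral {0<..} (\<lambda>x. complex_of_real (f x) * (complex_of_real x) powr (s - 1))"

definition M_class :: "real \<Rightarrow> nat \<Rightarrow> (real \<Rightarrow> real) \<Rightarrow> bool" where
  "M_class \<alpha> m f \<longleftrightarrow> (\<exists>F :: nat \<Rightarrow> real \<Rightarrow> real.
      (\<forall>x\<ge>0. F 0 x = f x) \<and>
      (\<forall>j<m. \<forall>x\<ge>0. (F j has_real_derivative F (Suc j) x) (at x within {0..})) \<and>
      (\<forall>j\<le>m. continuous_on {0..} (F j)) \<and>
      (\<forall>j\<le>m. F j \<in> O[at_top](\<lambda>x. x powr (- \<alpha> - real j))))"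

end

theory Submission
  imports Defs "HOL-Complex_Analysis.Complex_Analysis" "HOL-Real_Asymp.Real_Asymp"
begin

text \<open>Put \<open>\<theta> = x d/dx\<close>, \<open>I = f\<^sup>*(1)\<close> and \<open>J = (f\<^sup>*)'(1)\<close>. Summation by parts gives Muentz' formula
  \<open>h(x) = \<Sum>\<^sub>k f(kx) - I/x = \<integral> {t}/t (\<theta>f)(xt) dt\<close>, a multiplicative convolution; since the Mellin transform of
  \<open>{t}/t\<close> at \<open>1 - s\<close> is \<open>-\<zeta>(s)/s\<close> for \<open>0 < Re s < 1\<close> and \<open>(\<theta>f)\<^sup>*(s) = -s f\<^sup>*(s)\<close>, it follows that
  \<open>h\<^sup>*(s) = \<zeta>(s) f\<^sup>*(s)\<close>. A second application, to \<open>h\<close> in place of \<open>f\<close> (here the second derivative of \<open>f\<close> is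
  needed, because \<open>\<theta>h\<close> is the convolution belonging to \<open>\<theta>f\<close>), shows that
  \<open>G(x) = \<Sum>\<^sub>j \<Sum>\<^sub>k f(jkx) - (2\<gamma>I + J - I ln x)/x\<close> has Mellin transform \<open>\<zeta>(s)\<^sup>2 f\<^sup>*(s)\<close>.
  Finally \<open>|\<mu>(n)|\<close> is the sum of \<open>\<mu>(d)\<close> over \<open>d\<^sup>2\<close> dividing \<open>n\<close>, and \<open>2\<^sup>\<omega>\<close> is the sum of \<open>|\<mu>|\<close> over the divisors, so
  that the two integrands are \<open>\<Sum>\<^sub>d \<mu>(d) h(d\<^sup>2x)\<close> and \<open>\<Sum>\<^sub>d \<mu>(d) G(d\<^sup>2x)\<close>; for \<open>Re s > 1/2\<close> the sum over \<open>d\<close> may be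
  interchanged with the integral and contributes \<open>\<Sum>\<^sub>d \<mu>(d) d\<^bsup>-2s\<^esup> = 1/\<zeta>(2s)\<close>. No zeros of \<open>\<zeta>\<close> enter.

  The logarithm of Glaisher's constant appears through \<open>\<Sum> ln n / n\<^sup>2 = -\<zeta>'(2)\<close>. On the one hand
  \<open>\<integral>\<^sub>0\<^sup>N {x}(1 - {x})/x dx\<close> equals \<open>1/6 ln N\<close> plus twice the logarithm of the \<open>N\<close>-th term of the sequence defining
  \<open>A\<close>; on the other hand, expanding \<open>{x}(1 - {x})\<close> into its Fourier series, it is \<open>1/\<pi>\<^sup>2 \<Sum>\<^sub>n C(2\<pi>nN)/n\<^sup>2\<close>
  with \<open>C(z) = \<integral>\<^sub>0\<^sup>z (1 - cos u)/u du = ln z + \<gamma> + o(1)\<close>.\<close>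

subsection \<open>Divisor sums of the Moebius function\<close>

text \<open>\<open>zeta\<close> is a definite description, so it has no usable value until a
  function holomorphic on the whole punctured plane has been exhibited and shown to be unique. A
  continuation that only reaches \<open>Re s > 0\<close> cannot serve; the Dirichlet series is
  therefore pushed to the left one unit at a time. The obstacle in the second formula is that
  \<open>h\<close> behaves like \<open>- I / x\<close> at infinity. Unless I = 0, neither the sum of
  \<open>h (k x)\<close> nor the integral converges, and only their difference has a limit. This is
  why the summation formula is stated for partial sums minus partial integrals, and why the integral
  of \<open>h\<close> over (0, Y) has to be known up to an error tending to 0: it contributes
  \<open>- I ln Y\<close>, which meets the harmonic sum. Euler's constant enters twice on this
  route, once with the integral of \<open>h\<close> and once with the harmonic sum. It is absent
  from the final statement because \<open>24 ln A\<close> contains the same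
  \<open>2 \<gamma>\<close>.\<close>

lemma bij_betw_squarefree_divisors:
  fixes n :: nat
  assumes "n > 0"
  shows "bij_betw prime_factors {d. d dvd n \<and> squarefree d} (Pow (prime_factors n))"
proof (rule bij_betw_byWitness[where f' = "\<lambda>S. \<Prod>S"])
  \<comment> \<open>The inverse multiplies the primes of a set: in a squarefree number every
    exponent is 1, and a product of distinct primes has exactly these prime factors.\<close>
  have sqf: "\<Prod>(prime_factors d) = d" if "squarefree d" for d :: nat
  proof -
    have nz: "d \<noteq> 0" using that by (auto intro!: Nat.gr0I)
    have "d = (\<Prod>p\<in>prime_factors d. p ^ multiplicity p d)"
      using nz prime_factorization_nat by blast
    also have "\<dots> = (\<Prod>p\<in>prime_factors d. p)"
      using that nz by (intro prod.cong) (auto simp: squarefree_factorial_semiring')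
    finally show ?thesis by simp
  qed
  then show "\<forall>d\<in>{d. d dvd n \<and> squarefree d}. \<Prod>(prime_factors d) = d" by auto
  have fin: "finite S" if "S \<subseteq> prime_factors n" for S
    using that finite_subset by blast
  have pf: "prime_factorization (\<Prod>S) = mset_set S" if "S \<subseteq> prime_factors n" for S
  proof -
    have "prime_factorization (prod_mset (mset_set S)) = mset_set S"
      using that fin[OF that] by (intro prime_factorization_prod_mset_primes) (auto simp: in_prime_factors_iff)
    then show ?thesis by (simp add: prod_unfold_prod_mset)
  qed
  show "\<forall>S\<in>Pow (prime_factors n). prime_factors (\<Prod>S) = S"
    using pf fin by auto
  show "prime_factors ` {d. d dvd n \<and> squarefree d} \<subseteq> Pow (prime_factors n)"
  proof safe
    fix d p assume "d dvd n" "p \<in># prime_factorization d"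
    then show "p \<in># prime_factorization n"
      using assms by (auto simp: in_prime_factors_iff intro: dvd_trans)
  qed
  show "(\<lambda>S. \<Prod>S) ` Pow (prime_factors n) \<subseteq> {d. d dvd n \<and> squarefree d}"
  proof safe
    fix S assume S: "S \<subseteq> prime_factors n"
    have nz: "\<Prod>S \<noteq> 0" using S fin[OF S] by (auto simp: in_prime_factors_iff)
    have cnt: "multiplicity p (\<Prod>S) = (if p \<in> S then 1 else 0)" if "prime p" for p
      using pf[OF S] fin[OF S] that by (metis count_mset_set' count_prime_factorization_prime)
    show "\<Prod>S dvd n"
    proof (rule multiplicity_le_imp_dvd[OF nz])
      fix p :: nat assume p: "prime p"
      have "p \<in> S \<Longrightarrow> multiplicity p n \<ge> 1"
        using S by (auto simp: prime_factors_multiplicity Suc_le_eq)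
      then show "multiplicity p (\<Prod>S) \<le> multiplicity p n" using cnt[OF p] by auto
    qed
    show "squarefree (\<Prod>S)"
      unfolding squarefree_factorial_semiring'[OF nz]
    proof
      fix p assume p: "p \<in> prime_factors (\<Prod>S)"
      then have "multiplicity p (\<Prod>S) \<noteq> 0" using prime_factors_multiplicity by auto
      then show "multiplicity p (\<Prod>S) = 1"
        using cnt[of p] p by (auto simp: in_prime_factors_iff split: if_splits)
    qed
  qed
qed

lemma sum_squarefree_divisors:
  fixes n :: nat and g :: "nat \<Rightarrow> 'a :: comm_monoid_add"
  assumes "n > 0"
  shows "(\<Sum>d | d dvd n \<and> squarefree d. g (card (prime_factors d))) = (\<Sum>S\<in>Pow (prime_factors n). g (card S))"
  using sum.reindex_bij_betw[OF bij_betw_squarefree_divisors[OF assms], of "\<lambda>S. g (card S)"] .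

text \<open>Expanding the product of -1 + 1 over the primes of n produces the signed count of all
  sets of primes, so it vanishes unless the product is empty.\<close>

lemma sum_moebius_divisors:
  assumes "n > 0"
  shows "(\<Sum>d | d dvd n. moebius_mu d) = (if n = 1 then 1 else 0)"
proof -
  let ?P = "prime_factors n"
  have "(\<Sum>d | d dvd n. moebius_mu d) = (\<Sum>d | d dvd n \<and> squarefree d. (-1) ^ card (prime_factors d))"
    using assms by (intro sum.mono_neutral_cong_right) (auto simp: moebius_mu_def)
  also have "\<dots> = (\<Sum>S\<in>Pow ?P. (-1) ^ card S)"
    by (rule sum_squarefree_divisors[OF assms])
  also have "\<dots> = (\<Sum>S\<in>Pow ?P. \<Prod>x\<in>S. (-1::int))" by simp
  also have "\<dots> = (\<Prod>x\<in>?P. (-1) + 1)"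
    by (subst prod_add) auto
  also have "\<dots> = (if n = 1 then 1 else 0)"
    using assms by (auto simp: prime_factorization_empty_iff power_0_left)
  finally show ?thesis .
qed

lemma abs_moebius_mu: "\<bar>moebius_mu n\<bar> = (if squarefree n then 1 else 0)"
  by (simp add: moebius_mu_def power_abs)

text \<open>The d whose square divides n are the divisors of a single number,
  \<open>square_part n\<close>, and this number is 1 exactly for squarefree n. The claim is then the
  divisor sum of the Moebius function at \<open>square_part n\<close>.\<close>

lemma sum_moebius_square_divisors:
  assumes "n > 0"
  shows "(\<Sum>d | d ^ 2 dvd n. moebius_mu d) = \<bar>moebius_mu n\<bar>"
proof -
  have "{d. d ^ 2 dvd n} = {d. d dvd square_part n}"
    by (simp add: dvd_square_part_iff)
  moreover have "square_part n = 1 \<longleftrightarrow> squarefree n"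
    unfolding squarefree_def by (metis dvd_square_part_iff nat_dvd_1_iff_1 dvd_refl)
  moreover have "square_part n > 0"
    using assms by (auto intro!: Nat.gr0I)
  ultimately show ?thesis
    using sum_moebius_divisors[of "square_part n"] by (simp add: abs_moebius_mu)
qed

lemma sum_abs_moebius_divisors:
  assumes "n > 0"
  shows "(\<Sum>d | d dvd n. \<bar>moebius_mu d\<bar>) = 2 ^ omega n"
proof -
  have "(\<Sum>d | d dvd n. \<bar>moebius_mu d\<bar>) = (\<Sum>d | d dvd n \<and> squarefree d. 1)"
    using assms by (intro sum.mono_neutral_cong_right) (auto simp: abs_moebius_mu)
  also have "\<dots> = (\<Sum>S\<in>Pow (prime_factors n). 1)"
    by (rule sum_squarefree_divisors[OF assms])
  also have "\<dots> = 2 ^ omega n" by (simp add: card_Pow omega_def)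
  finally show ?thesis .
qed

text \<open>The pairs (d, k) correspond to the pairs (n, d) with \<open>d ^ e dvd n\<close> through
  \<open>n = d ^ e * k\<close>, and an unconditionally summable family may be regrouped along n. The
  exponent 1 serves Dirichlet products and \<open>2 ^ omega\<close>, the exponent 2 serves the
  absolute value of the Moebius function.\<close>

lemma infsum_power_divisor:
  fixes g :: "nat \<Rightarrow> nat \<Rightarrow> 'a :: banach"
  assumes e: "e > 0"
    and sm: "(\<lambda>(d, k). g d (d ^ e * k)) summable_on {0<..} \<times> {0<..}"
  shows "(\<Sum>\<^sub>\<infinity>d\<in>{0<..}. \<Sum>\<^sub>\<infinity>k\<in>{0<..}. g d (d ^ e * k)) = (\<Sum>\<^sub>\<infinity>n\<in>{0<..}. \<Sum>d | d ^ e dvd n. g d n)" (is ?th1)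
    and "(\<lambda>n. \<Sum>d | d ^ e dvd n. g d n) summable_on {0<..}" (is ?th2)
proof -
  define S where "S = Sigma {0::nat<..} (\<lambda>n. {d. d ^ e dvd n})"
  define \<phi> where "\<phi> = (\<lambda>(d, k::nat). (d ^ e * k, d))"
  have bij: "bij_betw \<phi> ({0<..} \<times> {0<..}) S"
  proof (rule bij_betw_byWitness[where f' = "\<lambda>(n, d). (d, n div d ^ e)"])
    show "\<forall>a\<in>{0<..} \<times> {0<..}. (\<lambda>(n, d). (d, n div d ^ e)) (\<phi> a) = a"
      by (auto simp: \<phi>_def)
    show "\<forall>a'\<in>S. \<phi> ((\<lambda>(n, d). (d, n div d ^ e)) a') = a'"
      by (auto simp: \<phi>_def S_def)
    show "\<phi> ` ({0<..} \<times> {0<..}) \<subseteq> S" by (auto simp: \<phi>_def S_def)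
    show "(\<lambda>(n, d). (d, n div d ^ e)) ` S \<subseteq> {0<..} \<times> {0<..}"
      using e by (auto simp: S_def dvd_imp_le zero_power div_greater_zero_iff intro!: Nat.gr0I)
  qed
  have eq: "(\<lambda>(d, k). g d (d ^ e * k)) = (\<lambda>x. (\<lambda>(n, d). g d n) (\<phi> x))"
    by (auto simp: \<phi>_def fun_eq_iff)
  have smS: "(\<lambda>(n, d). g d n) summable_on S"
    using sm summable_on_reindex_bij_betw[OF bij, of "\<lambda>(n, d). g d n"] by (simp add: eq)
  have fin: "finite {d. d ^ e dvd n}" if "n \<in> {0<..}" for n :: nat
  proof (rule finite_subset)
    have "d \<le> n" if "d ^ e dvd n" for d :: nat
    proof -
      have "d dvd n" using dvd_power[of e d] e that dvd_trans by blast
      then show ?thesis using \<open>n \<in> _\<close> by (auto intro: dvd_imp_le)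
    qed
    then show "{d. d ^ e dvd n} \<subseteq> {..n}" by auto
  qed auto
  have inner: "(\<Sum>\<^sub>\<infinity>d\<in>{d. d ^ e dvd n}. g d n) = (\<Sum>d | d ^ e dvd n. g d n)" if "n \<in> {0<..}" for n :: nat
    using fin[OF that] by simp
  have "(\<Sum>\<^sub>\<infinity>d\<in>{0<..}. \<Sum>\<^sub>\<infinity>k\<in>{0<..}. g d (d ^ e * k)) = infsum (\<lambda>(d, k). g d (d ^ e * k)) ({0<..} \<times> {0<..})"
    using infsum_Sigma'_banach[OF sm] by simp
  also have "\<dots> = infsum (\<lambda>(n, d). g d n) S"
    unfolding eq by (rule infsum_reindex_bij_betw[OF bij])
  also have "\<dots> = (\<Sum>\<^sub>\<infinity>n\<in>{0<..}. \<Sum>\<^sub>\<infinity>d\<in>{d. d ^ e dvd n}. g d n)"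
    using infsum_Sigma'_banach[of "\<lambda>n d. g d n" "{0<..}" "\<lambda>n. {d. d ^ e dvd n}"] smS by (simp add: S_def)
  also have "\<dots> = (\<Sum>\<^sub>\<infinity>n\<in>{0<..}. \<Sum>d | d ^ e dvd n. g d n)"
    by (rule infsum_cong) (rule inner)
  finally show ?th1 .
  have "(\<lambda>n. \<Sum>\<^sub>\<infinity>d\<in>{d. d ^ e dvd n}. g d n) summable_on {0<..}"
    using summable_on_Sigma_banach[of "\<lambda>n d. g d n" "{0<..}" "\<lambda>n. {d. d ^ e dvd n}"] smS by (simp add: S_def)
  then show ?th2
    by (subst summable_on_cong[OF inner[symmetric]]) auto
qed

text \<open>Bridge between ordinary series, indexed from \<open>Suc n\<close>, and unordered sums
  over the positive integers. The index 0 is left out because every d divides 0.\<close>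

lemma infsum_positive_nat:
  fixes f :: "nat \<Rightarrow> 'a :: banach"
  assumes "summable (\<lambda>n. norm (f (Suc n)))"
  shows "infsum f {0<..} = (\<Sum>n. f (Suc n))" and "f summable_on {0<..}"
proof -
  have bij: "bij_betw Suc UNIV {0<..}"
    by (rule bij_betw_byWitness[where f' = "\<lambda>n. n - 1"]) auto
  have hs: "((\<lambda>n. f (Suc n)) has_sum (\<Sum>n. f (Suc n))) UNIV"
    using assms by (intro norm_summable_imp_has_sum) (auto intro: summable_sums summable_norm_cancel)
  then have "(f has_sum (\<Sum>n. f (Suc n))) {0<..}"
    using has_sum_reindex_bij_betw[OF bij, of f] by simp
  then show "infsum f {0<..} = (\<Sum>n. f (Suc n))" and "f summable_on {0<..}"
    by (auto dest: infsumI has_sum_imp_summable)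
qed

subsection \<open>Analytic continuation of the zeta function\<close>

lemma norm_of_nat_powr: "norm (complex_of_nat (Suc n) powr z) = real (Suc n) powr Re z"
  using norm_powr_real_powr[of "of_nat (Suc n)" z] by simp

lemma summable_norm_Suc_powr:
  assumes "Re w > 1"
  shows "summable (\<lambda>n. norm (complex_of_nat (Suc n) powr (- w)))"
proof -
  have "summable (\<lambda>n. real n powr (- Re w))"
    using assms by (simp add: summable_real_powr_iff)
  then have "summable (\<lambda>n. real (Suc n) powr (- Re w))"
    by (subst summable_Suc_iff)
  then show ?thesis by (simp only: norm_of_nat_powr) simp
qed

lemma summable_Suc_powr: "c > 1 \<Longrightarrow> summable (\<lambda>n. real (Suc n) powr (- c))"
  using summable_norm_Suc_powr[of "of_real c"] by (simp only: norm_of_nat_powr) simp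

text \<open>The Taylor remainder of order \<open>K\<close> of \<open>(n + 1)\<^bsup>1 - s\<^esup>\<close> at \<open>n\<close>. Summing over \<open>n\<close> expresses
  \<open>(s - 1) \<zeta>(s)\<close> through the values \<open>\<zeta>(s + 1), \<dots>, \<zeta>(s + K - 1)\<close> and a series converging for
  \<open>Re s > 1 - K\<close>.\<close>
definition powr_rem :: "nat \<Rightarrow> nat \<Rightarrow> complex \<Rightarrow> complex" where
  "powr_rem K n s = of_nat (Suc n) powr (1 - s) - (\<Sum>k\<le>K. ((1 - s) gchoose k) * of_nat n powr (1 - s - of_nat k))"

text \<open>Taylor's formula on the segment from n + 1 to n + 2, which avoids the cut of the power
  function. The derivative of order K + 1 is a product times \<open>w powr (- s - K)\<close>, and
  since \<open>Re s + K \<ge> 0\<close> its modulus is largest at the left end.\<close>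

lemma norm_powr_rem_le:
  assumes "Re s + real K \<ge> 0"
  shows "norm (powr_rem K (Suc n) s) \<le> (\<Prod>j\<le>K. norm (1 - s - of_nat j)) * real (Suc n) powr (- Re s - real K)"
proof -
  define a where "a = 1 - s"
  define f where "f = (\<lambda>i w. (\<Prod>j<i. a - of_nat j) * w powr (a - of_nat i) :: complex)"
  let ?n = "complex_of_nat (Suc n)" and ?S = "closed_segment (complex_of_nat (Suc n)) (of_nat (Suc n) + 1)"
  let ?B = "(\<Prod>j\<le>K. norm (a - of_nat j)) * real (Suc n) powr (- Re s - real K)"
  have S: "\<exists>t. w = of_real t \<and> t \<ge> real (Suc n)" if "w \<in> ?S" for w
  proof -
    from that[unfolded in_segment(1)] obtain u where "0 \<le> u" "w = (1 - u) *\<^sub>R ?n + u *\<^sub>R (?n + 1)" by auto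
    then have "w = of_real (real (Suc n) + u)" by (simp add: algebra_simps scaleR_conv_of_real)
    then show ?thesis using \<open>0 \<le> u\<close> by (intro exI[of _ "real (Suc n) + u"]) auto
  qed
  have der: "(f i has_field_derivative f (Suc i) w) (at w within ?S)" if "w \<in> ?S" for i w
  proof -
    from S[OF that] obtain t where t: "w = of_real t" "t \<ge> real (Suc n)" by auto
    then have "w \<notin> \<real>\<^sub>\<le>\<^sub>0" by auto
    then show ?thesis unfolding f_def
      by (auto intro!: derivative_eq_intros simp: algebra_simps)
  qed
  have B: "norm (f (Suc K) w) \<le> ?B" if w: "w \<in> ?S" for w
  proof -
    from S[OF w] obtain t where t: "w = of_real t" "t \<ge> real (Suc n)" by auto
    have "norm (w powr (a - of_nat (Suc K))) = t powr (- Re s - real K)"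
      using t norm_powr_real_powr[of "of_real t" "a - of_nat (Suc K)"] by (simp add: a_def)
    also have "\<dots> \<le> real (Suc n) powr (- Re s - real K)"
      using assms t by (intro powr_mono2') auto
    finally show ?thesis unfolding f_def
      by (auto simp: norm_mult prod_norm lessThan_Suc_atMost intro!: mult_mono prod_nonneg)
  qed
  have "norm (f 0 (?n + 1) - (\<Sum>i\<le>K. f i ?n * (?n + 1 - ?n) ^ i / fact i)) \<le> ?B * norm (?n + 1 - ?n) ^ Suc K / fact K"
    by (rule field_Taylor[where S = ?S and f = f, OF convex_closed_segment der B]) auto
  also have "f 0 (?n + 1) - (\<Sum>i\<le>K. f i ?n * (?n + 1 - ?n) ^ i / fact i) = powr_rem K (Suc n) s"
  proof -
    have "f i ?n * (?n + 1 - ?n) ^ i / fact i = (a gchoose i) * ?n powr (a - of_nat i)" for i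
      by (simp add: f_def gbinomial_prod_rev atLeast0LessThan)
    then show ?thesis
      by (simp add: powr_rem_def f_def a_def add.commute)
  qed
  also have "?B * norm (?n + 1 - ?n) ^ Suc K / fact K \<le> ?B"
  proof -
    have "?B / fact K \<le> ?B / 1" by (intro divide_left_mono) (auto intro!: mult_nonneg_nonneg prod_nonneg fact_ge_1)
    then show ?thesis by simp
  qed
  finally show ?thesis by (simp add: a_def)
qed

lemma powr_rem_sum_holomorphic:
  "(\<lambda>s. \<Sum>n. powr_rem K (Suc n) s) holomorphic_on {s. Re s > 1 - real K}"
proof (rule holomorphic_uniform_sequence)
  let ?S = "{s. Re s > 1 - real K}"
  show "open ?S" by (rule open_halfspace_Re_gt)
  show "(\<lambda>s. \<Sum>n<N. powr_rem K (Suc n) s) holomorphic_on ?S" for N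
    unfolding powr_rem_def gbinomial_prod_rev by (intro holomorphic_intros) auto
  fix x assume x: "x \<in> ?S"
  \<comment> \<open>Half the distance to the boundary line, so that \<open>Re s + K\<close> stays
    above the fixed number \<open>Re x - d + K > 1\<close> on the whole closed disc.\<close>
  define d where "d = (Re x - (1 - real K)) / 2"
  have d: "d > 0" using x by (simp add: d_def)
  define C where "C = (\<Prod>j\<le>K. 1 + norm x + d + real j)"
  have re: "Re s \<ge> Re x - d" and nm: "norm s \<le> norm x + d" if "s \<in> cball x d" for s
  proof -
    have "\<bar>Re (x - s)\<bar> \<le> d" using that abs_Re_le_cmod[of "x - s"] by (auto simp: dist_norm)
    then show "Re s \<ge> Re x - d" by simp
    show "norm s \<le> norm x + d" using that norm_triangle_ineq2[of s x] by (auto simp: dist_norm norm_minus_commute)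
  qed
  have "cball x d \<subseteq> ?S"
  proof
    fix s assume "s \<in> cball x d"
    from re[OF this] x show "s \<in> ?S" by (simp add: d_def field_simps)
  qed
  moreover have "uniform_limit (cball x d) (\<lambda>N s. \<Sum>n<N. powr_rem K (Suc n) s) (\<lambda>s. \<Sum>n. powr_rem K (Suc n) s) sequentially"
  proof (rule Weierstrass_m_test)
    fix n s assume s: "s \<in> cball x d"
    have e: "Re s + real K \<ge> Re x - d + real K" "Re x - d + real K > 1"
      using re[OF s] x by (auto simp: d_def field_simps)
    have "norm (powr_rem K (Suc n) s) \<le> (\<Prod>j\<le>K. norm (1 - s - of_nat j)) * real (Suc n) powr (- Re s - real K)"
      using e by (intro norm_powr_rem_le) auto
    also have "\<dots> \<le> C * real (Suc n) powr (- (Re x - d + real K))"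
    proof (intro mult_mono)
      show "(\<Prod>j\<le>K. norm (1 - s - of_nat j)) \<le> C" unfolding C_def
      proof (intro prod_mono conjI)
        fix j
        have "norm (1 - s - of_nat j) \<le> norm (1 - s) + real j" using norm_triangle_ineq4[of "1 - s" "of_nat j"] by simp
        also have "\<dots> \<le> 1 + norm s + real j" using norm_triangle_ineq4[of 1 s] by simp
        finally show "norm (1 - s - of_nat j) \<le> 1 + norm x + d + real j" using nm[OF s] by simp
      qed auto
      show "real (Suc n) powr (- Re s - real K) \<le> real (Suc n) powr (- (Re x - d + real K))"
        using e by (intro powr_mono) auto
      show "0 \<le> C" unfolding C_def using d by (intro prod_nonneg) auto
    qed auto
    finally show "norm (powr_rem K (Suc n) s) \<le> C * real (Suc n) powr (- (Re x - d + real K))" .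
  next
    have "summable (\<lambda>n. real n powr (- (Re x - d + real K)))"
      using x by (simp add: summable_real_powr_iff d_def field_simps)
    then show "summable (\<lambda>n. C * real (Suc n) powr (- (Re x - d + real K)))"
      by (subst summable_Suc_iff) (rule summable_mult)
  qed
  ultimately show "\<exists>d>0. cball x d \<subseteq> ?S \<and> uniform_limit (cball x d) (\<lambda>N s. \<Sum>n<N. powr_rem K (Suc n) s) (\<lambda>s. \<Sum>n. powr_rem K (Suc n) s) sequentially"
    using d by blast
qed

text \<open>The term k = 0 telescopes together with the leading power and leaves -1, the term k = 1
  gives \<open>(s - 1) * D s\<close>, and each k from 2 on gives the Dirichlet series at
  \<open>s + k - 1\<close>.\<close>

lemma powr_rem_sums:
  assumes "Re s > 1"
  defines "D \<equiv> \<lambda>w. \<Sum>n. complex_of_nat (Suc n) powr (- w)"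
  assumes K: "K \<ge> 1"
  shows "(\<lambda>n. powr_rem K (Suc n) s) sums
    ((s - 1) * D s - 1 - (\<Sum>k\<in>{2..K}. ((1 - s) gchoose k) * D (s + of_nat k - 1)))"
proof -
  have D: "(\<lambda>n. complex_of_nat (Suc n) powr (- w)) sums D w" if "Re w > 1" for w
    unfolding D_def using summable_norm_Suc_powr[OF that] by (intro summable_sums) (rule summable_norm_cancel)
  let ?g = "\<lambda>n. complex_of_nat (Suc n) powr (1 - s)"
  have "?g \<longlonglongrightarrow> 0"
  proof (rule Lim_null_comparison)
    show "\<forall>\<^sub>F n in sequentially. norm (?g n) \<le> real (Suc n) powr (1 - Re s)"
      by (simp only: norm_of_nat_powr) simp
    show "(\<lambda>n. real (Suc n) powr (1 - Re s)) \<longlonglongrightarrow> 0"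
      using assms(1) by real_asymp
  qed
  from telescope_sums[OF this] have 1: "(\<lambda>n. ?g (Suc n) - ?g n) sums - 1" by simp
  have 2: "(\<lambda>n. \<Sum>k\<in>{1..K}. ((1 - s) gchoose k) * complex_of_nat (Suc n) powr (- (s + of_nat k - 1)))
      sums (\<Sum>k\<in>{1..K}. ((1 - s) gchoose k) * D (s + of_nat k - 1))"
    using assms(1) by (intro sums_sum sums_mult D) auto
  have "{..K} = insert 0 {1..K}" by auto
  then have eq: "powr_rem K (Suc n) s = (?g (Suc n) - ?g n) -
     (\<Sum>k\<in>{1..K}. ((1 - s) gchoose k) * complex_of_nat (Suc n) powr (- (s + of_nat k - 1)))" for n
    unfolding powr_rem_def by (simp add: algebra_simps)
  have "{1..K} = insert 1 {2..K}" using K by auto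
  then have "(\<Sum>k\<in>{1..K}. ((1 - s) gchoose k) * D (s + of_nat k - 1)) =
      (1 - s) * D s + (\<Sum>k\<in>{2..K}. ((1 - s) gchoose k) * D (s + of_nat k - 1))" by simp
  then have "- 1 - (\<Sum>k\<in>{1..K}. ((1 - s) gchoose k) * D (s + of_nat k - 1)) =
      (s - 1) * D s - 1 - (\<Sum>k\<in>{2..K}. ((1 - s) gchoose k) * D (s + of_nat k - 1))"
    by (simp only:) (simp add: algebra_simps)
  with sums_diff[OF 1 2] show ?thesis
    unfolding eq[symmetric] by (simp only:)
qed

text \<open>One step of the continuation: the remainder identity is solved for
  \<open>(s - 1) * D s\<close>. The last factor of \<open>(1 - s) gchoose k\<close> is minus
  \<open>s + k - 2\<close>, precisely the factor that turns \<open>D (s + k - 1)\<close> into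
  \<open>Z (s + k - 1)\<close>, so the shifted series bring in no poles.\<close>

lemma zeta_halfplane_step:
  fixes Z :: "complex \<Rightarrow> complex"
  assumes hol: "\<And>k. k \<in> {2..K} \<Longrightarrow> (\<lambda>s. Z (s + of_nat k - 1)) holomorphic_on {s. Re s > 1 - real K}"
    and Z: "\<And>s. Re s > 1 \<Longrightarrow> Z s = (s - 1) * (\<Sum>n. complex_of_nat (Suc n) powr (- s))" and K: "K \<ge> 1"
  shows "\<exists>Z'. Z' holomorphic_on {s. Re s > 1 - real K} \<and>
           (\<forall>s. Re s > 1 \<longrightarrow> Z' s = (s - 1) * (\<Sum>n. complex_of_nat (Suc n) powr (- s)))"
proof (intro exI conjI allI impI)
  let ?Z = "\<lambda>s. 1 + (\<Sum>n. powr_rem K (Suc n) s)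
      - (\<Sum>k\<in>{2..K}. ((1 - s) gchoose (k - 1)) / of_nat k * Z (s + of_nat k - 1))"
  show "?Z holomorphic_on {s. Re s > 1 - real K}"
    unfolding gbinomial_prod_rev by (intro holomorphic_intros powr_rem_sum_holomorphic hol) auto
  fix s :: complex assume s: "Re s > 1"
  have "((1 - s) gchoose k) * (\<Sum>n. complex_of_nat (Suc n) powr (- (s + of_nat k - 1))) =
      - (((1 - s) gchoose (k - 1)) / of_nat k * Z (s + of_nat k - 1))" if k: "k \<in> {2..K}" for k
  proof -
    obtain l where l: "k = Suc l" using k by (cases k) auto
    have "((1 - s) gchoose Suc l) = ((1 - s) gchoose l) * (1 - s - of_nat l) / of_nat (Suc l)"
      using gbinomial_absorption[of l "1 - s"] gbinomial_mult_1[of "1 - s" l] by (simp add: field_simps del: of_nat_Suc)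
    moreover have "s + of_nat k - 1 - 1 = - (1 - s - of_nat l)" by (simp add: l)
    moreover have "Re (s + of_nat k - 1) > 1" using k s by simp
    ultimately show ?thesis by (simp only: Z l diff_Suc_1) (simp only: times_divide_eq_left times_divide_eq_right mult_minus_left mult_minus_right minus_divide_left mult.assoc minus_minus)
  qed
  then have eq: "(\<Sum>k\<in>{2..K}. ((1 - s) gchoose k) * (\<Sum>n. complex_of_nat (Suc n) powr (- (s + of_nat k - 1))))
     = - (\<Sum>k\<in>{2..K}. ((1 - s) gchoose (k - 1)) / of_nat k * Z (s + of_nat k - 1))"
    by (subst sum_negf[symmetric]) (intro sum.cong refl)
  show "?Z s = (s - 1) * (\<Sum>n. complex_of_nat (Suc n) powr (- s))"
    by (simp only: powr_rem_sums[OF s K, THEN sums_unique, symmetric] eq) (simp only: minus_diff_eq diff_minus_eq_add add_diff_cancel, simp)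
qed

lemma zeta_halfplane:
  "\<exists>Z. Z holomorphic_on {s. Re s > - real j} \<and>
         (\<forall>s. Re s > 1 \<longrightarrow> Z s = (s - 1) * (\<Sum>n. complex_of_nat (Suc n) powr (- s)))"
proof (induction j)
  case 0
  show ?case
    using zeta_halfplane_step[of 1 "\<lambda>s. (s - 1) * (\<Sum>n. complex_of_nat (Suc n) powr (- s))"] by simp
next
  case (Suc j)
  then obtain Z where Z: "Z holomorphic_on {s. Re s > - real j}"
    "\<And>s. Re s > 1 \<Longrightarrow> Z s = (s - 1) * (\<Sum>n. complex_of_nat (Suc n) powr (- s))" by blast
  \<comment> \<open>Here K = j + 2. Since k is at least 2, the argument is shifted to the right by
    at least 1, from \<open>Re s > - (j + 1)\<close> into the half-plane of the induction
    hypothesis.\<close>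
  have "(\<lambda>s. Z (s + of_nat k - 1)) holomorphic_on {s. Re s > 1 - real (Suc (Suc j))}" if "k \<in> {2..Suc (Suc j)}" for k
  proof -
    have "Z \<circ> (\<lambda>s. s + of_nat k - 1) holomorphic_on {s. Re s > 1 - real (Suc (Suc j))}"
      using that by (intro holomorphic_on_compose_gen[OF _ Z(1)]) (auto intro!: holomorphic_intros)
    then show ?thesis by (simp add: o_def)
  qed
  from zeta_halfplane_step[OF this Z(2)] show ?case by (simp add: algebra_simps)
qed

text \<open>The half-planes are nested and the functions on them coincide for
  \<open>Re s > 1\<close>, so by the identity theorem they fit together to one entire
  function.\<close>

lemma zeta_entire:
  "\<exists>Z. Z holomorphic_on UNIV \<and>
         (\<forall>s. Re s > 1 \<longrightarrow> Z s = (s - 1) * (\<Sum>n. complex_of_nat (Suc n) powr (- s)))"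
proof -
  define H where "H = (\<lambda>j. {s. Re s > - real j})"
  from zeta_halfplane obtain Y where Y: "\<And>j. Y j holomorphic_on H j"
    "\<And>j s. Re s > 1 \<Longrightarrow> Y j s = (s - 1) * (\<Sum>n. complex_of_nat (Suc n) powr (- s))"
    unfolding H_def by metis
  have H: "open (H j)" "connected (H j)" for j
    by (auto simp: H_def open_halfspace_Re_gt convex_halfspace_Re_gt intro!: convex_connected)
  have agree: "Y i s = Y j s" if "i \<le> j" "s \<in> H i" for i j s
  proof (rule analytic_continuation_open[of "{s. Re s > 1}" "H i" "Y i" "Y j"])
    show "{s. Re s > 1} \<noteq> {}" by (auto intro!: exI[of _ 2])
    show "Y j holomorphic_on H i"
      using that by (intro holomorphic_on_subset[OF Y(1)]) (auto simp: H_def)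
    show "Y i z = Y j z" if "z \<in> {s. Re s > 1}" for z using that by (simp add: Y(2))
  qed (use that H Y(1) in \<open>auto simp: H_def open_halfspace_Re_gt\<close>)
  \<comment> \<open>The index merely selects some half-plane that contains s; by
    \<open>agree\<close> every other admissible choice gives the same value.\<close>
  define Z where "Z = (\<lambda>s. Y (nat \<lceil>\<bar>Re s\<bar>\<rceil> + 1) s)"
  have ZY: "Z s = Y j s" if "s \<in> H j" for s j
  proof -
    have "s \<in> H (nat \<lceil>\<bar>Re s\<bar>\<rceil> + 1)" unfolding H_def mem_Collect_eq by linarith
    then show ?thesis unfolding Z_def using that agree by (metis nat_le_linear)
  qed
  have "Z field_differentiable at s" for s
  proof -
    obtain j where j: "s \<in> H j" unfolding H_def mem_Collect_eq
      by (metis add.inverse_inverse neg_less_iff_less reals_Archimedean2)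
    have "Z holomorphic_on H j"
      using Y(1)[of j] ZY by (subst holomorphic_cong[OF refl, of _ _ "Y j"]) auto
    then show ?thesis using j H(1)[of j] holomorphic_on_imp_differentiable_at by blast
  qed
  then have "Z holomorphic_on UNIV" by (auto simp: holomorphic_on_def)
  moreover have "Z s = (s - 1) * (\<Sum>n. complex_of_nat (Suc n) powr (- s))" if "Re s > 1" for s
    using that ZY[of s 0] Y(2)[of s 0] by (simp add: H_def)
  ultimately show ?thesis by blast
qed

text \<open>The description in \<open>zeta\<close> is resolved by \<open>Z s / (s - 1)\<close> for
  existence and by the identity theorem on the connected punctured plane for uniqueness.\<close>

lemma zeta_holomorphic: "zeta holomorphic_on - {1}"
  and zeta_eq_suminf: "Re s > 1 \<Longrightarrow> zeta s = (\<Sum>n. complex_of_nat (Suc n) powr (- s))"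
proof -
  from zeta_entire obtain Z where Z: "Z holomorphic_on UNIV"
    "\<And>s. Re s > 1 \<Longrightarrow> Z s = (s - 1) * (\<Sum>n. complex_of_nat (Suc n) powr (- s))" by blast
  define g where "g = (\<lambda>s. Z s / (s - 1))"
  have g: "g holomorphic_on - {1}"
    unfolding g_def by (intro holomorphic_intros holomorphic_on_subset[OF Z(1)]) auto
  have gs: "g s = (\<Sum>n. complex_of_nat (Suc n) powr (- s))" if "Re s > 1" for s
  proof -
    have "s \<noteq> 1" using that by auto
    then show ?thesis by (simp add: g_def Z(2)[OF that])
  qed
  have series: "(\<Sum>n. 1 / of_nat (Suc n) powr w) = (\<Sum>n. complex_of_nat (Suc n) powr (- w))" for w
    by (simp add: powr_minus field_simps)
  have zeta: "zeta s = g s" if "s \<noteq> 1" for s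
  proof -
    have "h s = g s" if h: "h holomorphic_on - {1}" "\<forall>w. 1 < Re w \<longrightarrow> h w = (\<Sum>n. 1 / of_nat (Suc n) powr w)" for h
    proof (rule analytic_continuation_open[of "{s. Re s > 1}" "- {1}" h g])
      show "{s. Re s > 1} \<noteq> {}" by (auto intro!: exI[of _ 2])
      show "connected (- {1::complex})" by (rule connected_punctured_universe) simp
      show "h z = g z" if "z \<in> {s. 1 < Re s}" for z using that h(2) gs[of z] series[of z] by auto
    qed (use h g \<open>s \<noteq> 1\<close> in \<open>auto simp: open_halfspace_Re_gt\<close>)
    moreover have "\<exists>h. h holomorphic_on - {1} \<and> (\<forall>w. 1 < Re w \<longrightarrow> h w = (\<Sum>n. 1 / of_nat (Suc n) powr w)) \<and> h s = g s"
      using g gs series by (intro exI[of _ g]) simp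
    ultimately show ?thesis unfolding zeta_def by (intro the_equality) blast+
  qed
  show "zeta holomorphic_on - {1}"
    using g by (subst holomorphic_cong[OF refl, of _ _ g]) (auto simp: zeta)
  assume s: "Re s > 1"
  then have "s \<noteq> 1" by auto
  then show "zeta s = (\<Sum>n. complex_of_nat (Suc n) powr (- s))" using gs[OF s] zeta by simp
qed

text \<open>The case K = 1: the remainder series converges for \<open>Re s > 0\<close>, equals
  \<open>(s - 1) * zeta s - 1\<close> by continuation, and its partial sums telescope. The resulting
  limit is a sum minus the corresponding integral of \<open>t powr (- s)\<close>, the shape in which
  \<open>zeta\<close> meets Muentz' formula.\<close>

lemma zeta_partial_sums_limit:
  assumes s: "Re s > 0" "s \<noteq> 1"
  shows "(\<lambda>N. (\<Sum>n<N. complex_of_nat (Suc n) powr (- s)) - of_nat N powr (1 - s) / (1 - s)) \<longlonglongrightarrow> zeta s"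
proof -
  let ?g = "\<lambda>n. complex_of_nat n powr (1 - s)" and ?S = "\<lambda>N. \<Sum>n<N. complex_of_nat (Suc n) powr (- s)"
  have eq: "1 + (\<Sum>n. powr_rem 1 (Suc n) s) = (s - 1) * zeta s"
  proof (rule analytic_continuation_open[of "{s. Re s > 1}" "{s. Re s > 0} - {1}"
        "\<lambda>s. 1 + (\<Sum>n. powr_rem 1 (Suc n) s)" "\<lambda>s. (s - 1) * zeta s"])
    show "{s. Re s > 1} \<noteq> {}" by (auto intro!: exI[of _ 2])
    show "connected ({s. 0 < Re s} - {1})"
      by (rule connected_open_delete) (auto simp: open_halfspace_Re_gt convex_halfspace_Re_gt intro!: convex_connected)
    show "(\<lambda>s. 1 + (\<Sum>n. powr_rem 1 (Suc n) s)) holomorphic_on {s. 0 < Re s} - {1}"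
      using powr_rem_sum_holomorphic[of 1] by (intro holomorphic_intros) (auto elim: holomorphic_on_subset)
    show "(\<lambda>s. (s - 1) * zeta s) holomorphic_on {s. 0 < Re s} - {1}"
      using zeta_holomorphic by (intro holomorphic_intros) (auto elim: holomorphic_on_subset)
    show "1 + (\<Sum>n. powr_rem 1 (Suc n) z) = (z - 1) * zeta z" if "z \<in> {s. 1 < Re s}" for z
    proof -
      have "(\<Sum>n. powr_rem 1 (Suc n) z) = (z - 1) * zeta z - 1"
        using that powr_rem_sums[of z 1, THEN sums_unique] zeta_eq_suminf[of z] by simp
      then show ?thesis by simp
    qed
  qed (use s in \<open>auto simp: open_halfspace_Re_gt\<close>)
  have rem: "powr_rem 1 (Suc n) s = ?g (Suc (Suc n)) - ?g (Suc n) - (1 - s) * of_nat (Suc n) powr (- s)" for n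
    by (simp add: powr_rem_def algebra_simps)
  have part: "(\<Sum>n<N. powr_rem 1 (Suc n) s) = ?g (Suc N) - 1 - (1 - s) * ?S N" for N
  proof -
    have "(\<Sum>n<N. powr_rem 1 (Suc n) s) = (\<Sum>n<N. ?g (Suc (Suc n)) - ?g (Suc n)) - (1 - s) * ?S N"
      by (simp only: rem sum_subtractf sum_distrib_left)
    then show ?thesis by (simp only: sum_lessThan_telescope[of "\<lambda>n. ?g (Suc n)"]) simp
  qed
  have "summable (\<lambda>n. powr_rem 1 (Suc n) s)"
  proof (rule summable_comparison_test')
    have "summable (\<lambda>n. real n powr (- Re s - 1))" using s by (simp add: summable_real_powr_iff)
    then show "summable (\<lambda>n. (\<Prod>j\<le>1. norm (1 - s - of_nat j)) * real (Suc n) powr (- Re s - real 1))"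
      by (subst summable_Suc_iff) (intro summable_mult, simp)
    show "norm (powr_rem 1 (Suc n) s) \<le> (\<Prod>j\<le>1. norm (1 - s - of_nat j)) * real (Suc n) powr (- Re s - real 1)"
      if "n \<ge> 0" for n using s by (intro norm_powr_rem_le) auto
  qed
  then have "(\<lambda>N. ?g (Suc N) - 1 - (1 - s) * ?S N) \<longlonglongrightarrow> (\<Sum>n. powr_rem 1 (Suc n) s)"
    unfolding part[symmetric] by (rule summable_LIMSEQ)
  then have "(\<lambda>N. (1 + (?g (Suc N) - 1 - (1 - s) * ?S N)) / (s - 1)) \<longlonglongrightarrow> (1 + (\<Sum>n. powr_rem 1 (Suc n) s)) / (s - 1)"
    using s by (intro tendsto_intros) auto
  also have "(1 + (\<Sum>n. powr_rem 1 (Suc n) s)) / (s - 1) = zeta s"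
    using eq s by simp
  finally have 1: "(\<lambda>N. (1 + (?g (Suc N) - 1 - (1 - s) * ?S N)) / (s - 1)) \<longlonglongrightarrow> zeta s" .
  \<comment> \<open>Telescoping pairs N summands with the power of N + 1. Adding the next summand,
    which tends to 0, brings both to the same index.\<close>
  have 2: "(\<lambda>N. complex_of_nat (Suc N) powr (- s)) \<longlonglongrightarrow> 0"
  proof (rule Lim_null_comparison)
    show "\<forall>\<^sub>F n in sequentially. norm (complex_of_nat (Suc n) powr (- s)) \<le> real (Suc n) powr (- Re s)"
      by (simp only: norm_of_nat_powr) simp
    show "(\<lambda>n. real (Suc n) powr (- Re s)) \<longlonglongrightarrow> 0" using s by real_asymp
  qed
  have "(\<lambda>N. ?S (Suc N) - ?g (Suc N) / (1 - s)) \<longlonglongrightarrow> zeta s"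
  proof (rule Lim_transform_eventually[OF tendsto_add[OF 1 2, simplified add_0_right]])
    have "1 - s \<noteq> 0" "s - 1 \<noteq> 0" using s by auto
    then show "\<forall>\<^sub>F N in sequentially. (1 + (?g (Suc N) - 1 - (1 - s) * ?S N)) / (s - 1) + of_nat (Suc N) powr (- s) =
        ?S (Suc N) - ?g (Suc N) / (1 - s)"
      by (intro always_eventually allI) (simp add: divide_simps, simp add: algebra_simps)
  qed
  then show ?thesis by (rule LIMSEQ_imp_Suc)
qed

subsection \<open>The Glaisher--Kinkelin constant\<close>

lemma entire_exponential_integral:
  obtains P :: "complex \<Rightarrow> complex" where "P 0 = 0"
    "\<And>w. (P has_field_derivative (if w = 0 then 1 else (1 - exp (- w)) / w)) (at w)"
proof -
  let ?f = "\<lambda>z::complex. - exp (- z)"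
  \<comment> \<open>The integrand is the difference quotient of \<open>- exp (- z)\<close> at 0;
    filling in the derivative 1 there makes it entire, and an entire function has a
    primitive.\<close>
  have "(\<lambda>z. if z = 0 then deriv ?f 0 else (?f z - ?f 0) / (z - 0)) holomorphic_on UNIV"
    by (rule pole_lemma_open) (auto intro!: holomorphic_intros)
  moreover have "deriv ?f 0 = 1"
    by (rule DERIV_imp_deriv) (auto intro!: derivative_eq_intros)
  moreover have "(\<lambda>z. if z = 0 then 1 else (?f z - ?f 0) / (z - 0)) = (\<lambda>z. if z = 0 then 1 else (1 - exp (- z)) / z)"
    by (intro ext) simp
  ultimately have hol: "(\<lambda>z::complex. if z = 0 then 1 else (1 - exp (- z)) / z) holomorphic_on UNIV"
    by (simp only:)
  have "\<exists>g. \<forall>x::complex. (g has_field_derivative (if x = 0 then 1 else (1 - exp (- x)) / x)) (at x)"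
  proof (rule holomorphic_convex_primitive'[OF convex_UNIV open_UNIV hol])
    fix g assume "\<And>x::complex. x \<in> UNIV \<Longrightarrow> (g has_field_derivative (if x = 0 then 1 else (1 - exp (- x)) / x)) (at x)"
    from this[OF UNIV_I] show ?thesis by (intro exI[of _ g] allI)
  qed
  then obtain g where g: "\<And>x::complex. (g has_field_derivative (if x = 0 then 1 else (1 - exp (- x)) / x)) (at x)"
    by auto
  have "((\<lambda>z. g z - g 0) has_field_derivative (if w = 0 then 1 else (1 - exp (- w)) / w)) (at w)" for w
    using DERIV_diff[OF g[of w] DERIV_const[of "g 0"]] by simp
  then show ?thesis by (intro that[of "\<lambda>z. g z - g 0"]) (simp, blast)
qed

text \<open>The upper bound is \<open>1 + u \<le> exp u\<close>. For the lower bound, Bernoulli's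
  inequality gives (1 - t^2/n^2)^n \<ge> 1 - t^2/n, and the left side factors into the powers of 1 -
  t/n and 1 + t/n, the second of which is at most \<open>exp t\<close>.\<close>

lemma exp_minus_ge_power:
  assumes "0 \<le> t" "t \<le> real n" "n > 0"
  shows "(1 - t / n) ^ n \<le> exp (- t)" "exp (- t) - (1 - t / n) ^ n \<le> t\<^sup>2 / n * exp (- t)"
proof -
  have u: "0 \<le> t / n" "t / n \<le> 1" using assms by (auto simp: field_simps)
  have "(1 - t / n) ^ n \<le> exp (- (t / n)) ^ n"
    using u exp_ge_add_one_self[of "- (t / n)"] by (intro power_mono) auto
  then show "(1 - t / n) ^ n \<le> exp (- t)"
    using assms by (simp add: exp_of_nat_mult[symmetric])
  have "1 - t\<^sup>2 / n = 1 + real n * (- (t / n)\<^sup>2)" using assms by (simp add: field_simps power2_eq_square)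
  also have "\<dots> \<le> (1 + (- (t / n)\<^sup>2)) ^ n"
    using u by (intro Bernoulli_inequality) (simp add: power_le_one)
  also have "\<dots> = (1 - t / n) ^ n * (1 + t / n) ^ n"
    by (simp add: power_mult_distrib[symmetric] power2_eq_square algebra_simps)
  also have "\<dots> \<le> (1 - t / n) ^ n * exp t"
  proof (rule mult_left_mono)
    have "(1 + t / n) ^ n \<le> exp (t / n) ^ n"
      using u by (intro power_mono) auto
    then show "(1 + t / n) ^ n \<le> exp t"
      using assms by (simp add: exp_of_nat_mult[symmetric])
  qed (use u in auto)
  finally have "(1 - t\<^sup>2 / n) * exp (- t) \<le> (1 - t / n) ^ n * exp t * exp (- t)"
    by (intro mult_right_mono) auto
  also have "\<dots> = (1 - t / n) ^ n" by (simp add: mult.assoc exp_minus_inverse)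
  finally show "exp (- t) - (1 - t / n) ^ n \<le> t\<^sup>2 / n * exp (- t)" by (simp add: algebra_simps)
qed

text \<open>\<open>A\<close> is \<open>\<integral>\<^sub>0\<^sup>z (1 - e\<^sup>-\<^sup>t) / t dt\<close>, compared with \<open>H\<^sub>n = \<integral>\<^sub>0\<^sup>n (1 - (1 - t/n)\<^sup>n) / t dt\<close>.\<close>
lemma exponential_integral_asymp:
  fixes A :: "real \<Rightarrow> real"
  assumes A0: "A 0 = 0" and A: "\<And>t. (A has_real_derivative (if t = 0 then 1 else (1 - exp (- t)) / t)) (at t)"
  shows "((\<lambda>z. A z - ln z) \<longlongrightarrow> euler_mascheroni) at_top"
proof -
  have harm: "\<bar>A (real n) - harm n\<bar> \<le> 1 / n" if n: "n > 0" for n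
  proof -
    \<comment> \<open>The integrand (1 - (1 - t/n)^n)/t is a geometric sum in 1 - t/n;
      \<open>\<phi>\<close> is its termwise antiderivative and takes the value \<open>harm n\<close>
      at n.\<close>
    define \<phi> where "\<phi> = (\<lambda>t. \<Sum>k<n. (1 - (1 - t / n) ^ Suc k) / real (Suc k))"
    define d where "d = (\<lambda>t. ((if t = 0 then 1 else (1 - exp (- t)) / t) - (\<Sum>k<n. (1 - t / n) ^ k) / n))"
    have \<phi>: "((\<lambda>t. A t - \<phi> t) has_real_derivative d t) (at t)" for t
    proof -
      have "((\<lambda>t. (1 - (1 - t / n) ^ Suc k) / real (Suc k)) has_real_derivative (1 - t / n) ^ k / n) (at t)" for k
      proof -
        have "((\<lambda>t. 1 - t / n) has_real_derivative - (1 / n)) (at t)"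
          using n by (auto intro!: derivative_eq_intros)
        from DERIV_cdivide[OF DERIV_diff[OF DERIV_const[of 1] DERIV_power[OF this, of "Suc k"]], of "real (Suc k)"]
        show ?thesis using n by (simp add: mult.assoc del: of_nat_Suc power_Suc)
      qed
      then have "(\<phi> has_real_derivative (\<Sum>k<n. (1 - t / n) ^ k / n)) (at t)"
        unfolding \<phi>_def by (intro DERIV_sum)
      then show ?thesis unfolding d_def sum_divide_distrib by (intro DERIV_diff A)
    qed
    have dt: "d t = ((1 - t / n) ^ n - exp (- t)) / t" if "t \<noteq> 0" for t
    proof -
      have "(\<Sum>k<n. (1 - t / n) ^ k) = (1 - (1 - t / n) ^ n) / (t / n)"
        using that n by (simp add: sum_gp_strict)
      then have "(\<Sum>k<n. (1 - t / n) ^ k) / n = (1 - (1 - t / n) ^ n) / t" using that n by simp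
      then show ?thesis using that by (simp add: d_def field_simps)
    qed
    have d: "d t \<le> 0" "- (t / n * exp (- t)) \<le> d t" if t: "0 \<le> t" "t \<le> real n" for t
    proof -
      show "d t \<le> 0"
      proof (cases "t = 0")
        case True then show ?thesis using n by (simp add: d_def)
      next
        case False
        show ?thesis unfolding dt[OF False] using exp_minus_ge_power(1)[OF t n] t by (simp add: divide_nonpos_nonneg)
      qed
      show "- (t / n * exp (- t)) \<le> d t"
      proof (cases "t = 0")
        case True then show ?thesis using n by (simp add: d_def)
      next
        case False
        have "- (t / n * exp (- t)) = - (t\<^sup>2 / n * exp (- t)) / t"
          using False by (simp add: power2_eq_square)
        moreover have "- (t\<^sup>2 / n * exp (- t)) / t \<le> ((1 - t / n) ^ n - exp (- t)) / t"
          using exp_minus_ge_power(2)[OF t n] t by (intro divide_right_mono) auto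
        ultimately show ?thesis unfolding dt[OF False] by simp
      qed
    qed
    have \<phi>0: "\<phi> 0 = 0" by (simp add: \<phi>_def)
    have "\<phi> n = (\<Sum>k<n. 1 / real (Suc k))" using n by (simp add: \<phi>_def)
    also have "\<dots> = harm n" unfolding harm_def inverse_eq_divide
      unfolding One_nat_def by (rule sum.atLeast1_atMost_eq[symmetric])
    finally have \<phi>n: "\<phi> n = harm n" .
    have "A n - \<phi> n \<le> A 0 - \<phi> 0"
      by (rule DERIV_nonpos_imp_nonincreasing[of 0 n "\<lambda>t. A t - \<phi> t"]) (use \<phi> d in auto)
    \<comment> \<open>The added term is an antiderivative of \<open>t / n * exp (- t)\<close>, the
      largest possible amount by which \<open>d t\<close> falls below 0. Its increment over [0, n]
      is at most 1/n.\<close>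
    moreover have "(A 0 - \<phi> 0) + (- (1 + 0) * exp (- 0)) / n \<le> (A n - \<phi> n) + (- (1 + real n) * exp (- real n)) / n"
    proof (rule DERIV_nonneg_imp_nondecreasing[of 0 n "\<lambda>t. (A t - \<phi> t) + (- (1 + t) * exp (- t)) / n"])
      fix t assume t: "0 \<le> t" "t \<le> real n"
      have "((\<lambda>t. (A t - \<phi> t) + (- (1 + t) * exp (- t)) / n) has_real_derivative d t + t / n * exp (- t)) (at t)"
        by (rule DERIV_add[OF \<phi>]) (use n in \<open>auto intro!: derivative_eq_intros simp: field_simps\<close>)
      then show "\<exists>y. ((\<lambda>t. (A t - \<phi> t) + (- (1 + t) * exp (- t)) / n) has_real_derivative y) (at t) \<and> y \<ge> 0"
        using d(2)[OF t] by fastforce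
    qed auto
    moreover have "(- (1 + real n) * exp (- real n)) / n \<le> 0"
      by (intro divide_nonpos_nonneg mult_nonpos_nonneg) auto
    ultimately show ?thesis using n by (simp add: \<phi>0 \<phi>n A0 abs_le_iff)
  qed
  define B where "B = (\<lambda>z. A z - ln z)"
  have lim: "(\<lambda>n. B (real n)) \<longlonglongrightarrow> euler_mascheroni"
  proof -
    have "(\<lambda>n. A (real n) - harm n) \<longlonglongrightarrow> 0"
    proof (rule Lim_null_comparison[OF _ lim_1_over_n])
      show "\<forall>\<^sub>F n in sequentially. norm (A (real n) - harm n) \<le> 1 / real n"
        using eventually_gt_at_top[of 0] by eventually_elim (simp only: real_norm_def harm)
    qed
    moreover have "(A (real n) - harm n) + (harm n - ln (real n)) = B (real n)" for n
      by (simp add: B_def)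
    ultimately show ?thesis using tendsto_add[OF _ euler_mascheroni_LIMSEQ, of "\<lambda>n. A (real n) - harm n" 0]
      by (simp only: add_0_left)
  qed
  \<comment> \<open>The derivative of \<open>A z - ln z\<close> is \<open>- exp (- z) / z\<close>,
    so this function decreases and its limit along the integers determines the limit along the
    reals.\<close>
  have mono: "B z \<le> B y" if "0 < y" "y \<le> z" for y z
  proof (rule DERIV_nonpos_imp_nonincreasing[of y z B])
    fix t assume "y \<le> t" "t \<le> z"
    then have "t > 0" using that by simp
    then have "(B has_real_derivative - exp (- t) / t) (at t)"
      unfolding B_def using DERIV_diff[OF A[of t] DERIV_ln_divide[of t]] by (simp add: diff_divide_distrib)
    then show "\<exists>y. (B has_real_derivative y) (at t) \<and> y \<le> 0"
      using \<open>t > 0\<close> by (intro exI[of _ "- exp (- t) / t"]) auto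
  qed (use that in auto)
  have fl: "filterlim (\<lambda>z::real. nat \<lfloor>z\<rfloor>) sequentially at_top"
    by (rule filterlim_compose[OF filterlim_nat_sequentially filterlim_floor_sequentially])
  show ?thesis unfolding B_def[symmetric]
  proof (rule tendsto_sandwich)
    show "((\<lambda>z::real. B (real (Suc (nat \<lfloor>z\<rfloor>)))) \<longlongrightarrow> euler_mascheroni) at_top"
      by (rule filterlim_compose[OF LIMSEQ_Suc[OF lim] fl])
    show "((\<lambda>z::real. B (real (nat \<lfloor>z\<rfloor>))) \<longlongrightarrow> euler_mascheroni) at_top"
      by (rule filterlim_compose[OF lim fl])
    show "\<forall>\<^sub>F z in at_top. B (real (Suc (nat \<lfloor>z\<rfloor>))) \<le> B z"
      using eventually_ge_at_top[of 1] by eventually_elim (intro mono, auto, linarith)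
    show "\<forall>\<^sub>F z in at_top. B z \<le> B (real (nat \<lfloor>z\<rfloor>))"
      using eventually_ge_at_top[of 1] by eventually_elim (intro mono, auto)
  qed
qed

text \<open>\<open>C\<close> is the real part, on the positive imaginary axis, of the entire
  function whose restriction to the positive axis is \<open>A\<close>. As \<open>P w - Ln w\<close>
  has the derivative \<open>- exp (- w) / w\<close>, its values at z and at iz differ by O(1/z), and
  \<open>Ln\<close> has the same real part at both points; hence \<open>C\<close> inherits the
  asymptotics of \<open>A\<close>.\<close>

lemma cosine_integral:
  obtains C :: "real \<Rightarrow> real" where "C 0 = 0" "continuous_on UNIV C"
    "\<And>z. z \<noteq> 0 \<Longrightarrow> (C has_real_derivative (1 - cos z) / z) (at z)"
    "((\<lambda>z. C z - ln z) \<longlongrightarrow> euler_mascheroni) at_top"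
proof -
  obtain P :: "complex \<Rightarrow> complex" where P0: "P 0 = 0"
    and P: "\<And>w. (P has_field_derivative (if w = 0 then 1 else (1 - exp (- w)) / w)) (at w)"
    using entire_exponential_integral by blast
  define C where "C = (\<lambda>z. Re (P (\<i> * of_real z)))"
  define A where "A = (\<lambda>z. Re (P (of_real z)))"
  have Pz: "((\<lambda>x. P (c * of_real x)) has_vector_derivative c * (if c * of_real t = 0 then 1 else (1 - exp (- (c * of_real t))) / (c * of_real t))) (at t)"
    for c t
    by (rule field_vector_diff_chain_at[OF _ P, of _ c t, unfolded o_def])
      (auto intro!: derivative_eq_intros has_vector_derivative_real_field)
  have C: "(C has_real_derivative Re (\<i> * (if \<i> * of_real t = 0 then 1 else (1 - exp (- (\<i> * of_real t))) / (\<i> * of_real t)))) (at t)" for t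
    unfolding C_def has_real_derivative_iff_has_vector_derivative
    by (rule bounded_linear.has_vector_derivative[OF bounded_linear_Re Pz])
  have A: "(A has_real_derivative (if t = 0 then 1 else (1 - exp (- t)) / t)) (at t)" for t
  proof -
    have "(A has_real_derivative Re (1 * (if 1 * complex_of_real t = 0 then 1 else (1 - exp (- (1 * of_real t))) / (1 * of_real t)))) (at t)"
      unfolding A_def has_real_derivative_iff_has_vector_derivative
      using bounded_linear.has_vector_derivative[OF bounded_linear_Re Pz[of 1 t]] by simp
    moreover have "Re ((1 - exp (- complex_of_real t)) / of_real t) = (1 - exp (- t)) / t"
    proof -
      have "(1 - exp (- complex_of_real t)) / of_real t = complex_of_real ((1 - exp (- t)) / t)"
        by (simp add: exp_of_real[symmetric])
      then show ?thesis by (simp only: Re_complex_of_real)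
    qed
    ultimately show ?thesis by (auto split: if_splits)
  qed
  have CA_Re: "C z - A z = Re ((P (\<i> * of_real z) - Ln (\<i> * of_real z)) - (P (of_real z) - Ln (of_real z)))" if "z > 0" for z
    using that by (simp add: C_def A_def Ln_times_ii Ln_of_real split: if_splits)
  have CA_norm: "norm ((P (\<i> * of_real z) - Ln (\<i> * of_real z)) - (P (of_real z) - Ln (of_real z))) \<le> 2 / z" if z: "z > 0" for z
  proof -
    \<comment> \<open>The straight path from z to iz. On it the modulus is at least z / sqrt 2 and
      the real part is z (1 - t), so the derivative along the path is at most 2 exp (- z (1 - t)),
      whose integral is below 2 / z.\<close>
    define w where "w = (\<lambda>t. of_real z * (1 - of_real t + \<i> * of_real t) :: complex)"
    have wder: "(w has_vector_derivative of_real z * (\<i> - 1)) (at t)" for t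
      unfolding w_def by (rule has_vector_derivative_real_field) (auto intro!: derivative_eq_intros simp: algebra_simps)
    have Re: "Re (w t) = z * (1 - t)" and Im: "Im (w t) = z * t" for t by (auto simp: w_def)
    have nw: "norm (w t) \<ge> z / sqrt 2" for t
    proof -
      have "1 / 2 \<le> (1 - t)\<^sup>2 + t\<^sup>2" using zero_le_power2[of "2 * t - 1"] by (simp add: power2_eq_square algebra_simps)
      then have "z\<^sup>2 * (1 / 2) \<le> z\<^sup>2 * ((1 - t)\<^sup>2 + t\<^sup>2)" by (intro mult_left_mono) auto
      then have "(z / sqrt 2)\<^sup>2 \<le> (norm (w t))\<^sup>2"
        by (simp add: cmod_power2 Re Im power_mult_distrib power_divide distrib_left)
      then show ?thesis by (rule power2_le_imp_le) auto
    qed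
    have w0: "w t \<notin> \<real>\<^sub>\<le>\<^sub>0" if "0 \<le> t" "t \<le> 1" for t
      using that z Re[of t] Im[of t] by (cases "t = 0") (auto simp: complex_nonpos_Reals_iff)
    let ?Q = "\<lambda>t. P (w t) - Ln (w t)" and ?Q' = "\<lambda>t. of_real z * (\<i> - 1) * (- exp (- w t) / w t)"
    have Q: "(?Q has_vector_derivative ?Q' t) (at t)" if "0 \<le> t" "t \<le> 1" for t
    proof -
      have "((\<lambda>w. P w - Ln w) has_field_derivative - exp (- w t) / w t) (at (w t))"
        using w0[OF that] P[of "w t"] by (auto intro!: derivative_eq_intros simp: field_simps)
      from field_vector_diff_chain_at[OF wder this] show ?thesis by (simp add: o_def)
    qed
    let ?\<psi> = "\<lambda>t. 2 * exp (- (z * (1 - t))) / z"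
    have "norm (?Q 1 - ?Q 0) \<le> ?\<psi> 1 - ?\<psi> 0"
    proof (rule differentiable_bound_general[of 0 1])
      show "continuous_on {0..1} ?Q"
        by (intro continuous_at_imp_continuous_on ballI has_vector_derivative_continuous[OF Q]) auto
      show "continuous_on {0..1} ?\<psi>" by (intro continuous_intros) (use z in auto)
      fix t :: real assume t: "0 < t" "t < 1"
      show "(?Q has_vector_derivative ?Q' t) (at t)" using t by (intro Q) auto
      show "(?\<psi> has_vector_derivative 2 * exp (- (z * (1 - t)))) (at t)"
        unfolding has_real_derivative_iff_has_vector_derivative[symmetric]
        using z by (auto intro!: derivative_eq_intros)
      have "norm (\<i> - 1) = sqrt 2" by (simp add: cmod_def)
      then have "norm (?Q' t) = z * sqrt 2 * exp (- (z * (1 - t))) / norm (w t)"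
        using z by (simp add: norm_mult norm_divide Re)
      also have "\<dots> \<le> z * sqrt 2 * exp (- (z * (1 - t))) / (z / sqrt 2)"
      proof (rule divide_left_mono)
        have "0 < z / sqrt 2" using z by simp
        moreover from this have "0 < norm (w t)" using nw[of t] by linarith
        ultimately show "0 < norm (w t) * (z / sqrt 2)" by (rule mult_pos_pos[rotated])
      qed (use nw z in auto)
      also have "\<dots> = 2 * exp (- (z * (1 - t)))" using z by (simp add: field_simps)
      finally show "norm (?Q' t) \<le> 2 * exp (- (z * (1 - t)))" .
    qed auto
    also have "\<dots> \<le> 2 / z" using z by simp
    finally show ?thesis by (simp add: w_def mult.commute)
  qed
  have CA: "\<bar>C z - A z\<bar> \<le> 2 / z" if "z > 0" for z
    unfolding CA_Re[OF that] by (rule order_trans[OF abs_Re_le_cmod CA_norm[OF that]])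
  have CA0: "((\<lambda>z. C z - A z) \<longlongrightarrow> 0) at_top"
  proof (rule Lim_null_comparison)
    show "\<forall>\<^sub>F z in at_top. norm (C z - A z) \<le> 2 / z"
      using eventually_gt_at_top[of 0] by eventually_elim (use CA in auto)
    show "((\<lambda>z::real. 2 / z) \<longlongrightarrow> 0) at_top" by real_asymp
  qed
  show ?thesis
  proof (rule that[of C])
    show "C 0 = 0" by (simp add: C_def P0)
    show "continuous_on UNIV C" using C by (intro continuous_at_imp_continuous_on) (auto dest: DERIV_isCont)
    show "(C has_real_derivative (1 - cos z) / z) (at z)" if "z \<noteq> 0" for z
    proof -
      have "Re (\<i> * (if \<i> * of_real z = 0 then 1 else (1 - exp (- (\<i> * of_real z))) / (\<i> * of_real z))) = (1 - cos z) / z"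
        using that by (simp add: Re_divide_of_real Re_exp)
      then show ?thesis using C[of z] by simp
    qed
    have "((\<lambda>z. A z - ln z) \<longlongrightarrow> euler_mascheroni) at_top"
      by (rule exponential_integral_asymp[OF _ A]) (simp add: A_def P0)
    from tendsto_add[OF CA0 this] show "((\<lambda>z. C z - ln z) \<longlongrightarrow> euler_mascheroni) at_top" by simp
  qed
qed

section \<open>The Fourier series of the parabola\<close>

lemma sum_cos_Dirichlet:
  fixes x :: real
  shows "2 * sin (x / 2) * (\<Sum>k<n. cos (real (Suc k) * x)) = sin ((real n + 1 / 2) * x) - sin (x / 2)"
proof (induction n)
  case (Suc n)
  have "2 * sin (x / 2) * cos (real (Suc n) * x) = sin ((real (Suc n) + 1 / 2) * x) - sin ((real n + 1 / 2) * x)"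
  proof -
    have "sin ((real (Suc n) + 1 / 2) * x) - sin ((real n + 1 / 2) * x) =
        sin (real (Suc n) * x + x / 2) - sin (real (Suc n) * x - x / 2)"
      by (simp add: algebra_simps)
    then show ?thesis by (simp add: sin_add sin_diff)
  qed
  with Suc.IH show ?case by (simp add: distrib_left del: of_nat_Suc)
qed simp

text \<open>The error of the sawtooth series has the derivative sin (my/2) / (2 sin (y/2)) with m =
  2n + 1. The term with the cosine in \<open>h\<close> is what one integration by parts splits off:
  after adding it the derivative is O(1/m). At y = pi all terms vanish, because m is odd, and the
  mean value theorem carries the bound from there to x.\<close>

lemma sawtooth_partial_sums:
  fixes \<delta> x :: real
  assumes \<delta>: "0 < \<delta>" "\<delta> \<le> pi" and x: "\<delta> \<le> x" "x \<le> 2 * pi - \<delta>"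
  shows "\<bar>(\<Sum>k<n. sin (real (Suc k) * x) / real (Suc k)) - (pi - x) / 2\<bar>
    \<le> (pi / (sin (\<delta> / 2))\<^sup>2 + 1 / sin (\<delta> / 2)) / (2 * real n + 1)"
proof -
  define c where "c = sin (\<delta> / 2)"
  define m where "m = 2 * real n + 1"
  have m: "m > 0" by (simp add: m_def add_nonneg_pos)
  have c: "c > 0" unfolding c_def using \<delta> by (intro sin_gt_zero) auto
  have sin: "sin (y / 2) \<ge> c" if "\<delta> \<le> y" "y \<le> 2 * pi - \<delta>" for y
  proof (cases "y \<le> pi")
    case True then show ?thesis unfolding c_def using that \<delta> by (intro sin_monotone_2pi_le) auto
  next
    case False
    have "sin (\<delta> / 2) \<le> sin (pi - y / 2)" using that \<delta> False by (intro sin_monotone_2pi_le) auto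
    then show ?thesis by (simp add: c_def)
  qed
  define h where "h = (\<lambda>y. (\<Sum>k<n. sin (real (Suc k) * y) / real (Suc k)) - (pi - y) / 2 + cos (m * y / 2) / (m * sin (y / 2)))"
  define h' where "h' = (\<lambda>y. - (cos (m * y / 2) * cos (y / 2)) / (2 * m * (sin (y / 2))\<^sup>2))"
  have der: "(h has_real_derivative h' y) (at y within {\<delta>..2 * pi - \<delta>})" if y: "y \<in> {\<delta>..2 * pi - \<delta>}" for y
  proof -
    have s: "sin (y / 2) > 0" using sin[of y] y c by auto
    have d1: "((\<lambda>y. sin (real (Suc k) * y) / real (Suc k)) has_real_derivative cos (real (Suc k) * y)) (at y)" for k
      by (auto intro!: derivative_eq_intros simp del: of_nat_Suc)
    have d2: "((\<lambda>y. \<Sum>k<n. sin (real (Suc k) * y) / real (Suc k)) has_real_derivative (\<Sum>k<n. cos (real (Suc k) * y))) (at y)"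
      by (intro DERIV_sum d1)
    have d3: "((\<lambda>y. cos (m * y / 2) / (m * sin (y / 2))) has_real_derivative
       ((- sin (m * y / 2) * (m / 2)) * (m * sin (y / 2)) - cos (m * y / 2) * (m * (cos (y / 2) * (1 / 2)))) / ((m * sin (y / 2)) * (m * sin (y / 2)))) (at y)"
      using s m by (auto intro!: derivative_eq_intros)
    have d4: "((\<lambda>y. (pi - y) / 2) has_real_derivative - 1 / 2) (at y)"
      by (auto intro!: derivative_eq_intros)
    have D: "(\<Sum>k<n. cos (real (Suc k) * y)) = (sin (m * y / 2) - sin (y / 2)) / (2 * sin (y / 2))"
      using sum_cos_Dirichlet[where x = y and n = n] s by (simp add: m_def field_simps)
    have "(\<Sum>k<n. cos (real (Suc k) * y)) - (- 1 / 2) + ((- sin (m * y / 2) * (m / 2)) * (m * sin (y / 2)) -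
        cos (m * y / 2) * (m * (cos (y / 2) * (1 / 2)))) / ((m * sin (y / 2)) * (m * sin (y / 2))) = h' y"
    proof -
      have alg: "(S - s) / (2 * s) - (- 1 / 2) + ((- S * (m / 2)) * (m * s) - C * (m * (E * (1 / 2)))) / ((m * s) * (m * s))
          = - (C * E) / (2 * m * s\<^sup>2)" if "s > 0" for S s C E :: real
        using that m by (simp add: field_simps power2_eq_square)
      show ?thesis unfolding D h'_def by (rule alg[OF s])
    qed
    with DERIV_add[OF DERIV_diff[OF d2 d4] d3] show ?thesis
      unfolding h_def by (simp add: has_field_derivative_at_within)
  qed
  have bound: "\<bar>h' y\<bar> \<le> 1 / (2 * m * c\<^sup>2)" if y: "y \<in> {\<delta>..2 * pi - \<delta>}" for y
  proof -
    have s: "sin (y / 2) \<ge> c" using sin[of y] y by auto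
    have "\<bar>h' y\<bar> = \<bar>cos (m * y / 2)\<bar> * \<bar>cos (y / 2)\<bar> / (2 * m * (sin (y / 2))\<^sup>2)"
      using m by (simp add: h'_def abs_mult)
    also have "\<dots> \<le> 1 * 1 / (2 * m * c\<^sup>2)"
      using s c m by (intro frac_le mult_mono power_mono) auto
    finally show ?thesis by simp
  qed
  have "norm (h x - h pi) \<le> 1 / (2 * m * c\<^sup>2) * norm (x - pi)"
    by (rule field_differentiable_bound[OF _ der]) (use bound x \<delta> in auto)
  also have "\<dots> \<le> 1 / (2 * m * c\<^sup>2) * (2 * pi)"
    using x \<delta> m by (intro mult_left_mono) auto
  finally have 1: "\<bar>h x - h pi\<bar> \<le> pi / c\<^sup>2 / m" by (simp add: mult.commute)
  have "sin (real (Suc k) * pi) = 0" for k using sin_npi[of "Suc k"] by (simp only:)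
  then have "(\<Sum>k<n. sin (real (Suc k) * pi) / real (Suc k)) = 0" by (simp only: div_0 sum.neutral_const)
  moreover have "cos (m * pi / 2) = 0"
    unfolding m_def cos_zero_iff by (rule disjI1, rule exI[of _ "2 * n + 1"]) (auto simp: field_simps)
  ultimately have "h pi = 0" by (simp only: h_def) simp
  then have 2: "\<bar>h x\<bar> \<le> pi / c\<^sup>2 / m" using 1 by simp
  have "\<bar>cos (m * x / 2) / (m * sin (x / 2))\<bar> = \<bar>cos (m * x / 2)\<bar> / (m * sin (x / 2))"
    using sin[OF x] c m by (simp add: abs_mult)
  also have "\<dots> \<le> 1 / (m * c)" using sin[OF x] c m by (intro frac_le mult_left_mono) auto
  finally have "\<bar>cos (m * x / 2) / (m * sin (x / 2))\<bar> \<le> 1 / c / m" by (simp add: mult.commute)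
  with 2 have "\<bar>h x - cos (m * x / 2) / (m * sin (x / 2))\<bar> \<le> pi / c\<^sup>2 / m + 1 / c / m" by linarith
  moreover have "(\<Sum>k<n. sin (real (Suc k) * x) / real (Suc k)) - (pi - x) / 2 = h x - cos (m * x / 2) / (m * sin (x / 2))"
    by (simp add: h_def)
  ultimately show ?thesis unfolding c_def[symmetric] m_def[symmetric] by (simp only: add_divide_distrib)
qed

lemma summable_inverse_Suc_square: "summable (\<lambda>n. c / (real (Suc n))\<^sup>2)"
proof -
  have "summable (\<lambda>n. c * (1 / (real (Suc n))\<^sup>2))"
    using sums_summable[OF inverse_squares_sums] by (intro summable_mult) (simp add: add.commute)
  then show ?thesis by simp
qed

text \<open>Differentiation gives the sawtooth series, which converges uniformly away from 0 and 2
  pi; so sum and parabola differ by a constant in between. Since the terms contain 1 - cos, the sum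
  is 0 at 0, and continuity there shows that the constant is 0.\<close>

lemma fourier_parabola:
  assumes "0 \<le> x" "x \<le> 2 * pi"
  shows "(\<lambda>n. (1 - cos (real (Suc n) * x)) / (real (Suc n))\<^sup>2) sums (x * (2 * pi - x) / 4)"
proof -
  define f where "f = (\<lambda>n y. (1 - cos (real (Suc n) * y)) / (real (Suc n))\<^sup>2)"
  define F where "F = (\<lambda>y. \<Sum>n. f n y)"
  have fb: "norm (f n y) \<le> 2 / (real (Suc n))\<^sup>2" for n y
  proof -
    have "norm (1 - cos (real (Suc n) * y)) \<le> 2" using cos_ge_minus_one[of "real (Suc n) * y"] cos_le_one[of "real (Suc n) * y"] by (simp only: real_norm_def)
    then show ?thesis unfolding f_def norm_divide by (intro frac_le) auto
  qed
  have sm: "(\<lambda>n. f n y) sums F y" for y unfolding F_def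
    by (intro summable_sums summable_comparison_test'[OF summable_inverse_Suc_square[of 2] fb])
  have unif: "uniform_limit UNIV (\<lambda>n y. \<Sum>i<n. f i y) F sequentially"
    unfolding F_def by (rule Weierstrass_m_test[OF fb summable_inverse_Suc_square])
  have cont: "continuous_on UNIV F"
    by (rule uniform_limit_theorem[OF _ unif]) (auto intro!: always_eventually continuous_intros simp: f_def)
  have const: "F y - y * (2 * pi - y) / 4 = F pi - pi\<^sup>2 / 4" if y: "0 < y" "y < 2 * pi" for y
  proof -
    \<comment> \<open>Chosen so that the interval on which the sawtooth estimate is uniform contains
      y as well as the reference point pi.\<close>
    define \<delta> where "\<delta> = min (min y (2 * pi - y)) pi"
    have \<delta>: "0 < \<delta>" "\<delta> \<le> pi" "\<delta> \<le> y" "y \<le> 2 * pi - \<delta>" using y by (auto simp: \<delta>_def)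
    define K where "K = pi / (sin (\<delta> / 2))\<^sup>2 + 1 / sin (\<delta> / 2)"
    define q where "q = (\<lambda>n y. (\<Sum>i<n. f i y) - y * (2 * pi - y) / 4)"
    have bd: "norm (q n y - q n pi) \<le> K / (2 * real n + 1) * norm (y - pi)" for n
    proof (rule field_differentiable_bound[of "{\<delta>..2 * pi - \<delta>}"])
      fix z assume z: "z \<in> {\<delta>..2 * pi - \<delta>}"
      have "(f k has_real_derivative sin (real (Suc k) * z) / real (Suc k)) (at z)" for k
      proof -
        have "(f k has_real_derivative (0 - (- sin (real (Suc k) * z) * real (Suc k))) / (real (Suc k))\<^sup>2) (at z)"
          unfolding f_def by (rule DERIV_cdivide) (auto intro!: derivative_eq_intros simp del: of_nat_Suc)
        then show ?thesis by (simp add: power2_eq_square del: of_nat_Suc)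
      qed
      then have "((\<lambda>z. \<Sum>k<n. f k z) has_real_derivative (\<Sum>k<n. sin (real (Suc k) * z) / real (Suc k))) (at z)"
        by (intro DERIV_sum)
      moreover have "((\<lambda>y. y * (2 * pi - y) / 4) has_real_derivative (pi - z) / 2) (at z)"
        by (auto intro!: derivative_eq_intros simp: field_simps)
      ultimately have "(q n has_real_derivative (\<Sum>k<n. sin (real (Suc k) * z) / real (Suc k)) - (pi - z) / 2) (at z)"
        unfolding q_def by (rule DERIV_diff)
      then show "(q n has_real_derivative (\<Sum>k<n. sin (real (Suc k) * z) / real (Suc k)) - (pi - z) / 2) (at z within {\<delta>..2 * pi - \<delta>})"
        by (rule has_field_derivative_at_within)
      show "norm ((\<Sum>k<n. sin (real (Suc k) * z) / real (Suc k)) - (pi - z) / 2) \<le> K / (2 * real n + 1)"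
        using sawtooth_partial_sums[OF \<delta>(1,2), of z n] z by (simp add: K_def)
    qed (use \<delta> in auto)
    have lim0: "(\<lambda>n. q n y - q n pi) \<longlonglongrightarrow> 0"
    proof (rule Lim_null_comparison)
      show "\<forall>\<^sub>F n in sequentially. norm (q n y - q n pi) \<le> K / (2 * real n + 1) * norm (y - pi)"
        by (intro always_eventually allI bd)
      show "(\<lambda>n. K / (2 * real n + 1) * norm (y - pi)) \<longlonglongrightarrow> 0" by real_asymp
    qed
    have "(\<lambda>n. q n y - q n pi) \<longlonglongrightarrow> (F y - y * (2 * pi - y) / 4) - (F pi - pi * (2 * pi - pi) / 4)"
      unfolding q_def by (intro tendsto_intros sm[unfolded sums_def]) auto
    from LIMSEQ_unique[OF this lim0] have "(F y - y * (2 * pi - y) / 4) - (F pi - pi * (2 * pi - pi) / 4) = 0" .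
    then show ?thesis by (simp add: power2_eq_square algebra_simps)
  qed
  have F0: "F 0 = 0" by (simp add: F_def f_def)
  have "F pi - pi\<^sup>2 / 4 = 0"
  proof -
    have "((\<lambda>y. F y - y * (2 * pi - y) / 4) \<longlongrightarrow> F 0 - 0 * (2 * pi - 0) / 4) (at_right 0)"
      using cont by (intro tendsto_intros) (auto simp: continuous_on_def filterlim_at_split intro: tendsto_within_subset)
    moreover have "\<forall>\<^sub>F y in at_right 0. F y - y * (2 * pi - y) / 4 = F pi - pi\<^sup>2 / 4"
      unfolding eventually_at_right_field by (intro exI[of _ "2 * pi"]) (auto intro: const)
    ultimately have "((\<lambda>y::real. F pi - pi\<^sup>2 / 4) \<longlongrightarrow> F 0 - 0 * (2 * pi - 0) / 4) (at_right 0)"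
      by (rule Lim_transform_eventually)
    then have "F pi - pi\<^sup>2 / 4 = F 0 - 0 * (2 * pi - 0) / 4"
      by (subst (asm) tendsto_const_iff) auto
    then show ?thesis by (simp add: F0)
  qed
  then have c: "F y = y * (2 * pi - y) / 4" if "0 < y" "y < 2 * pi" for y using const[OF that] by simp
  have "F (2 * pi) = 0"
  proof -
    have "cos (real (Suc n) * (2 * pi)) = 1" for n using cos_2npi[of "Suc n"] by (simp only: mult_ac)
    then show ?thesis by (simp add: F_def f_def)
  qed
  then have "F x = x * (2 * pi - x) / 4"
    using assms c[of x] F0 by (cases "x = 0"; cases "x = 2 * pi") auto
  from sm[of x, unfolded this] show ?thesis by (simp only: f_def)
qed

section \<open>The limit that defines Glaisher's constant\<close>

lemma has_integral_parabola_div: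
  "((\<lambda>x. frac x * (1 - frac x) / x) has_integral
     ((real N)\<^sup>2 / 2 - real N * (real N + 1) * ln (real N) + 2 * (\<Sum>k=1..N. real k * ln (real k)))) {0..real N}"
proof (induction N)
  case (Suc N)
  \<comment> \<open>Between N and N + 1 the integrand is (x - N)(N + 1 - x)/x = 2N + 1 - x - N(N +
    1)/x. For N = 0 the logarithm has the coefficient 0, so the antiderivative is continuous at 0
    too.\<close>
  let ?F = "\<lambda>x. (2 * real N + 1) * x - x\<^sup>2 / 2 - real N * (real N + 1) * ln x"
  have cont: "continuous_on {real N..real (Suc N)} ?F"
    by (cases "N = 0") (auto intro!: continuous_intros)
  have "((\<lambda>x. frac x * (1 - frac x) / x) has_integral ?F (real (Suc N)) - ?F (real N)) {real N..real (Suc N)}"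
  proof (rule fundamental_theorem_of_calculus_interior[OF _ cont])
    fix x assume x: "x \<in> {real N<..<real (Suc N)}"
    then have "\<lfloor>x\<rfloor> = int N" by (simp add: floor_eq_iff)
    then have fr: "frac x = x - real N" by (simp add: frac_def)
    have "x > 0" using x by (auto intro: le_less_trans[of 0 "real N"])
    then have "(?F has_real_derivative frac x * (1 - frac x) / x) (at x)"
      unfolding fr by (auto intro!: derivative_eq_intros simp: field_simps power2_eq_square)
    then show "(?F has_vector_derivative frac x * (1 - frac x) / x) (at x)"
      by (simp add: has_real_derivative_iff_has_vector_derivative)
  qed simp
  from has_integral_combine[OF _ _ Suc.IH this]
  have "((\<lambda>x. frac x * (1 - frac x) / x) has_integral
     ((real N)\<^sup>2 / 2 - real N * (real N + 1) * ln (real N) + 2 * (\<Sum>k=1..N. real k * ln (real k)))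
      + (?F (real (Suc N)) - ?F (real N))) {0..real (Suc N)}" by simp
  also have "((real N)\<^sup>2 / 2 - real N * (real N + 1) * ln (real N) + 2 * (\<Sum>k=1..N. real k * ln (real k)))
      + (?F (real (Suc N)) - ?F (real N)) =
     (real (Suc N))\<^sup>2 / 2 - real (Suc N) * (real (Suc N) + 1) * ln (real (Suc N)) + 2 * (\<Sum>k=1..Suc N. real k * ln (real k))"
    by (simp add: field_simps power2_eq_square)
  finally show ?case .
qed (simp add: has_integral_refl)

lemma fourier_parabola_frac:
  "(\<lambda>n. (1 - cos (real (Suc n) * (2 * pi * x))) / (real (Suc n))\<^sup>2) sums (pi\<^sup>2 * (frac x * (1 - frac x)))"
proof -
  have "cos (real (Suc n) * (2 * pi * x)) = cos (real (Suc n) * (2 * pi * frac x))" for n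
  proof -
    have "real (Suc n) * (2 * pi * x) = real (Suc n) * (2 * pi * frac x) + 2 * pi * of_int (int (Suc n) * \<lfloor>x\<rfloor>)"
      by (simp add: frac_def algebra_simps)
    then show ?thesis by (simp only: cos_add cos_int_2pin sin_int_2pin mult_1_right mult_zero_right diff_zero)
  qed
  moreover have "2 * pi * frac x * (2 * pi - 2 * pi * frac x) / 4 = pi\<^sup>2 * (frac x * (1 - frac x))"
    by (simp add: power2_eq_square field_simps)
  moreover have "2 * pi * frac x \<le> 2 * pi" using frac_lt_1[of x] mult_left_mono[of "frac x" 1 "2 * pi"] by simp
  moreover have "0 \<le> 2 * pi * frac x" using frac_ge_0[of x] by simp
  ultimately show ?thesis using fourier_parabola[of "2 * pi * frac x"] by (simp only:)
qed

lemma summable_ln_div_square: "summable (\<lambda>n. ln (real (Suc n)) / (real (Suc n))\<^sup>2)"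
proof (rule summable_comparison_test')
  have "summable (\<lambda>n. real n powr (- 3 / 2))" by (simp add: summable_real_powr_iff)
  then show "summable (\<lambda>n. 2 * real (Suc n) powr (- 3 / 2))"
    by (subst summable_Suc_iff) (rule summable_mult)
  fix n :: nat
  have "ln (real (Suc n)) \<le> real (Suc n) powr (1 / 2) / (1 / 2)" by (rule ln_powr_bound) auto
  then have "norm (ln (real (Suc n)) / (real (Suc n))\<^sup>2) \<le> 2 * real (Suc n) powr (1 / 2) / real (Suc n) powr 2"
    by (simp add: divide_right_mono powr_numeral del: of_nat_Suc)
  also have "\<dots> = 2 * real (Suc n) powr (- 3 / 2)"
  proof -
    have "real (Suc n) powr (1 / 2) / real (Suc n) powr 2 = real (Suc n) powr (1 / 2 - 2)" by (simp only: powr_diff)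
    also have "(1 / 2 - 2 :: real) = - 3 / 2" by simp
    finally show ?thesis by (simp only: times_divide_eq_right[symmetric])
  qed
  finally show "norm (ln (real (Suc n)) / (real (Suc n))\<^sup>2) \<le> 2 * real (Suc n) powr (- 3 / 2)" .
qed

lemma glaisher_eq:
  "glaisher > 0"
  "24 * ln glaisher = 2 * euler_mascheroni + 2 * ln (2 * pi) + 12 / pi\<^sup>2 * (\<Sum>n. ln (real (Suc n)) / (real (Suc n))\<^sup>2)"
proof -
  obtain C :: "real \<Rightarrow> real" where C0: "C 0 = 0" and Ccont: "continuous_on UNIV C"
    and C: "\<And>z. z \<noteq> 0 \<Longrightarrow> (C has_real_derivative (1 - cos z) / z) (at z)"
    and Clim: "((\<lambda>z. C z - ln z) \<longlongrightarrow> euler_mascheroni) at_top"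
    using cosine_integral by blast
  define E where "E = (\<lambda>N. (real N)\<^sup>2 / 2 - real N * (real N + 1) * ln (real N) + 2 * (\<Sum>k=1..N. real k * ln (real k)))"
  define Ls where "Ls = (\<Sum>n. ln (real (Suc n)) / (real (Suc n))\<^sup>2)"
  have trm: "((\<lambda>x. (1 - cos (real (Suc n) * (2 * pi * x))) / (real (Suc n))\<^sup>2 / x) has_integral
      C (2 * pi * real (Suc n) * real N) / (real (Suc n))\<^sup>2) {0..real N}" for n N
  proof -
    let ?a = "2 * pi * real (Suc n)"
    have a: "?a > 0" by simp
    have "((\<lambda>x. (1 - cos (?a * x)) / x) has_integral C (?a * real N) - C (?a * 0)) {0..real N}"
    proof (rule fundamental_theorem_of_calculus_interior)
      show "continuous_on {0..real N} (\<lambda>x. C (?a * x))"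
        by (rule continuous_on_compose2[OF Ccont]) (auto intro!: continuous_intros)
      fix x assume x: "x \<in> {0<..<real N}"
      have "((\<lambda>x. C (?a * x)) has_real_derivative (1 - cos (?a * x)) / (?a * x) * (?a * 1)) (at x)"
        by (rule DERIV_chain2[OF C]) (use x a in \<open>auto intro!: derivative_eq_intros\<close>)
      also have "(1 - cos (?a * x)) / (?a * x) * (?a * 1) = (1 - cos (?a * x)) / x" using a x by simp
      finally show "((\<lambda>x. C (?a * x)) has_vector_derivative (1 - cos (?a * x)) / x) (at x)"
        by (simp only: has_real_derivative_iff_has_vector_derivative)
    qed simp
    from has_integral_divide[OF this, of "(real (Suc n))\<^sup>2"] show ?thesis
      by (simp add: C0 mult_ac del: of_nat_Suc)
  qed
  define c where "c = (\<lambda>N n. C (2 * pi * real (Suc n) * real N) / (real (Suc n))\<^sup>2)"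
  have c_nonneg: "c N n \<ge> 0" for N n
    unfolding c_def
  proof (rule has_integral_nonneg[OF trm])
    fix x assume "x \<in> {0..real N}"
    then show "0 \<le> (1 - cos (real (Suc n) * (2 * pi * x))) / (real (Suc n))\<^sup>2 / x"
      using cos_le_one[of "real (Suc n) * (2 * pi * x)"] by (intro divide_nonneg_nonneg) auto
  qed
  \<comment> \<open>The asymptotics of \<open>C\<close> hold for all arguments beyond some b, and 2
    pi (n + 1) N is at least N. So a single threshold for N serves all n, and the errors are
    summable with weight 1/(n + 1)^2.\<close>
  have lim_err: "\<forall>\<^sub>F N in sequentially. \<forall>n. \<bar>c N n - (ln (2 * pi) + euler_mascheroni + ln (real N) + ln (real (Suc n))) / (real (Suc n))\<^sup>2\<bar> \<le> \<epsilon> / (real (Suc n))\<^sup>2"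
    if "\<epsilon> > 0" for \<epsilon>
  proof -
    from Clim that have "\<forall>\<^sub>F z in at_top. dist (C z - ln z) euler_mascheroni < \<epsilon>" by (rule tendstoD)
    then obtain b where b: "\<And>z. z \<ge> b \<Longrightarrow> dist (C z - ln z) euler_mascheroni < \<epsilon>"
      by (auto simp: eventually_at_top_linorder)
    show ?thesis
    proof (rule eventually_mono[OF eventually_gt_at_top[of "nat \<lceil>\<bar>b\<bar>\<rceil>"]], intro allI)
      fix N n assume N: "nat \<lceil>\<bar>b\<bar>\<rceil> < N"
      then have Nb: "real N \<ge> b" "N > 0" by linarith+
      have "1 * real N \<le> (2 * pi * real (Suc n)) * real N"
      proof (rule mult_right_mono)
        have "1 * 1 \<le> (2 * pi) * real (Suc n)" using pi_ge_two by (intro mult_mono) auto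
        then show "1 \<le> 2 * pi * real (Suc n)" by simp
      qed simp
      then have z: "2 * pi * real (Suc n) * real N \<ge> b" using Nb(1) by linarith
      have "ln (2 * pi * real (Suc n) * real N) = ln (2 * pi) + ln (real (Suc n)) + ln (real N)"
        using Nb by (simp add: ln_mult del: of_nat_Suc)
      with b[OF z] have "\<bar>C (2 * pi * real (Suc n) * real N) - (ln (2 * pi) + euler_mascheroni + ln (real N) + ln (real (Suc n)))\<bar> \<le> \<epsilon>"
        by (simp add: dist_real_def algebra_simps del: of_nat_Suc)
      then have "\<bar>C (2 * pi * real (Suc n) * real N) - (ln (2 * pi) + euler_mascheroni + ln (real N) + ln (real (Suc n)))\<bar> / (real (Suc n))\<^sup>2 \<le> \<epsilon> / (real (Suc n))\<^sup>2"
        by (rule divide_right_mono) simp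
      then show "\<bar>c N n - (ln (2 * pi) + euler_mascheroni + ln (real N) + ln (real (Suc n))) / (real (Suc n))\<^sup>2\<bar> \<le> \<epsilon> / (real (Suc n))\<^sup>2"
        by (simp add: c_def diff_divide_distrib[symmetric] del: of_nat_Suc)
    qed
  qed
  have basel: "(\<lambda>n. 1 / (real (Suc n))\<^sup>2) sums (pi\<^sup>2 / 6)" using inverse_squares_sums by (simp add: add.commute)
  have main: "(\<lambda>n. (a + ln (real (Suc n))) / (real (Suc n))\<^sup>2) sums (a * (pi\<^sup>2 / 6) + Ls)" for a
    using sums_add[OF sums_mult[OF basel, of a] summable_sums[OF summable_ln_div_square]]
    by (simp add: add_divide_distrib Ls_def del: of_nat_Suc)
  \<comment> \<open>Every term of the Fourier series is nonnegative after division by x, so monotone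
    convergence allows termwise integration; summability of \<open>c N\<close> keeps the partial
    integrals bounded.\<close>
  have sums_E: "c N sums (pi\<^sup>2 * E N)" if csum: "summable (c N)" for N
  proof -
    let ?f = "\<lambda>M x. \<Sum>n<M. (1 - cos (real (Suc n) * (2 * pi * x))) / (real (Suc n))\<^sup>2 / x"
    have f: "(?f M has_integral (\<Sum>n<M. c N n)) {0..real N}" for M
      unfolding c_def by (intro has_integral_sum trm) auto
    have "(\<lambda>x. pi\<^sup>2 * (frac x * (1 - frac x) / x)) integrable_on {0..real N} \<and>
       (\<lambda>M. integral {0..real N} (?f M)) \<longlonglongrightarrow> integral {0..real N} (\<lambda>x. pi\<^sup>2 * (frac x * (1 - frac x) / x))"
    proof (rule monotone_convergence_increasing)
      show "?f M integrable_on {0..real N}" for M using f by blast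
      show "?f M x \<le> ?f (Suc M) x" if "x \<in> {0..real N}" for M x
        using that cos_le_one[of "real (Suc M) * (2 * pi * x)"] by (simp add: divide_nonneg_nonneg del: of_nat_Suc)
      show "(\<lambda>M. ?f M x) \<longlonglongrightarrow> pi\<^sup>2 * (frac x * (1 - frac x) / x)" for x
        using sums_divide[OF fourier_parabola_frac[of x], of x] by (simp add: sums_def del: of_nat_Suc)
      have "integral {0..real N} (?f M) \<in> {0..suminf (c N)}" for M
        using integral_unique[OF f[of M]] c_nonneg csum by (auto intro!: sum_nonneg sum_le_suminf)
      then show "bounded (range (\<lambda>M. integral {0..real N} (?f M)))"
        by (intro bounded_subset[OF bounded_closed_interval[of 0 "suminf (c N)"]]) (rule image_subsetI)
    qed
    then have "(\<lambda>M. \<Sum>n<M. c N n) \<longlonglongrightarrow> integral {0..real N} (\<lambda>x. pi\<^sup>2 * (frac x * (1 - frac x) / x))"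
      by (simp only: integral_unique[OF f])
    also have "integral {0..real N} (\<lambda>x. pi\<^sup>2 * (frac x * (1 - frac x) / x)) = pi\<^sup>2 * E N"
      by (intro integral_unique has_integral_mult_right) (simp only: E_def has_integral_parabola_div)
    finally show ?thesis by (simp add: sums_def)
  qed
  have lim_E: "(\<lambda>N. E N - ln (real N) / 6) \<longlonglongrightarrow> (ln (2 * pi) + euler_mascheroni) / 6 + Ls / pi\<^sup>2"
  proof (rule LIMSEQ_I)
    fix r :: real assume r: "r > 0"
    \<comment> \<open>Summing the errors gives a factor pi^2/6, and division by pi^2 turns 3r into
      r/2.\<close>
    then have "3 * r > 0" by simp
    from lim_err[OF this] obtain N0 where N0: "\<And>N n. N \<ge> N0 \<Longrightarrow>
       \<bar>c N n - (ln (2 * pi) + euler_mascheroni + ln (real N) + ln (real (Suc n))) / (real (Suc n))\<^sup>2\<bar> \<le> 3 * r / (real (Suc n))\<^sup>2"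
      unfolding eventually_sequentially by blast
    have "norm (E N - ln (real N) / 6 - ((ln (2 * pi) + euler_mascheroni) / 6 + Ls / pi\<^sup>2)) < r" if N: "N \<ge> N0" for N
    proof -
      let ?a = "ln (2 * pi) + euler_mascheroni + ln (real N)"
      let ?d = "\<lambda>n. c N n - (?a + ln (real (Suc n))) / (real (Suc n))\<^sup>2"
      have sd: "summable (\<lambda>n. norm (?d n))"
        by (rule summable_comparison_test'[OF summable_inverse_Suc_square[of "3 * r"]]) (use N0[OF N] in simp)
      then have "summable ?d" by (rule summable_norm_cancel)
      from summable_add[OF this sums_summable[OF main[of ?a]]] have "summable (c N)" by simp
      from sums_diff[OF sums_E[OF this] main[of ?a]] have d: "suminf ?d = pi\<^sup>2 * E N - (?a * (pi\<^sup>2 / 6) + Ls)"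
        by (simp add: sums_iff)
      have "norm (suminf ?d) \<le> (\<Sum>n. norm (?d n))" by (rule summable_norm[OF sd])
      also have "\<dots> \<le> (\<Sum>n. 3 * r / (real (Suc n))\<^sup>2)"
        by (rule suminf_le[OF _ sd summable_inverse_Suc_square]) (use N0[OF N] in simp)
      also have "\<dots> = 3 * r * (pi\<^sup>2 / 6)" using sums_mult[OF basel, of "3 * r"] by (simp add: sums_iff)
      finally have "\<bar>pi\<^sup>2 * E N - (?a * (pi\<^sup>2 / 6) + Ls)\<bar> / pi\<^sup>2 \<le> 3 * r * (pi\<^sup>2 / 6) / pi\<^sup>2"
        unfolding d real_norm_def by (rule divide_right_mono) simp
      also have "\<bar>pi\<^sup>2 * E N - (?a * (pi\<^sup>2 / 6) + Ls)\<bar> / pi\<^sup>2 = \<bar>(pi\<^sup>2 * E N - (?a * (pi\<^sup>2 / 6) + Ls)) / pi\<^sup>2\<bar>" by simp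
      also have "(pi\<^sup>2 * E N - (?a * (pi\<^sup>2 / 6) + Ls)) / pi\<^sup>2 = E N - ln (real N) / 6 - ((ln (2 * pi) + euler_mascheroni) / 6 + Ls / pi\<^sup>2)"
        by (simp add: field_simps)
      finally show ?thesis using r by simp
    qed
    then show "\<exists>N0. \<forall>N\<ge>N0. norm (E N - ln (real N) / 6 - ((ln (2 * pi) + euler_mascheroni) / 6 + Ls / pi\<^sup>2)) < r" by blast
  qed
  have gl: "(\<Prod>k=1..N. real k ^ k) / (real N powr (real N ^ 2 / 2 + real N / 2 + 1 / 12) * exp (- (real N ^ 2) / 4)) =
      exp ((E N - ln (real N) / 6) / 2)" if N: "N > 0" for N
  proof -
    have "real k ^ k = exp (real k * ln (real k))" if "k \<in> {1..N}" for k
      using that by (simp add: exp_of_nat_mult)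
    then have "(\<Prod>k=1..N. real k ^ k) = exp (\<Sum>k=1..N. real k * ln (real k))"
      by (simp add: exp_sum)
    moreover have "real N powr (real N ^ 2 / 2 + real N / 2 + 1 / 12) = exp ((real N ^ 2 / 2 + real N / 2 + 1 / 12) * ln (real N))"
      using N by (simp add: powr_def)
    ultimately show ?thesis
      by (simp add: exp_add[symmetric] exp_diff[symmetric] E_def field_simps power2_eq_square)
  qed
  let ?L = "((ln (2 * pi) + euler_mascheroni) / 6 + Ls / pi\<^sup>2) / 2"
  have "(\<lambda>N. exp ((E N - ln (real N) / 6) / 2)) \<longlonglongrightarrow> exp ?L"
    by (intro tendsto_intros lim_E) auto
  then have "(\<lambda>N. (\<Prod>k=1..N. real k ^ k) / (real N powr (real N ^ 2 / 2 + real N / 2 + 1 / 12) * exp (- (real N ^ 2) / 4))) \<longlonglongrightarrow> exp ?L"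
    by (rule Lim_transform_eventually) (use eventually_gt_at_top[of 0] in eventually_elim, simp only: gl)
  then have g: "glaisher = exp ?L" unfolding glaisher_def by (rule limI)
  show "glaisher > 0" unfolding g by (rule exp_gt_zero)
  show "24 * ln glaisher = 2 * euler_mascheroni + 2 * ln (2 * pi) + 12 / pi\<^sup>2 * (\<Sum>n. ln (real (Suc n)) / (real (Suc n))\<^sup>2)"
    unfolding g Ls_def[symmetric] by (simp add: field_simps)
qed

subsection \<open>Dirichlet series and sums over multiples\<close>

lemma summable_on_product_of_summable:
  fixes u v :: "nat \<Rightarrow> 'a :: {banach, real_normed_field}"
  assumes "summable (\<lambda>n. norm (u (Suc n)))" "summable (\<lambda>n. norm (v (Suc n)))"
  shows "(\<lambda>(d, k). u d * v k) summable_on {0<..} \<times> {0<..}"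
proof -
  have u: "(\<lambda>n. norm (u n)) summable_on {0<..}" and v: "(\<lambda>n. norm (v n)) summable_on {0<..}"
    using assms infsum_positive_nat(2)[of "\<lambda>n. norm (u n)"] infsum_positive_nat(2)[of "\<lambda>n. norm (v n)"] by simp_all
  have "(\<lambda>z. norm (case z of (d, k) \<Rightarrow> u d * v k)) summable_on {0<..} \<times> {0<..}"
    unfolding Infinite_Sum.abs_summable_on_Sigma_iff
  proof (intro conjI ballI)
    show "(\<lambda>k. norm (case (d, k) of (d, k) \<Rightarrow> u d * v k)) summable_on {0<..}" for d
      using summable_on_cmult_right[OF v, of "norm (u d)"] by (simp add: norm_mult)
    have "(\<lambda>d. norm (u d) * (\<Sum>\<^sub>\<infinity>k\<in>{0<..}. norm (v k))) summable_on {0<..}"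
      by (rule summable_on_cmult_left[OF u])
    then show "(\<lambda>d. norm (\<Sum>\<^sub>\<infinity>k\<in>{0<..}. norm (case (d, k) of (d, k) \<Rightarrow> u d * v k))) summable_on {0<..}"
      by (simp add: norm_mult infsum_cmult_right' infsum_nonneg abs_mult)
  qed
  then show ?thesis by (rule abs_summable_summable)
qed

lemma summable_on_positive_nat_sums:
  fixes f :: "nat \<Rightarrow> real"
  assumes "f summable_on {0<..}"
  shows "(\<lambda>n. f (Suc n)) sums infsum f {0<..}" and "summable (\<lambda>n. norm (f (Suc n)))"
proof -
  have bij: "bij_betw Suc UNIV {0<..}"
    by (rule bij_betw_byWitness[where f' = "\<lambda>n. n - 1"]) auto
  have sums: "(\<lambda>n. g (Suc n)) sums infsum g {0<..}" if "g summable_on {0<..}" for g :: "nat \<Rightarrow> real"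
    using has_sum_infsum[OF that] has_sum_reindex_bij_betw[OF bij, of g] by (intro has_sum_imp_sums) simp
  from assms show "(\<lambda>n. f (Suc n)) sums infsum f {0<..}" by (rule sums)
  have "(\<lambda>n. norm (f n)) summable_on {0<..}"
    using assms summable_on_iff_abs_summable_on_real by blast
  from sums[OF this] show "summable (\<lambda>n. norm (f (Suc n)))" by (rule sums_summable)
qed

lemma Dirichlet_product:
  fixes u v :: "nat \<Rightarrow> 'a :: {banach, real_normed_field}"
  assumes u: "summable (\<lambda>n. norm (u (Suc n)))" and v: "summable (\<lambda>n. norm (v (Suc n)))"
  shows "(\<Sum>n. u (Suc n)) * (\<Sum>n. v (Suc n)) = (\<Sum>\<^sub>\<infinity>n\<in>{0<..}. \<Sum>d | d dvd n. u d * v (n div d))"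
    and "(\<lambda>n. \<Sum>d | d dvd n. u d * v (n div d)) summable_on {0<..}"
proof -
  let ?g = "\<lambda>d n. u d * v (n div d)"
  have sm: "(\<lambda>(d, k). ?g d (d ^ 1 * k)) summable_on {0<..} \<times> {0<..}"
    using summable_on_product_of_summable[OF u v] by (rule summable_on_cong[THEN iffD1, rotated]) auto
  have "(\<Sum>n. u (Suc n)) * (\<Sum>n. v (Suc n)) = infsum u {0<..} * infsum v {0<..}"
    by (simp only: infsum_positive_nat(1)[OF u] infsum_positive_nat(1)[OF v])
  also have "\<dots> = (\<Sum>\<^sub>\<infinity>d\<in>{0<..}. \<Sum>\<^sub>\<infinity>k\<in>{0<..}. u d * v k)"
    by (simp only: infsum_cmult_right' infsum_cmult_left')
  also have "\<dots> = (\<Sum>\<^sub>\<infinity>d\<in>{0<..}. \<Sum>\<^sub>\<infinity>k\<in>{0<..}. ?g d (d ^ 1 * k))"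
    by (intro infsum_cong) auto
  also have "\<dots> = (\<Sum>\<^sub>\<infinity>n\<in>{0<..}. \<Sum>d | d ^ 1 dvd n. ?g d n)"
    by (rule infsum_power_divisor[OF _ sm]) simp
  finally show "(\<Sum>n. u (Suc n)) * (\<Sum>n. v (Suc n)) = (\<Sum>\<^sub>\<infinity>n\<in>{0<..}. \<Sum>d | d dvd n. u d * v (n div d))" by simp
  show "(\<lambda>n. \<Sum>d | d dvd n. u d * v (n div d)) summable_on {0<..}"
    using infsum_power_divisor(2)[OF _ sm] by simp
qed

lemma abs_moebius_mu_le: "\<bar>real_of_int (moebius_mu n)\<bar> \<le> 1"
  using abs_moebius_mu[of n] by (simp flip: of_int_abs)

lemma norm_moebius_mu_le: "norm (of_int (moebius_mu n) :: complex) \<le> 1"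
  using abs_moebius_mu_le[of n] by simp

lemma infsum_single_one: "(\<Sum>\<^sub>\<infinity>n\<in>{0::nat<..}. if n = 1 then c else 0) = c"
  by (rule infsumI, rule has_sum_finite_neutralI[of "{1}"]) auto

text \<open>The Dirichlet product of the Moebius function with the constant 1 is supported at n = 1.
  In particular \<open>zeta w\<close> does not vanish for \<open>Re w > 1\<close>, which makes the
  division by \<open>zeta (2 * s)\<close> meaningful.\<close>

lemma moebius_Dirichlet_series:
  assumes w: "Re w > 1"
  shows "(\<Sum>n. of_int (moebius_mu (Suc n)) * of_nat (Suc n) powr (- w)) * zeta w = 1"
    and "summable (\<lambda>n. norm (of_int (moebius_mu (Suc n)) * complex_of_nat (Suc n) powr (- w)))"
proof -
  let ?u = "\<lambda>n. of_int (moebius_mu n) * complex_of_nat n powr (- w)" and ?v = "\<lambda>n. complex_of_nat n powr (- w)"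
  show u: "summable (\<lambda>n. norm (?u (Suc n)))"
  proof (rule summable_comparison_test'[OF summable_norm_Suc_powr[OF w]])
    show "norm (norm (?u (Suc n))) \<le> norm (?v (Suc n))" for n
      using norm_moebius_mu_le[of "Suc n"] mult_right_mono[of _ 1 "norm (?v (Suc n))"] by (simp add: norm_mult del: of_nat_Suc)
  qed
  have "(\<Sum>n. ?u (Suc n)) * zeta w = (\<Sum>n. ?u (Suc n)) * (\<Sum>n. ?v (Suc n))"
    by (simp only: zeta_eq_suminf[OF w])
  also have "\<dots> = (\<Sum>\<^sub>\<infinity>n\<in>{0<..}. \<Sum>d | d dvd n. ?u d * ?v (n div d))"
    by (rule Dirichlet_product(1)[OF u summable_norm_Suc_powr[OF w]])
  also have "\<dots> = (\<Sum>\<^sub>\<infinity>n\<in>{0::nat<..}. if n = 1 then 1 else 0)"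
  proof (rule infsum_cong)
    fix n :: nat assume n: "n \<in> {0<..}"
    have "?u d * ?v (n div d) = of_int (moebius_mu d) * of_nat n powr (- w)" if dvd: "d dvd n" for d
    proof -
      obtain k where k: "n = d * k" using dvd by (elim dvdE)
      then have "d > 0" "k > 0" using n by auto
      then have "complex_of_real (real d) powr (- w) * of_real (real k) powr (- w) = of_real (real d * real k) powr (- w)"
        by (subst of_real_mult, subst powr_times_real) auto
      then show ?thesis using \<open>d > 0\<close> by (simp add: k mult.assoc)
    qed
    then have "(\<Sum>d | d dvd n. ?u d * ?v (n div d)) = (\<Sum>d | d dvd n. of_int (moebius_mu d)) * of_nat n powr (- w)"
      unfolding sum_distrib_right by (intro sum.cong) auto
    also have "(\<Sum>d | d dvd n. complex_of_int (moebius_mu d)) = of_int (\<Sum>d | d dvd n. moebius_mu d)"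
      by simp
    also have "\<dots> * of_nat n powr (- w) = (if n = 1 then 1 else 0)"
      using n by (subst sum_moebius_divisors) auto
    finally show "(\<Sum>d | d dvd n. ?u d * ?v (n div d)) = (if n = 1 then 1 else 0)" .
  qed
  also have "\<dots> = 1" by (rule infsum_single_one)
  finally show "(\<Sum>n. ?u (Suc n)) * zeta w = 1" .
qed

text \<open>These are 1/zeta(2) and zeta'(2)/zeta(2)^2. Instead of differentiating, the second is
  read off from Dirichlet products: ln is additive over n = d k, so the two products containing a
  logarithm add up to ln n times the divisor sum of the Moebius function, which is 0 also for n =
  1.\<close>

lemma moebius_sums_square:
  "(\<lambda>n. of_int (moebius_mu (Suc n)) / (real (Suc n))\<^sup>2) sums (6 / pi\<^sup>2)"
  "(\<lambda>n. of_int (moebius_mu (Suc n)) * ln (real (Suc n)) / (real (Suc n))\<^sup>2) sums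
     (- 36 / pi ^ 4 * (\<Sum>n. ln (real (Suc n)) / (real (Suc n))\<^sup>2))"
proof -
  let ?u = "\<lambda>n. of_int (moebius_mu n) / (real n)\<^sup>2" and ?v = "\<lambda>n. 1 / (real n)\<^sup>2"
  let ?ul = "\<lambda>n. of_int (moebius_mu n) * ln (real n) / (real n)\<^sup>2" and ?vl = "\<lambda>n. ln (real n) / (real n)\<^sup>2"
  have basel: "(\<lambda>n. ?v (Suc n)) sums (pi\<^sup>2 / 6)" using inverse_squares_sums by (simp add: add.commute)
  have v: "summable (\<lambda>n. norm (?v (Suc n)))" using basel by (simp add: sums_summable)
  have vl: "summable (\<lambda>n. norm (?vl (Suc n)))" using summable_ln_div_square by simp
  have u: "summable (\<lambda>n. norm (?u (Suc n)))"
    by (rule summable_comparison_test'[OF v]) (use abs_moebius_mu_le in \<open>auto simp: divide_right_mono\<close>)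
  have ul: "summable (\<lambda>n. norm (?ul (Suc n)))"
  proof (rule summable_comparison_test'[OF vl])
    show "norm (norm (?ul (Suc n))) \<le> norm (?vl (Suc n))" for n
      using mult_right_mono[OF abs_moebius_mu_le[of "Suc n"], of "\<bar>ln (real (Suc n))\<bar>"]
      by (simp add: abs_mult divide_right_mono del: of_nat_Suc)
  qed
  have mu_sum: "(\<Sum>d | d dvd n. of_int (moebius_mu d)) = (if n = 1 then 1 else 0 :: real)" if "n > 0" for n
    using arg_cong[OF sum_moebius_divisors[OF that], of real_of_int] by simp
  have 1: "(\<Sum>n. ?u (Suc n)) * (\<Sum>n. ?v (Suc n)) = 1"
  proof -
    have "(\<Sum>n. ?u (Suc n)) * (\<Sum>n. ?v (Suc n)) = (\<Sum>\<^sub>\<infinity>n\<in>{0<..}. \<Sum>d | d dvd n. ?u d * ?v (n div d))"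
      by (rule Dirichlet_product(1)[OF u v])
    also have "\<dots> = (\<Sum>\<^sub>\<infinity>n\<in>{0::nat<..}. if n = 1 then 1 else 0)"
    proof (rule infsum_cong)
      fix n :: nat assume n: "n \<in> {0<..}"
      have "?u d * ?v (n div d) = of_int (moebius_mu d) / (real n)\<^sup>2" if "d dvd n" for d
        using that n by (auto elim!: dvdE simp: power_mult_distrib)
      then have "(\<Sum>d | d dvd n. ?u d * ?v (n div d)) = (\<Sum>d | d dvd n. of_int (moebius_mu d)) / (real n)\<^sup>2"
        unfolding sum_divide_distrib by (intro sum.cong) auto
      then show "(\<Sum>d | d dvd n. ?u d * ?v (n div d)) = (if n = 1 then 1 else 0)"
        using n by (simp add: mu_sum)
    qed
    also have "\<dots> = 1" by (rule infsum_single_one)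
    finally show ?thesis .
  qed
  have V: "(\<Sum>n. ?v (Suc n)) = pi\<^sup>2 / 6" using basel by (simp only: sums_iff)
  have su: "(\<Sum>n. ?u (Suc n)) = 6 / pi\<^sup>2"
    using 1 unfolding V by (simp add: field_simps)
  have smu: "summable (\<lambda>n. ?u (Suc n))" using u by (rule summable_norm_cancel)
  show "(\<lambda>n. ?u (Suc n)) sums (6 / pi\<^sup>2)"
    using summable_sums[OF smu] by (simp only: su)
  have 2: "(\<Sum>n. ?ul (Suc n)) * (\<Sum>n. ?v (Suc n)) + (\<Sum>n. ?u (Suc n)) * (\<Sum>n. ?vl (Suc n)) = 0"
  proof -
    let ?A = "\<lambda>n. \<Sum>d | d dvd n. ?ul d * ?v (n div d)" and ?B = "\<lambda>n. \<Sum>d | d dvd n. ?u d * ?vl (n div d)"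
    have sA: "?A summable_on {0<..}" and sB: "?B summable_on {0<..}"
      using Dirichlet_product(2)[OF ul v] Dirichlet_product(2)[OF u vl] by simp_all
    have AB: "?A n + ?B n = 0" if n: "n \<in> {0<..}" for n
    proof -
      have "?ul d * ?v (n div d) + ?u d * ?vl (n div d) = of_int (moebius_mu d) * (ln (real n) / (real n)\<^sup>2)" if dvd: "d dvd n" for d
      proof -
        obtain k where k: "n = d * k" using dvd by (elim dvdE)
        then have dk: "d > 0" "k > 0" using n by auto
        then show ?thesis by (simp add: k ln_mult power_mult_distrib field_simps)
      qed
      then have "?A n + ?B n = (\<Sum>d | d dvd n. of_int (moebius_mu d)) * (ln (real n) / (real n)\<^sup>2)"
        unfolding sum.distrib[symmetric] sum_distrib_right by (intro sum.cong) auto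
      also have "\<dots> = 0" using n by (simp only: mu_sum[OF n[unfolded greaterThan_iff]]) simp
      finally show ?thesis .
    qed
    have "(\<Sum>n. ?ul (Suc n)) * (\<Sum>n. ?v (Suc n)) + (\<Sum>n. ?u (Suc n)) * (\<Sum>n. ?vl (Suc n)) = infsum ?A {0<..} + infsum ?B {0<..}"
      by (simp only: Dirichlet_product(1)[OF ul v] Dirichlet_product(1)[OF u vl])
    also have "\<dots> = infsum (\<lambda>n. ?A n + ?B n) {0<..}" by (rule infsum_add[OF sA sB, symmetric])
    also have "\<dots> = 0" by (rule infsum_0) (rule AB)
    finally show ?thesis .
  qed
  have sul: "(\<Sum>n. ?ul (Suc n)) = - 36 / pi ^ 4 * (\<Sum>n. ?vl (Suc n))"
  proof -
    have "(\<Sum>n. ?ul (Suc n)) * (pi\<^sup>2 / 6) + 6 / pi\<^sup>2 * (\<Sum>n. ?vl (Suc n)) = 0" using 2 by (simp only: su V)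
    then have "(\<Sum>n. ?ul (Suc n)) * (pi\<^sup>2 / 6) = - (6 / pi\<^sup>2 * (\<Sum>n. ?vl (Suc n)))" by linarith
    then have "(\<Sum>n. ?ul (Suc n)) * (pi\<^sup>2 / 6) * (6 / pi\<^sup>2) = - (6 / pi\<^sup>2 * (\<Sum>n. ?vl (Suc n))) * (6 / pi\<^sup>2)" by (rule arg_cong)
    then show ?thesis by (simp add: power2_eq_square power4_eq_xxxx)
  qed
  have smul: "summable (\<lambda>n. ?ul (Suc n))" using ul by (rule summable_norm_cancel)
  show "(\<lambda>n. ?ul (Suc n)) sums (- 36 / pi ^ 4 * (\<Sum>n. ?vl (Suc n)))"
    using summable_sums[OF smul] by (simp only: sul)
qed

text \<open>The double family over (d, k) is dominated by a product of two convergent series,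
  because \<open>\<phi>\<close> decays faster than 1/y; hence it may be grouped by n = d^e k. With e
  = 2 and the Moebius function the weights become its absolute value, with e = 1 and that absolute
  value they become \<open>2 ^ omega\<close>; the choice b = 0 serves for bare summability of the
  dilates.\<close>

lemma sum_over_multiples:
  fixes \<phi> :: "real \<Rightarrow> real" and b :: "nat \<Rightarrow> real"
  assumes \<alpha>: "\<alpha> > 1" and \<phi>: "\<And>y. y > 0 \<Longrightarrow> \<bar>\<phi> y\<bar> \<le> C * y powr (- \<alpha>)"
    and b: "\<And>n. \<bar>b n\<bar> \<le> 1" and e: "e > 0" and x: "x > 0"
  shows "(\<lambda>n. b (Suc n) * (\<Sum>k. \<phi> (real (Suc k) * (real (Suc n) ^ e * x)))) sums
    (\<Sum>n. (\<Sum>d | d ^ e dvd Suc n. b d) * \<phi> (real (Suc n) * x))"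
    and "summable (\<lambda>n. \<bar>\<phi> (real (Suc n) * x)\<bar>)"
    and "summable (\<lambda>n. \<bar>b (Suc n) * (\<Sum>k. \<phi> (real (Suc k) * (real (Suc n) ^ e * x)))\<bar>)"
proof -
  let ?g = "\<lambda>d n. b d * \<phi> (real n * x)" and ?p = "\<lambda>n. real n powr (- \<alpha>)"
  have C: "C \<ge> 0" using order_trans[OF abs_ge_zero \<phi>[of 1]] by simp
  have p: "summable (\<lambda>n. norm (?p (Suc n)))"
    using summable_Suc_powr[OF \<alpha>] by simp
  have \<phi>x: "\<bar>\<phi> (real (d ^ e * k) * x)\<bar> \<le> C * x powr (- \<alpha>) * (?p d * ?p k)" if "d > 0" "k > 0" for d k
  proof -
    have "(real d ^ e) powr (- \<alpha>) \<le> real d powr (- \<alpha>)"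
      using that \<alpha> e by (intro powr_mono2') (auto intro: self_le_power)
    then have "C * x powr (- \<alpha>) * ((real d ^ e) powr (- \<alpha>) * ?p k) \<le> C * x powr (- \<alpha>) * (?p d * ?p k)"
      using C by (intro mult_left_mono mult_right_mono) auto
    moreover have "\<bar>\<phi> (real (d ^ e * k) * x)\<bar> \<le> C * (real (d ^ e * k) * x) powr (- \<alpha>)"
      using that x by (intro \<phi>) auto
    moreover have "(real (d ^ e * k) * x) powr (- \<alpha>) = x powr (- \<alpha>) * ((real d ^ e) powr (- \<alpha>) * ?p k)"
      using that x by (simp add: powr_mult)
    ultimately show ?thesis by (simp add: mult.assoc)
  qed
  have "(\<lambda>(d, k). ?p d * ?p k) summable_on {0<..} \<times> {0<..}"
    by (rule summable_on_product_of_summable[OF p p])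
  then have "(\<lambda>z. C * x powr (- \<alpha>) * (case z of (d, k) \<Rightarrow> ?p d * ?p k)) summable_on {0<..} \<times> {0<..}"
    by (rule summable_on_cmult_right)
  then have "(\<lambda>z. norm (case z of (d, k) \<Rightarrow> ?g d (d ^ e * k))) summable_on {0<..} \<times> {0<..}"
  proof (rule Infinite_Sum.abs_summable_on_comparison_test')
    fix z :: "nat \<times> nat" assume "z \<in> {0<..} \<times> {0<..}"
    then obtain d k where z: "z = (d, k)" "d > 0" "k > 0" by (cases z) auto
    have "\<bar>b d\<bar> * \<bar>\<phi> (real (d ^ e * k) * x)\<bar> \<le> 1 * \<bar>\<phi> (real (d ^ e * k) * x)\<bar>"
      using b by (intro mult_right_mono) auto
    also have "\<dots> \<le> C * x powr (- \<alpha>) * (?p d * ?p k)" using \<phi>x[OF z(2,3)] by simp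
    finally show "norm (case z of (d, k) \<Rightarrow> ?g d (d ^ e * k)) \<le> C * x powr (- \<alpha>) * (case z of (d, k) \<Rightarrow> ?p d * ?p k)"
      by (simp add: z abs_mult)
  qed
  then have sm: "(\<lambda>(d, k). ?g d (d ^ e * k)) summable_on {0<..} \<times> {0<..}"
    by (rule abs_summable_summable)
  have p': "summable (\<lambda>k. c * norm (?p (Suc k)))" for c using p by (rule summable_mult)
  have inner: "summable (\<lambda>k. norm (\<phi> (real (d ^ e * Suc k) * x)))" if "d > 0" for d
  proof (rule summable_comparison_test'[OF p'[of "C * x powr (- \<alpha>) * ?p d"]])
    fix k :: nat
    show "norm (norm (\<phi> (real (d ^ e * Suc k) * x))) \<le> C * x powr (- \<alpha>) * ?p d * norm (?p (Suc k))"
      using \<phi>x[OF that zero_less_Suc[of k]]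
      by (simp only: real_norm_def abs_idempotent mult.assoc abs_of_nonneg[OF powr_ge_zero])
  qed
  from inner[of 1] show "summable (\<lambda>n. \<bar>\<phi> (real (Suc n) * x)\<bar>)" by (simp del: of_nat_Suc)
  have eq: "(\<Sum>\<^sub>\<infinity>k\<in>{0<..}. ?g d (d ^ e * k)) = b d * (\<Sum>k. \<phi> (real (Suc k) * (real d ^ e * x)))" if "d \<in> {0<..}" for d
  proof -
    have "(\<Sum>\<^sub>\<infinity>k\<in>{0<..}. ?g d (d ^ e * k)) = b d * (\<Sum>\<^sub>\<infinity>k\<in>{0<..}. \<phi> (real (d ^ e * k) * x))"
      by (rule infsum_cmult_right')
    also have "(\<Sum>\<^sub>\<infinity>k\<in>{0<..}. \<phi> (real (d ^ e * k) * x)) = (\<Sum>k. \<phi> (real (d ^ e * Suc k) * x))"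
      using that by (intro infsum_positive_nat(1) inner) auto
    finally have "(\<Sum>\<^sub>\<infinity>k\<in>{0<..}. ?g d (d ^ e * k)) = b d * (\<Sum>k. \<phi> (real (d ^ e * Suc k) * x))" .
    moreover have "real (d ^ e * Suc k) * x = real (Suc k) * (real d ^ e * x)" for k
      by (simp only: of_nat_mult of_nat_power mult_ac)
    ultimately show ?thesis by (simp only:)
  qed
  have "(\<lambda>d. \<Sum>\<^sub>\<infinity>k\<in>{0<..}. ?g d (d ^ e * k)) summable_on {0<..}"
    by (rule summable_on_Sigma_banach[OF sm])
  then have sm1: "(\<lambda>d. b d * (\<Sum>k. \<phi> (real (Suc k) * (real d ^ e * x)))) summable_on {0<..}"
    by (subst (asm) summable_on_cong[OF eq])
  have "(\<Sum>\<^sub>\<infinity>d\<in>{0<..}. b d * (\<Sum>k. \<phi> (real (Suc k) * (real d ^ e * x)))) = (\<Sum>\<^sub>\<infinity>n\<in>{0<..}. \<Sum>d | d ^ e dvd n. ?g d n)"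
    unfolding infsum_power_divisor(1)[OF e sm, symmetric] by (intro infsum_cong eq[symmetric])
  also have "\<dots> = (\<Sum>n. \<Sum>d | d ^ e dvd Suc n. ?g d (Suc n))"
    by (rule sums_unique[OF summable_on_positive_nat_sums(1)[OF infsum_power_divisor(2)[OF e sm]]])
  also have "\<dots> = (\<Sum>n. (\<Sum>d | d ^ e dvd Suc n. b d) * \<phi> (real (Suc n) * x))"
    by (simp only: sum_distrib_right)
  finally show "(\<lambda>n. b (Suc n) * (\<Sum>k. \<phi> (real (Suc k) * (real (Suc n) ^ e * x)))) sums
    (\<Sum>n. (\<Sum>d | d ^ e dvd Suc n. b d) * \<phi> (real (Suc n) * x))"
    using summable_on_positive_nat_sums(1)[OF sm1] by simp
  show "summable (\<lambda>n. \<bar>b (Suc n) * (\<Sum>k. \<phi> (real (Suc k) * (real (Suc n) ^ e * x)))\<bar>)"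
    using summable_on_positive_nat_sums(2)[OF sm1] by simp
qed

subsection \<open>Mellin transforms\<close>

text \<open>Absolute integrability belongs to the notion, since Fubini's theorem and termwise
  integration depend on it. The indicator keeps all integrals on the whole line, where dilations
  act.\<close>

definition has_mellin :: "(real \<Rightarrow> complex) \<Rightarrow> complex \<Rightarrow> complex \<Rightarrow> bool" where
  "has_mellin \<phi> s v \<longleftrightarrow>
     integrable lborel (\<lambda>x. indicator {0<..} x *\<^sub>R (\<phi> x * complex_of_real x powr (s - 1))) \<and>
     (LINT x|lborel. indicator {0<..} x *\<^sub>R (\<phi> x * complex_of_real x powr (s - 1))) = v"

lemma has_mellin_cong:
  assumes "\<And>x. x > 0 \<Longrightarrow> \<phi> x = \<psi> x"
  shows "has_mellin \<phi> s v \<longleftrightarrow> has_mellin \<psi> s v"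
proof -
  have "(\<lambda>x. indicator {0<..} x *\<^sub>R (\<phi> x * complex_of_real x powr (s - 1))) =
        (\<lambda>x. indicator {0<..} x *\<^sub>R (\<psi> x * complex_of_real x powr (s - 1)))"
    using assms by (auto simp: indicator_def fun_eq_iff)
  then show ?thesis unfolding has_mellin_def by simp
qed

lemma has_mellin_imp_has_integral:
  assumes "has_mellin \<phi> s v"
  shows "((\<lambda>x. \<phi> x * complex_of_real x powr (s - 1)) has_integral v) {0<..}"
proof -
  let ?g = "\<lambda>x. indicator {0<..} x *\<^sub>R (\<phi> x * complex_of_real x powr (s - 1))"
  have "(?g has_integral v) UNIV"
    using assms has_integral_integral_lborel[of ?g] unfolding has_mellin_def by auto
  also have "?g = (\<lambda>x. if x \<in> {0<..} then \<phi> x * complex_of_real x powr (s - 1) else 0)"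
    by (auto simp: indicator_def)
  finally show ?thesis by (simp only: has_integral_restrict_UNIV)
qed

lemma has_mellin_scale:
  assumes "has_mellin \<phi> s v" and c: "c > 0"
  shows "has_mellin (\<lambda>x. \<phi> (c * x)) s (of_real c powr (- s) * v)"
proof -
  let ?g = "\<lambda>x. indicator {0<..} x *\<^sub>R (\<phi> x * complex_of_real x powr (s - 1))"
  let ?h = "\<lambda>x. indicator {0<..} x *\<^sub>R (\<phi> (c * x) * complex_of_real x powr (s - 1))"
  have int: "integrable lborel ?g" and v: "integral\<^sup>L lborel ?g = v"
    using assms by (auto simp: has_mellin_def)
  have eq: "?h x = of_real c powr (1 - s) * ?g (0 + c * x)" for x
  proof (cases "x > 0")
    case True
    have "complex_of_real (c * x) powr (s - 1) = of_real c powr (s - 1) * of_real x powr (s - 1)"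
      using c True by (simp add: powr_times_real)
    moreover have "complex_of_real c powr (1 - s) * of_real c powr (s - 1) = 1"
      using c by (simp add: powr_add[symmetric])
    ultimately show ?thesis using c True
      by (simp add: mult_ac)
  next
    case False
    then show ?thesis using c by (simp add: zero_less_mult_iff)
  qed
  have int2: "integrable lborel (\<lambda>x. ?g (0 + c * x))"
    using lborel_integrable_real_affine[OF int, of c 0] c by simp
  have "integral\<^sup>L lborel ?g = \<bar>c\<bar> *\<^sub>R (LINT x|lborel. ?g (0 + c * x))"
    using c by (intro lborel_integral_real_affine) auto
  then have "(LINT x|lborel. ?g (0 + c * x)) = v / of_real c"
    using c v by (simp add: scaleR_conv_of_real field_simps)
  then have "integral\<^sup>L lborel ?h = of_real c powr (1 - s) * (v / of_real c)"
    unfolding eq integral_mult_right_zero by (simp only:)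
  also have "\<dots> = of_real c powr (- s) * v"
    using c by (simp add: powr_diff powr_minus field_simps)
  finally have "integral\<^sup>L lborel ?h = of_real c powr (- s) * v" .
  moreover have "integrable lborel ?h" unfolding eq by (rule integrable_mult_right[OF int2])
  ultimately show ?thesis unfolding has_mellin_def by (rule conjI[rotated])
qed

lemma norm_of_real_powr: "x > 0 \<Longrightarrow> norm (complex_of_real x powr s) = x powr Re s"
  using norm_powr_real_powr[of "of_real x" s] by simp

text \<open>The dilation rule for absolute values: these norms are what Fubini's theorem and the
  interchange with the sum over d ask for.\<close>

lemma has_mellin_norm_scale:
  assumes "has_mellin \<phi> s v" and c: "c > 0"
  shows "(LINT x|lborel. norm (indicator {0<..} x *\<^sub>R (\<phi> (c * x) * complex_of_real x powr (s - 1)))) =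
     c powr (- Re s) * (LINT x|lborel. norm (indicator {0<..} x *\<^sub>R (\<phi> x * complex_of_real x powr (s - 1))))"
proof -
  let ?n = "\<lambda>x. norm (indicator {0<..} x *\<^sub>R (\<phi> x * complex_of_real x powr (s - 1)))"
  have eq: "norm (indicator {0<..} x *\<^sub>R (\<phi> (c * x) * complex_of_real x powr (s - 1))) = c powr (1 - Re s) * ?n (0 + c * x)" for x
  proof (cases "x > 0")
    case True
    have "(c * x) powr (Re s - 1) = c powr (Re s - 1) * x powr (Re s - 1)"
      using c True by (simp add: powr_mult)
    moreover have "c powr (1 - Re s) * c powr (Re s - 1) = 1"
      using c by (simp add: powr_add[symmetric])
    ultimately show ?thesis using c True
      by (simp add: norm_mult norm_of_real_powr del: of_real_mult)
  next
    case False
    then show ?thesis using c by (simp add: zero_less_mult_iff)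
  qed
  have "integral\<^sup>L lborel ?n = \<bar>c\<bar> *\<^sub>R (LINT x|lborel. ?n (0 + c * x))"
    using c by (intro lborel_integral_real_affine) auto
  then have A: "(LINT x|lborel. ?n (0 + c * x)) = integral\<^sup>L lborel ?n / c"
    using c by (simp add: field_simps)
  have "c powr (- Re s) = c powr (1 - Re s) / c" using c by (simp add: powr_diff powr_minus field_simps)
  then show ?thesis
    unfolding eq integral_mult_right_zero A by (simp only: times_divide_eq_left times_divide_eq_right)
qed

text \<open>Integrating over x first, the dilation by t yields \<open>t powr (- s)\<close> times V,
  and what remains is the transform of \<open>k\<close> at \<open>1 - s\<close>. The same
  computation with norms gives a finite value and thereby justifies Fubini's theorem.\<close>

lemma has_mellin_convolution:
  fixes k :: "real \<Rightarrow> real" and \<phi> :: "real \<Rightarrow> real"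
  assumes [measurable]: "k \<in> borel_measurable borel" "\<phi> \<in> borel_measurable borel"
    and K: "has_mellin (\<lambda>t. of_real (k t)) (1 - s) K"
    and V: "has_mellin (\<lambda>x. of_real (\<phi> x)) s V"
  shows "has_mellin (\<lambda>x. of_real (LINT t|lborel. indicator {0<..} t * (k t * \<phi> (x * t)))) s (K * V)"
proof -

  let ?i = "indicator {0<..} :: real \<Rightarrow> real"
  define f where "f = (\<lambda>t x. ?i t *\<^sub>R ?i x *\<^sub>R (complex_of_real (k t) * (complex_of_real (\<phi> (x * t)) * complex_of_real x powr (s - 1))))"
  have inner: "integrable lborel (f t)" "(LINT x|lborel. f t x) = ?i t *\<^sub>R (complex_of_real (k t) * of_real t powr (1 - s - 1)) * V"
    "(LINT x|lborel. norm (f t x)) = norm (?i t *\<^sub>R (complex_of_real (k t) * of_real t powr (1 - s - 1))) *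
       (LINT x|lborel. norm (?i x *\<^sub>R (complex_of_real (\<phi> x) * complex_of_real x powr (s - 1))))" for t
  proof -
    define a where "a = ?i t *\<^sub>R complex_of_real (k t)"
    define g where "g = (\<lambda>x. ?i x *\<^sub>R (complex_of_real (\<phi> (t * x)) * complex_of_real x powr (s - 1)))"
    define N where "N = (LINT x|lborel. norm (?i x *\<^sub>R (complex_of_real (\<phi> x) * complex_of_real x powr (s - 1))))"
    have eq: "f t = (\<lambda>x. a * g x)"
      by (auto simp: f_def a_def g_def fun_eq_iff mult_ac)
    have g: "integrable lborel g" "integral\<^sup>L lborel g = of_real t powr (- s) * V"
      "(LINT x|lborel. norm (g x)) = t powr (- Re s) * N" if "t > 0"
      using has_mellin_scale[OF V that] has_mellin_norm_scale[OF V that]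
      unfolding has_mellin_def g_def N_def by simp_all
    have a0: "a = 0" if "\<not> t > 0" using that by (simp add: a_def)
    show "integrable lborel (f t)"
      unfolding eq using g(1) a0 by (cases "t > 0") (auto intro: integrable_mult_right)
    show "(LINT x|lborel. f t x) = ?i t *\<^sub>R (complex_of_real (k t) * of_real t powr (1 - s - 1)) * V"
      unfolding eq integral_mult_right_zero using g(2) by (cases "t > 0") (simp_all add: a_def)
    show "(LINT x|lborel. norm (f t x)) = norm (?i t *\<^sub>R (complex_of_real (k t) * of_real t powr (1 - s - 1))) * N"
      unfolding eq norm_mult integral_mult_right_zero using g(3)
      by (cases "t > 0") (simp_all add: a_def norm_mult norm_of_real_powr)
  qed
  have int: "integrable (lborel \<Otimes>\<^sub>M lborel) (case_prod f)"
  proof (rule lborel_pair.Fubini_integrable)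
    show "case_prod f \<in> borel_measurable (lborel \<Otimes>\<^sub>M lborel)"
      unfolding f_def by measurable
    have "integrable lborel (\<lambda>t. norm (?i t *\<^sub>R (complex_of_real (k t) * of_real t powr (1 - s - 1))))"
      using K unfolding has_mellin_def by (intro integrable_norm) auto
    then show "integrable lborel (\<lambda>t. LINT x|lborel. norm (case (t, x) of (t, x) \<Rightarrow> f t x))"
      by (simp add: inner(3))
    show "AE t in lborel. integrable lborel (\<lambda>x. case (t, x) of (t, x) \<Rightarrow> f t x)"
      using inner(1) by simp
  qed
  have ft: "(LINT t|lborel. f t x) = ?i x *\<^sub>R (complex_of_real (LINT t|lborel. ?i t * (k t * \<phi> (x * t))) * of_real x powr (s - 1))" for x
  proof -
    have "f t x = (?i x *\<^sub>R complex_of_real x powr (s - 1)) * complex_of_real (?i t * (k t * \<phi> (x * t)))" for t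
      by (simp add: f_def scaleR_conv_of_real mult_ac)
    then have "(LINT t|lborel. f t x) = (LINT t|lborel. (?i x *\<^sub>R complex_of_real x powr (s - 1)) * complex_of_real (?i t * (k t * \<phi> (x * t))))"
      by (simp only:)
    also have "\<dots> = (?i x *\<^sub>R complex_of_real x powr (s - 1)) * complex_of_real (LINT t|lborel. ?i t * (k t * \<phi> (x * t)))"
      by (simp only: integral_mult_right_zero integral_complex_of_real)
    finally show ?thesis by (simp add: mult_ac scaleR_conv_of_real)
  qed
  have "integrable lborel (\<lambda>x. LINT t|lborel. f t x)" by (rule lborel_pair.integrable_snd[OF int])
  moreover have "(LINT x|lborel. LINT t|lborel. f t x) = (LINT t|lborel. LINT x|lborel. f t x)"
    by (rule lborel_pair.Fubini_integral[OF int])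
  moreover have "(LINT t|lborel. LINT x|lborel. f t x) = K * V"
    unfolding inner(2) integral_mult_left_zero using K unfolding has_mellin_def by (simp only:)
  ultimately show ?thesis unfolding has_mellin_def ft by simp
qed

lemma integrable_powr_bound:
  fixes \<phi> :: "real \<Rightarrow> 'a :: {banach, second_countable_topology}"
  assumes [measurable]: "\<phi> \<in> borel_measurable borel"
    and a: "a > -1" "\<And>x. 0 < x \<Longrightarrow> x \<le> 1 \<Longrightarrow> norm (\<phi> x) \<le> C * x powr a"
    and b: "b < -1" "\<And>x. 1 < x \<Longrightarrow> norm (\<phi> x) \<le> C * x powr b"
  shows "integrable lborel (\<lambda>x. indicator {0<..} x *\<^sub>R \<phi> x)"
proof -
  have I: "integrable lborel (\<lambda>x. indicator S x * x powr c)"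
    if "(\<lambda>x. x powr c) integrable_on S" "S \<in> sets borel" for S :: "real set" and c
  proof -
    have "(\<lambda>x::real. x powr c) absolutely_integrable_on S"
      using that(1) by (rule nonnegative_absolutely_integrable_1) simp
    then show ?thesis
      using that(2) by (simp add: set_integrable_def integrable_completion)
  qed
  have "(\<lambda>x::real. x powr a) integrable_on {0..1}"
    using has_integral_powr_from_0[of a 1] a by (auto simp: integrable_on_def)
  then have 1: "integrable lborel (\<lambda>x. indicator {0..1} x * x powr a)" by (rule I) simp
  have "(\<lambda>x::real. x powr b) integrable_on {1..}"
    using has_integral_powr_to_inf[of b 1] b by (auto simp: integrable_on_def)
  then have 2: "integrable lborel (\<lambda>x. indicator {1..} x * x powr b)" by (rule I) simp
  have "integrable lborel (\<lambda>x. C * (indicator {0..1} x * x powr a) + C * (indicator {1..} x * x powr b))"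
    by (intro Bochner_Integration.integrable_add integrable_mult_right 1 2)
  then show ?thesis
  proof (rule Bochner_Integration.integrable_bound)
    have C: "C \<ge> 0" using order_trans[OF norm_ge_zero a(2)[of 1]] by simp
    show "AE x in lborel. norm (indicator {0<..} x *\<^sub>R \<phi> x) \<le> norm (C * (indicator {0..1} x * x powr a) + C * (indicator {1..} x * x powr b))"
    proof (rule AE_I2)
      fix x :: real
      consider "x \<le> 0" | "0 < x" "x \<le> 1" | "x > 1" by linarith
      then show "norm (indicator {0<..} x *\<^sub>R \<phi> x) \<le> norm (C * (indicator {0..1} x * x powr a) + C * (indicator {1..} x * x powr b))"
      proof cases
        case 2
        have "norm (\<phi> x) \<le> C * x powr a + C * (indicator {1..} x * x powr b)"
          using a(2)[OF 2] C by (simp add: add_increasing2)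
        then show ?thesis using 2 C by simp
      next
        case 3 then show ?thesis using b(2)[OF 3] C by simp
      qed simp
    qed
  qed measurable
qed

text \<open>On [N, N + 1] the function (t - N) \<open>\<phi> (x * t)\<close> is an antiderivative of
  \<open>H\<close>, and its increment is the summand with index N + 1. Convergence is asked only of
  the integral with the fractional part, not of the sum or of the integral of \<open>\<phi>\<close>;
  this is what permits \<open>\<phi> = h\<close> later. The assumption at 0 replaces continuity
  there and admits the singular function \<open>t powr (- s)\<close>, for which the values must be
  allowed to be complex.\<close>

lemma sum_minus_integral:
  fixes \<phi> \<phi>' :: "real \<Rightarrow> 'a :: euclidean_space"
  assumes x: "x > 0"
    and der: "\<And>y. y > 0 \<Longrightarrow> (\<phi> has_vector_derivative \<phi>' y) (at y)"
    and zero: "((\<lambda>t. t *\<^sub>R \<phi> t) \<longlongrightarrow> 0) (at_right 0)"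
    and int1: "\<And>N. set_integrable lborel {0..real N} (\<lambda>t. \<phi> (x * t))"
    and int2: "set_integrable lborel {0..} (\<lambda>t. frac t *\<^sub>R x *\<^sub>R \<phi>' (x * t))"
  shows "(LINT t:{0..real N}|lborel. frac t *\<^sub>R x *\<^sub>R \<phi>' (x * t)) =
      (\<Sum>k=1..N. \<phi> (x * real k)) - (LINT t:{0..real N}|lborel. \<phi> (x * t))"
    and "(\<lambda>N. (\<Sum>k=1..N. \<phi> (x * real k)) - (LINT t:{0..real N}|lborel. \<phi> (x * t)))
      \<longlonglongrightarrow> (LINT t:{0..}|lborel. frac t *\<^sub>R x *\<^sub>R \<phi>' (x * t))"
proof -
  define H where "H = (\<lambda>t. \<phi> (x * t) + frac t *\<^sub>R x *\<^sub>R \<phi>' (x * t))"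
  have der': "((\<lambda>t. \<phi> (x * t)) has_vector_derivative x *\<^sub>R \<phi>' (x * t)) (at t)" if "t > 0" for t
  proof -
    have "((*) x has_vector_derivative x) (at t)"
      unfolding has_real_derivative_iff_has_vector_derivative[symmetric] by (auto intro!: derivative_eq_intros)
    from vector_diff_chain_at[OF this der[of "x * t"]] x that show ?thesis by (simp add: o_def)
  qed
  have H: "(H has_integral (\<Sum>k=1..N. \<phi> (x * real k))) {0..real N}" for N
  proof (induction N)
    case 0 show ?case by (simp add: has_integral_refl)
  next
    case (Suc N)
    let ?\<Psi> = "\<lambda>t. (t - real N) *\<^sub>R \<phi> (x * t)"
    have \<Psi>: "(?\<Psi> has_vector_derivative (\<phi> (x * t) + (t - real N) *\<^sub>R x *\<^sub>R \<phi>' (x * t))) (at t)" if "t > 0" for t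
      using der'[OF that] by (auto intro!: derivative_eq_intros)
    have cont: "continuous_on {real N..real (Suc N)} ?\<Psi>"
      unfolding continuous_on_eq_continuous_within
    proof
      fix t assume t: "t \<in> {real N..real (Suc N)}"
      show "continuous (at t within {real N..real (Suc N)}) ?\<Psi>"
      proof (cases "t > 0")
        case True
        from has_vector_derivative_continuous[OF \<Psi>[OF True]] show ?thesis by (rule continuous_at_imp_continuous_at_within)
      next
        case False
        with t have N: "N = 0" "t = 0" by auto
        have "filterlim (\<lambda>t. x * t) (at_right 0) (at_right 0)"
          using x by real_asymp
        from tendsto_scaleR[OF tendsto_const[of "1 / x"] filterlim_compose[OF zero this]]
        have "((\<lambda>t. t *\<^sub>R \<phi> (x * t)) \<longlongrightarrow> 0) (at_right 0)" using x by simp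
        then show ?thesis
          using N at_within_Icc_at_right[of 0 "1::real"] by (simp add: continuous_within)
      qed
    qed
    have "(H has_integral ?\<Psi> (real (Suc N)) - ?\<Psi> (real N)) {real N..real (Suc N)}"
    proof (rule fundamental_theorem_of_calculus_interior[OF _ cont])
      fix t assume t: "t \<in> {real N<..<real (Suc N)}"
      then have "\<lfloor>t\<rfloor> = int N" by (simp add: floor_eq_iff)
      then have fr: "frac t = t - real N" by (simp add: frac_def)
      have "t > 0" using t by (auto intro: le_less_trans[of 0 "real N"])
      from \<Psi>[OF this] show "(?\<Psi> has_vector_derivative H t) (at t)" by (simp add: H_def fr)
    qed simp
    from has_integral_combine[OF _ _ Suc.IH this] show ?case by simp
  qed
  have int2N: "set_integrable lborel {0..real N} (\<lambda>t. frac t *\<^sub>R x *\<^sub>R \<phi>' (x * t))" for N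
    using int2 by (rule set_integrable_subset) auto
  show eq: "(LINT t:{0..real N}|lborel. frac t *\<^sub>R x *\<^sub>R \<phi>' (x * t)) =
      (\<Sum>k=1..N. \<phi> (x * real k)) - (LINT t:{0..real N}|lborel. \<phi> (x * t))" for N
  proof -
    have "((\<lambda>t. \<phi> (x * t)) has_integral (LINT t:{0..real N}|lborel. \<phi> (x * t))) {0..real N}"
      "((\<lambda>t. frac t *\<^sub>R x *\<^sub>R \<phi>' (x * t)) has_integral (LINT t:{0..real N}|lborel. frac t *\<^sub>R x *\<^sub>R \<phi>' (x * t))) {0..real N}"
      using set_borel_integral_eq_integral[OF int1[of N]] set_borel_integral_eq_integral[OF int2N[of N]]
      by (auto simp: has_integral_iff)
    from has_integral_unique[OF H[of N, unfolded H_def] has_integral_add[OF this]] show ?thesis by simp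
  qed
  have "((\<lambda>y. LINT t:{0..y}|lborel. frac t *\<^sub>R x *\<^sub>R \<phi>' (x * t)) \<longlongrightarrow> (LINT t:{0..}|lborel. frac t *\<^sub>R x *\<^sub>R \<phi>' (x * t))) at_top"
    by (rule tendsto_set_lebesgue_integral_at_top[OF _ int2]) auto
  from filterlim_compose[OF this filterlim_real_sequentially]
  show "(\<lambda>N. (\<Sum>k=1..N. \<phi> (x * real k)) - (LINT t:{0..real N}|lborel. \<phi> (x * t)))
      \<longlonglongrightarrow> (LINT t:{0..}|lborel. frac t *\<^sub>R x *\<^sub>R \<phi>' (x * t))"
    by (simp only: eq)
qed

subsection \<open>Muentz' formula\<close>

lemma set_integrable_Icc_powr_bound:
  fixes \<phi> :: "real \<Rightarrow> 'a :: {banach, second_countable_topology}"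
  assumes [measurable]: "\<phi> \<in> borel_measurable borel" and a: "a > -1" and b: "b \<ge> 0"
    and \<phi>: "\<And>x. 0 < x \<Longrightarrow> x \<le> b \<Longrightarrow> norm (\<phi> x) \<le> C * x powr a"
  shows "set_integrable lborel {0..b} \<phi>"
  unfolding set_integrable_def
proof (rule Bochner_Integration.integrable_bound)
  have "(\<lambda>x. x powr a) integrable_on {0..b}"
    using has_integral_powr_from_0[OF a b] by (auto simp: integrable_on_def)
  then have "(\<lambda>x::real. x powr a) absolutely_integrable_on {0..b}"
    by (rule nonnegative_absolutely_integrable_1) simp
  then have "integrable lborel (\<lambda>x. indicator {0..b} x * x powr a)"
    by (simp add: set_integrable_def integrable_completion)
  then show "integrable lborel (\<lambda>x. C * (indicator {0..b} x * x powr a))" by (rule integrable_mult_right)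
  show "AE x in lborel. norm (indicator {0..b} x *\<^sub>R \<phi> x) \<le> norm (C * (indicator {0..b} x * x powr a))"
    using AE_lborel_singleton[of 0]
  proof eventually_elim
    fix x :: real assume "x \<noteq> 0"
    show "norm (indicator {0..b} x *\<^sub>R \<phi> x) \<le> norm (C * (indicator {0..b} x * x powr a))"
    proof (cases "x \<in> {0..b}")
      case True
      with \<open>x \<noteq> 0\<close> have "norm (\<phi> x) \<le> C * x powr a" by (intro \<phi>) auto
      also have "\<dots> \<le> \<bar>C * x powr a\<bar>" by (rule abs_ge_self)
      finally show ?thesis using True by simp
    qed simp
  qed
qed measurable

lemma tendsto_of_real_powr_0:
  assumes "Re z > 0"
  shows "((\<lambda>t. complex_of_real t powr z) \<longlongrightarrow> 0) (at_right 0)"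
proof (rule Lim_null_comparison)
  show "\<forall>\<^sub>F t in at_right 0. norm (complex_of_real t powr z) \<le> t powr Re z"
    using eventually_at_right_less[of 0] by eventually_elim (simp add: norm_of_real_powr)
  show "((\<lambda>t. t powr Re z) \<longlongrightarrow> 0) (at_right 0)"
    using assms by real_asymp
qed

lemma has_vector_derivative_of_real_powr:
  assumes "t > 0"
  shows "((\<lambda>t. complex_of_real t powr z) has_vector_derivative z * of_real t powr (z - 1)) (at t)"
  by (rule has_vector_derivative_real_field, rule has_field_derivative_powr) (use assms in auto)

lemma measurable_of_real_powr [measurable]: "(\<lambda>t. complex_of_real t powr z) \<in> borel_measurable borel"
  unfolding powr_def by measurable

lemma borel_measurable_frac [measurable]: "(frac :: real \<Rightarrow> real) \<in> borel_measurable borel"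
  unfolding frac_def[abs_def] by measurable

lemma frac_le_self: "0 \<le> t \<Longrightarrow> frac t \<le> (t::real)"
  by (simp add: frac_def)

lemma abs_frac_div_le:
  fixes t :: real
  assumes "t > 0"
  shows "\<bar>frac t / t\<bar> \<le> 1" "\<bar>frac t / t\<bar> \<le> 1 / t"
  using frac_le_self[of t] frac_ge_0[of t] frac_lt_1[of t] assms by (auto simp: divide_right_mono)

text \<open>The summation formula for \<open>t powr (- s)\<close> at x = 1: the sum minus the
  integral tends to \<open>zeta s\<close>, while t times the derivative is
  \<open>- s * t powr (- s)\<close>, which produces the factor -s. The integrand is of order
  \<open>- Re s\<close> at 0 and \<open>- Re s - 1\<close> at infinity, hence the strip.\<close>

lemma has_mellin_frac:
  assumes s: "0 < Re s" "Re s < 1"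
  shows "has_mellin (\<lambda>t. of_real (frac t / t)) (1 - s) (- zeta s / s)"
proof -
  have s0: "s \<noteq> 0" "s \<noteq> 1" using s by auto
  define \<phi> where "\<phi> = (\<lambda>t. complex_of_real t powr (- s))"
  define \<phi>' where "\<phi>' = (\<lambda>t. - s * complex_of_real t powr (- s - 1))"
  define g where "g = (\<lambda>t. indicator {0<..} t *\<^sub>R (complex_of_real (frac t / t) * of_real t powr (1 - s - 1)))"
  have g: "integrable lborel g"
    unfolding g_def
  proof (rule integrable_powr_bound)
    show "- Re s > - 1" "- Re s - 1 < - 1" using s by auto
    show "norm (complex_of_real (frac t / t) * of_real t powr (1 - s - 1)) \<le> 1 * t powr (- Re s)" if "0 < t" "t \<le> 1" for t
    proof -
      have "\<bar>frac t / t\<bar> * t powr (- Re s) \<le> 1 * t powr (- Re s)"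
        using that by (intro mult_right_mono abs_frac_div_le) auto
      then show ?thesis using that by (simp add: norm_mult norm_of_real_powr del: of_real_divide)
    qed
    show "norm (complex_of_real (frac t / t) * of_real t powr (1 - s - 1)) \<le> 1 * t powr (- Re s - 1)" if "1 < t" for t
    proof -
      have "\<bar>frac t / t\<bar> * t powr (- Re s) \<le> 1 / t * t powr (- Re s)"
        using that by (intro mult_right_mono abs_frac_div_le) auto
      also have "\<dots> = t powr (- Re s - 1)" using that by (simp add: powr_diff)
      finally show ?thesis using that by (simp add: norm_mult norm_of_real_powr del: of_real_divide)
    qed
  qed measurable
  have eq: "indicator {0..} t *\<^sub>R (frac t *\<^sub>R 1 *\<^sub>R \<phi>' (1 * t)) = - s * g t" for t
  proof (cases "t > 0")
    case True
    then have "complex_of_real t powr (- s - 1) = of_real t powr (- s) / of_real t" by (simp add: powr_diff)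
    then show ?thesis using True by (simp add: g_def \<phi>'_def scaleR_conv_of_real mult_ac)
  next
    case False then show ?thesis by (cases "t = 0") (simp_all add: g_def \<phi>'_def)
  qed
  have int1: "set_integrable lborel {0..real N} \<phi>" for N
  proof (rule set_integrable_Icc_powr_bound)
    show "norm (\<phi> t) \<le> 1 * t powr (- Re s)" if "0 < t" for t
      using that by (simp add: \<phi>_def norm_of_real_powr)
  qed (use s in \<open>auto simp: \<phi>_def\<close>)
  have lim: "(\<lambda>N. (\<Sum>k=1..N. \<phi> (1 * real k)) - (LINT t:{0..real N}|lborel. \<phi> (1 * t)))
      \<longlonglongrightarrow> (LINT t:{0..}|lborel. frac t *\<^sub>R 1 *\<^sub>R \<phi>' (1 * t))"
  proof (rule sum_minus_integral)
    show "(\<phi> has_vector_derivative \<phi>' y) (at y)" if "y > 0" for y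
      unfolding \<phi>_def \<phi>'_def using that by (rule has_vector_derivative_of_real_powr)
    have "((\<lambda>t. complex_of_real t powr (1 - s)) \<longlongrightarrow> 0) (at_right 0)"
      using s by (intro tendsto_of_real_powr_0) auto
    then show "((\<lambda>t. t *\<^sub>R \<phi> t) \<longlongrightarrow> 0) (at_right 0)"
    proof (rule Lim_transform_eventually)
      show "\<forall>\<^sub>F t in at_right 0. complex_of_real t powr (1 - s) = t *\<^sub>R \<phi> t"
        using eventually_at_right_less[of 0]
        by eventually_elim (simp add: \<phi>_def powr_diff powr_minus scaleR_conv_of_real field_simps)
    qed
    show "set_integrable lborel {0..real N} (\<lambda>t. \<phi> (1 * t))" for N using int1 by simp
    show "set_integrable lborel {0..} (\<lambda>t. frac t *\<^sub>R 1 *\<^sub>R \<phi>' (1 * t))"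
      unfolding set_integrable_def eq using g by (rule integrable_mult_right)
  qed simp
  have int: "(LINT t:{0..real N}|lborel. \<phi> (1 * t)) = of_nat N powr (1 - s) / (1 - s)" for N
  proof -
    from set_borel_integral_eq_integral(2)[OF int1]
    have "(LINT t:{0..real N}|lborel. \<phi> t) = integral {0..real N} \<phi>" .
    also have "(\<phi> has_integral of_real (real N) powr (1 - s) / (1 - s) - of_real 0 powr (1 - s) / (1 - s)) {0..real N}"
    proof (rule fundamental_theorem_of_calculus_interior)
      have pd: "((\<lambda>t. complex_of_real t powr (1 - s) / (1 - s)) has_vector_derivative \<phi> t) (at t)" if "t > 0" for t
      proof -
        have "((\<lambda>t. complex_of_real t powr (1 - s) / (1 - s)) has_vector_derivative (1 - s) * of_real t powr (1 - s - 1) / (1 - s)) (at t)"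
          by (rule has_vector_derivative_divide[OF has_vector_derivative_of_real_powr[OF that]])
        then show ?thesis using s0 by (simp add: \<phi>_def)
      qed
      then show "((\<lambda>t. complex_of_real t powr (1 - s) / (1 - s)) has_vector_derivative \<phi> t) (at t)" if "t \<in> {0<..<real N}" for t
        using that by auto
      show "continuous_on {0..real N} (\<lambda>t. complex_of_real t powr (1 - s) / (1 - s))"
      proof (cases "N = 0")
        case False
        show ?thesis unfolding continuous_on_eq_continuous_within
        proof
          fix t assume t: "t \<in> {0..real N}"
          show "continuous (at t within {0..real N}) (\<lambda>t. complex_of_real t powr (1 - s) / (1 - s))"
          proof (cases "t = 0")
            case True
            have "((\<lambda>t. complex_of_real t powr (1 - s) / (1 - s)) \<longlongrightarrow> 0 / (1 - s)) (at_right 0)"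
              using s s0 by (intro tendsto_intros tendsto_of_real_powr_0) auto
            then show ?thesis using True \<open>N \<noteq> 0\<close> by (simp add: continuous_within at_within_Icc_at_right)
          next
            case False
            with t have "t > 0" by simp
            from has_vector_derivative_continuous[OF pd[OF this]] show ?thesis
              by (rule continuous_at_imp_continuous_at_within)
          qed
        qed
      qed simp
    qed simp
    then have "integral {0..real N} \<phi> = of_nat N powr (1 - s) / (1 - s)"
      using s0 by (simp add: integral_unique)
    finally show ?thesis by simp
  qed
  have "(\<Sum>k=1..N. \<phi> (1 * real k)) = (\<Sum>n<N. complex_of_nat (Suc n) powr (- s))" for N
    by (simp add: \<phi>_def sum.atLeast1_atMost_eq del: of_nat_Suc)
  then have "(\<lambda>N. (\<Sum>n<N. complex_of_nat (Suc n) powr (- s)) - of_nat N powr (1 - s) / (1 - s))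
      \<longlonglongrightarrow> (LINT t:{0..}|lborel. frac t *\<^sub>R 1 *\<^sub>R \<phi>' (1 * t))"
    using lim by (simp only: int)
  from LIMSEQ_unique[OF this zeta_partial_sums_limit[OF s(1) s0(2)]]
  have "zeta s = (LINT t:{0..}|lborel. frac t *\<^sub>R 1 *\<^sub>R \<phi>' (1 * t))" by simp
  also have "\<dots> = - s * integral\<^sup>L lborel g"
    unfolding set_lebesgue_integral_def eq by (rule integral_mult_right_zero)
  finally have "integral\<^sup>L lborel g = - zeta s / s" using s0 by (simp add: field_simps)
  with g show ?thesis unfolding has_mellin_def g_def by blast
qed

section \<open>Functions with decay, and the first summation formula\<close>

definition mel :: "(real \<Rightarrow> real) \<Rightarrow> complex \<Rightarrow> complex" where
  "mel \<phi> s = (LINT x|lborel. indicator {0<..} x *\<^sub>R (of_real (\<phi> x) * complex_of_real x powr (s - 1)))"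

text \<open>The conditions concern the open half-line only and are tailored to hold for
  \<open>f\<close> as well as for \<open>\<lambda>x. x * f' x\<close>, so that the whole development
  is available for both.\<close>

locale decaying =
  fixes \<phi> \<phi>' :: "real \<Rightarrow> real" and \<alpha> C :: real
  assumes \<alpha>: "\<alpha> > 1"
    and meas [measurable]: "\<phi> \<in> borel_measurable borel" "\<phi>' \<in> borel_measurable borel"
    and der: "\<And>y. y > 0 \<Longrightarrow> (\<phi> has_real_derivative \<phi>' y) (at y)"
    and cont': "\<And>y. y > 0 \<Longrightarrow> isCont \<phi>' y"
    and bound: "\<And>y. y > 0 \<Longrightarrow> \<bar>\<phi> y\<bar> \<le> C" "\<And>y. y > 0 \<Longrightarrow> \<bar>\<phi> y\<bar> \<le> C * y powr (- \<alpha>)"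
    and bound': "\<And>y. y > 0 \<Longrightarrow> \<bar>\<phi>' y\<bar> \<le> C" "\<And>y. y > 0 \<Longrightarrow> \<bar>\<phi>' y\<bar> \<le> C * y powr (- \<alpha> - 1)"
begin

lemma C_nonneg: "C \<ge> 0"
  using bound(1)[of 1] by (simp add: order_trans[OF abs_ge_zero])

lemma has_mellin_mel:
  assumes s: "0 < Re s" "Re s < \<alpha>"
  shows "has_mellin (\<lambda>x. of_real (\<phi> x)) s (mel \<phi> s)"
  unfolding has_mellin_def mel_def
proof (intro conjI refl integrable_powr_bound)
  show "Re s - 1 > - 1" "Re s - 1 - \<alpha> < - 1" using s by auto
  show "norm (complex_of_real (\<phi> x) * of_real x powr (s - 1)) \<le> C * x powr (Re s - 1)" if "0 < x" for x
    using that bound(1)[OF that] by (simp add: norm_mult norm_of_real_powr mult_right_mono)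
  show "norm (complex_of_real (\<phi> x) * of_real x powr (s - 1)) \<le> C * x powr (Re s - 1 - \<alpha>)" if "1 < x" for x
  proof -
    have "\<bar>\<phi> x\<bar> * x powr (Re s - 1) \<le> C * x powr (- \<alpha>) * x powr (Re s - 1)"
      using that by (intro mult_right_mono bound(2)) auto
    also have "\<dots> = C * x powr (Re s - 1 - \<alpha>)" by (simp add: powr_add[symmetric])
    finally show ?thesis using that by (simp add: norm_mult norm_of_real_powr)
  qed
qed measurable

lemma integrable_\<phi>: "integrable lborel (\<lambda>x. indicator {0<..} x *\<^sub>R \<phi> x)"
proof (rule integrable_powr_bound)
  show "norm (\<phi> x) \<le> C * x powr 0" if "0 < x" for x using bound(1)[OF that] that by simp
  show "norm (\<phi> x) \<le> C * x powr (- \<alpha>)" if "1 < x" for x using bound(2)[of x] that by simp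
qed (use \<alpha> in auto)

definition I where "I = (LINT x|lborel. indicator {0<..} x *\<^sub>R \<phi> x)"

lemma mel_1: "mel \<phi> 1 = of_real I"
proof -
  have "mel \<phi> 1 = (LINT x|lborel. complex_of_real (indicator {0<..} x *\<^sub>R \<phi> x))"
    unfolding mel_def by (intro Bochner_Integration.integral_cong) (auto simp: indicator_def scaleR_conv_of_real)
  then show ?thesis unfolding I_def by (simp only: integral_complex_of_real)
qed

text \<open>Integration by parts: the sum of the new integrand and s times the old one is the
  derivative of \<open>\<phi> x * x powr s\<close>, which vanishes at 0 because
  \<open>Re s > 0\<close> and at infinity because \<open>Re s < \<alpha>\<close>.\<close>

lemma has_mellin_theta:
  assumes s: "0 < Re s" "Re s < \<alpha>"
  shows "has_mellin (\<lambda>x. of_real (x * \<phi>' x)) s (- s * mel \<phi> s)"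
proof -
  let ?F = "\<lambda>x. of_real (\<phi> x) * complex_of_real x powr s"
  let ?g = "\<lambda>x. of_real (x * \<phi>' x) * complex_of_real x powr (s - 1)"
  let ?h = "\<lambda>x. of_real (\<phi> x) * complex_of_real x powr (s - 1)"
  have h: "integrable lborel (\<lambda>x. indicator {0<..} x *\<^sub>R ?h x)"
    and mel: "(LINT x|lborel. indicator {0<..} x *\<^sub>R ?h x) = mel \<phi> s"
    using has_mellin_mel[OF s] unfolding has_mellin_def by auto
  have g: "integrable lborel (\<lambda>x. indicator {0<..} x *\<^sub>R ?g x)"
  proof (rule integrable_powr_bound)
    show "Re s > - 1" "Re s - 1 - \<alpha> < - 1" using s by auto
    show "norm (?g x) \<le> C * x powr Re s" if "0 < x" "x \<le> 1" for x
    proof -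
      have "x * \<bar>\<phi>' x\<bar> * x powr (Re s - 1) \<le> x * C * x powr (Re s - 1)"
        using that by (intro mult_right_mono mult_left_mono bound'(1)) auto
      then show ?thesis using that by (simp add: norm_mult norm_of_real_powr powr_diff abs_mult mult_ac)
    qed
    show "norm (?g x) \<le> C * x powr (Re s - 1 - \<alpha>)" if "1 < x" for x
    proof -
      have "x * \<bar>\<phi>' x\<bar> * x powr (Re s - 1) \<le> x * (C * x powr (- \<alpha> - 1)) * x powr (Re s - 1)"
        using that by (intro mult_right_mono mult_left_mono bound'(2)) auto
      also have "\<dots> = C * (x * x powr (- \<alpha> - 1) * x powr (Re s - 1))" by (simp only: mult_ac)
      also have "x * x powr (- \<alpha> - 1) * x powr (Re s - 1) = x powr (Re s - 1 - \<alpha>)"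
        using that by (simp add: powr_mult_base powr_add[symmetric])
      finally show ?thesis using that by (simp add: norm_mult norm_of_real_powr abs_mult)
    qed
  qed measurable
  have sum: "(\<lambda>x. indicator {0<..} x *\<^sub>R (?g x + s * ?h x)) = (\<lambda>x. indicator {0<..} x *\<^sub>R ?g x + s * (indicator {0<..} x *\<^sub>R ?h x))"
    by (simp add: fun_eq_iff scaleR_add_right)
  have ein: "einterval 0 \<infinity> = {0::real<..}" by (simp add: zero_ereal_def)
  have "(LBINT x=0..\<infinity>. ?g x + s * ?h x) = 0 - 0"
  proof (rule interval_integral_FTC_integrable)
    show "(0::ereal) < \<infinity>" by simp
    show "set_integrable lborel (einterval 0 \<infinity>) (\<lambda>x. ?g x + s * ?h x)"
      unfolding set_integrable_def ein sum by (intro Bochner_Integration.integrable_add g integrable_mult_right h)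
    fix x assume "0 < ereal x" "ereal x < \<infinity>"
    then have x: "x > 0" by simp
    have "((\<lambda>x. complex_of_real (\<phi> x)) has_vector_derivative of_real (\<phi>' x)) (at x)"
      using der[OF x] has_vector_derivative_of_real by blast
    from has_vector_derivative_mult[OF this has_vector_derivative_of_real_powr[OF x, of s]]
    have "(?F has_vector_derivative of_real (\<phi> x) * (s * of_real x powr (s - 1)) + of_real (\<phi>' x) * of_real x powr s) (at x)" .
    moreover have "complex_of_real x powr s = of_real x * of_real x powr (s - 1)" using x by (simp add: powr_diff)
    ultimately show "(?F has_vector_derivative ?g x + s * ?h x) (at x)" by (simp add: mult_ac add_ac)
    show "isCont (\<lambda>x. ?g x + s * ?h x) x"
      using x DERIV_isCont[OF der[OF x]] cont'[OF x] has_vector_derivative_continuous[OF has_vector_derivative_of_real_powr[OF x]]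
      by (intro continuous_intros) auto
  next
    show "((?F \<circ> real_of_ereal) \<longlongrightarrow> 0) (at_right 0)"
      unfolding zero_ereal_def ereal_tendsto_simps
    proof (rule Lim_null_comparison)
      show "\<forall>\<^sub>F x in at_right 0. norm (?F x) \<le> C * x powr Re s"
        using eventually_at_right_less[of 0]
        by eventually_elim (simp add: norm_mult norm_of_real_powr mult_right_mono bound(1))
      show "((\<lambda>x. C * x powr Re s) \<longlongrightarrow> 0) (at_right 0)" using s by real_asymp
    qed
    show "((?F \<circ> real_of_ereal) \<longlongrightarrow> 0) (at_left \<infinity>)"
      unfolding ereal_tendsto_simps
    proof (rule Lim_null_comparison)
      show "\<forall>\<^sub>F x in at_top. norm (?F x) \<le> C * x powr (- \<alpha>) * x powr Re s"
        using eventually_gt_at_top[of 0]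
        by eventually_elim (simp add: norm_mult norm_of_real_powr mult_right_mono bound(2))
      show "((\<lambda>x. C * x powr (- \<alpha>) * x powr Re s) \<longlongrightarrow> 0) at_top"
      proof -
        have "((\<lambda>x::real. C * x powr (Re s - \<alpha>)) \<longlongrightarrow> 0) at_top" using s by real_asymp
        then show ?thesis by (simp add: powr_add[symmetric] mult.assoc)
      qed
    qed
  qed
  also have "(LBINT x=0..\<infinity>. ?g x + s * ?h x) = (LINT x|lborel. indicator {0<..} x *\<^sub>R (?g x + s * ?h x))"
    unfolding zero_ereal_def interval_integral_to_infinity_eq set_lebesgue_integral_def ..
  also have "\<dots> = (LINT x|lborel. indicator {0<..} x *\<^sub>R ?g x) + s * mel \<phi> s"
    unfolding sum mel[symmetric] integral_mult_right_zero[symmetric]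
    by (intro Bochner_Integration.integral_add g integrable_mult_right h)
  finally have "(LINT x|lborel. indicator {0<..} x *\<^sub>R ?g x) = - s * mel \<phi> s"
    by (simp add: eq_neg_iff_add_eq_0)
  with g show ?thesis unfolding has_mellin_def by blast
qed

definition S where "S x = (\<Sum>k. \<phi> (real (Suc k) * x))"

lemma summable_S: "x > 0 \<Longrightarrow> summable (\<lambda>k. \<bar>\<phi> (real (Suc k) * x)\<bar>)"
  using sum_over_multiples(2)[of \<alpha> \<phi> C "\<lambda>_. 0" 1 x] \<alpha> bound(2) by simp

lemma sums_S: "x > 0 \<Longrightarrow> (\<lambda>k. \<phi> (real (Suc k) * x)) sums S x"
  unfolding S_def using summable_S[of x] by (intro summable_sums summable_norm_cancel[of "\<lambda>k. \<phi> (real (Suc k) * x)"]) simp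

lemma S_bound:
  obtains B where "\<And>x. x > 0 \<Longrightarrow> \<bar>S x\<bar> \<le> B * x powr (- \<alpha>)"
proof -
  let ?p = "\<lambda>k. real (Suc k) powr (- \<alpha>)"
  have p: "summable ?p" by (rule summable_Suc_powr[OF \<alpha>])
  have "\<bar>S x\<bar> \<le> C * suminf ?p * x powr (- \<alpha>)" if x: "x > 0" for x
  proof -
    have b: "\<bar>\<phi> (real (Suc k) * x)\<bar> \<le> C * x powr (- \<alpha>) * ?p k" for k
      using bound(2)[of "real (Suc k) * x"] x by (simp add: powr_mult mult_ac del: of_nat_Suc)
    have "\<bar>S x\<bar> \<le> (\<Sum>k. \<bar>\<phi> (real (Suc k) * x)\<bar>)"
      unfolding S_def by (rule summable_rabs[OF summable_S[OF x]])
    also have "\<dots> \<le> (\<Sum>k. C * x powr (- \<alpha>) * ?p k)"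
      by (rule suminf_le[OF b summable_S[OF x] summable_mult[OF p]])
    also have "\<dots> = C * x powr (- \<alpha>) * suminf ?p" by (rule suminf_mult[OF p])
    finally show ?thesis by (simp add: mult_ac)
  qed
  then show ?thesis by (rule that)
qed

text \<open>The total variation of \<open>\<phi>\<close>. It is unchanged under the substitution of
  \<open>x * t\<close> for t and therefore bounds the remainder \<open>S x - I / x\<close>, with all
  its partial versions, uniformly in x.\<close>

definition B where "B = (LINT x|lborel. indicator {0<..} x *\<^sub>R \<bar>\<phi>' x\<bar>)"

lemma abs_deriv_scaled:
  assumes x: "x > 0"
  shows "integrable lborel (\<lambda>t. indicator {0<..} t *\<^sub>R (x * \<bar>\<phi>' (x * t)\<bar>))"
    and "(LINT t|lborel. indicator {0<..} t *\<^sub>R (x * \<bar>\<phi>' (x * t)\<bar>)) = B"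
proof -
  let ?f = "\<lambda>x. indicator {0<..} x *\<^sub>R \<bar>\<phi>' x\<bar>"
  have f: "integrable lborel ?f"
  proof (rule integrable_powr_bound)
    show "norm \<bar>\<phi>' x\<bar> \<le> C * x powr 0" if "0 < x" for x using bound'(1)[OF that] that by simp
    show "norm \<bar>\<phi>' x\<bar> \<le> C * x powr (- \<alpha> - 1)" if "1 < x" for x using bound'(2)[of x] that by simp
  qed (use \<alpha> in auto)
  have eq: "indicator {0<..} t *\<^sub>R (x * \<bar>\<phi>' (x * t)\<bar>) = x * ?f (0 + x * t)" for t
    using x by (simp add: indicator_def zero_less_mult_iff)
  show "integrable lborel (\<lambda>t. indicator {0<..} t *\<^sub>R (x * \<bar>\<phi>' (x * t)\<bar>))"
    unfolding eq using x by (intro integrable_mult_right lborel_integrable_real_affine f) auto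
  have "B = \<bar>x\<bar> *\<^sub>R (LINT t|lborel. ?f (0 + x * t))"
    unfolding B_def using x by (intro lborel_integral_real_affine) auto
  then show "(LINT t|lborel. indicator {0<..} t *\<^sub>R (x * \<bar>\<phi>' (x * t)\<bar>)) = B"
    unfolding eq integral_mult_right_zero using x by simp
qed

lemma frac_integrable:
  assumes x: "x > 0"
  shows "set_integrable lborel {0..} (\<lambda>t. frac t *\<^sub>R x *\<^sub>R \<phi>' (x * t))"
  unfolding set_integrable_def
proof (rule Bochner_Integration.integrable_bound[OF abs_deriv_scaled(1)[OF x]])
  show "AE t in lborel. norm (indicator {0..} t *\<^sub>R (frac t *\<^sub>R x *\<^sub>R \<phi>' (x * t)))
      \<le> norm (indicator {0<..} t *\<^sub>R (x * \<bar>\<phi>' (x * t)\<bar>))"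
  proof (rule AE_I2)
    fix t :: real
    have "\<bar>frac t\<bar> * (x * \<bar>\<phi>' (x * t)\<bar>) \<le> 1 * (x * \<bar>\<phi>' (x * t)\<bar>)"
      using frac_ge_0[of t] frac_lt_1[of t] x by (intro mult_right_mono) auto
    then show "norm (indicator {0..} t *\<^sub>R (frac t *\<^sub>R x *\<^sub>R \<phi>' (x * t))) \<le> norm (indicator {0<..} t *\<^sub>R (x * \<bar>\<phi>' (x * t)\<bar>))"
      using x by (cases "t = 0") (auto simp: indicator_def abs_mult)
  qed
qed measurable

lemma frac_integral_bound:
  assumes x: "x > 0" and A: "A \<in> sets borel" "A \<subseteq> {0..}"
  shows "\<bar>LINT t:A|lborel. frac t *\<^sub>R x *\<^sub>R \<phi>' (x * t)\<bar> \<le> B"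
proof -
  have "\<bar>LINT t:A|lborel. frac t *\<^sub>R x *\<^sub>R \<phi>' (x * t)\<bar> \<le> (LINT t|lborel. \<bar>indicator A t *\<^sub>R (frac t *\<^sub>R x *\<^sub>R \<phi>' (x * t))\<bar>)"
    unfolding set_lebesgue_integral_def by (rule integral_abs_bound)
  also have "\<dots> \<le> (LINT t|lborel. indicator {0<..} t *\<^sub>R (x * \<bar>\<phi>' (x * t)\<bar>))"
  proof (rule integral_mono[OF integrable_abs abs_deriv_scaled(1)[OF x]])
    show "integrable lborel (\<lambda>t. indicator A t *\<^sub>R (frac t *\<^sub>R x *\<^sub>R \<phi>' (x * t)))"
      using set_integrable_subset[OF frac_integrable[OF x]] A unfolding set_integrable_def by auto
    fix t :: real
    have "\<bar>frac t\<bar> * (x * \<bar>\<phi>' (x * t)\<bar>) \<le> 1 * (x * \<bar>\<phi>' (x * t)\<bar>)"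
      using frac_ge_0[of t] frac_lt_1[of t] x by (intro mult_right_mono) auto
    moreover have "t \<in> A \<Longrightarrow> t \<ge> 0" using A by auto
    ultimately show "\<bar>indicator A t *\<^sub>R (frac t *\<^sub>R x *\<^sub>R \<phi>' (x * t))\<bar> \<le> indicator {0<..} t *\<^sub>R (x * \<bar>\<phi>' (x * t)\<bar>)"
      using x by (cases "t = 0") (auto simp: indicator_def abs_mult)
  qed
  also have "\<dots> = B" by (rule abs_deriv_scaled(2)[OF x])
  finally show ?thesis .
qed

lemma set_integrable_\<phi>_scaled:
  assumes x: "x > 0"
  shows "set_integrable lborel {0..} (\<lambda>t. \<phi> (x * t))" "(LINT t:{0..}|lborel. \<phi> (x * t)) = I / x"
proof -
  let ?f = "\<lambda>x. indicator {0<..} x *\<^sub>R \<phi> x"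
  have eq: "AE t in lborel. ?f (0 + x * t) = indicator {0..} t *\<^sub>R \<phi> (x * t)"
    using AE_lborel_singleton[of 0]
    by eventually_elim (use x in \<open>auto simp: indicator_def zero_less_mult_iff\<close>)
  have f: "integrable lborel (\<lambda>t. ?f (0 + x * t))"
    using x by (intro lborel_integrable_real_affine integrable_\<phi>) auto
  show "set_integrable lborel {0..} (\<lambda>t. \<phi> (x * t))"
    unfolding set_integrable_def by (rule integrable_cong_AE_imp[OF f _ eq]) measurable
  have "(LINT t:{0..}|lborel. \<phi> (x * t)) = (LINT t|lborel. ?f (0 + x * t))"
    unfolding set_lebesgue_integral_def by (rule integral_cong_AE[OF _ _ AE_symmetric[OF eq]]) measurable
  also have "I = \<bar>x\<bar> *\<^sub>R (LINT t|lborel. ?f (0 + x * t))"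
    unfolding I_def using x by (intro lborel_integral_real_affine) auto
  then have "(LINT t|lborel. ?f (0 + x * t)) = I / x" using x by simp
  finally show "(LINT t:{0..}|lborel. \<phi> (x * t)) = I / x" .
qed

text \<open>The first bound is uniform in N and x although the sum and the integral taken separately
  may grow like 1/x near 0; it is the dominating constant when the remainder is integrated over (0,
  Y).\<close>

lemma partial_sum_minus_integral:
  assumes x: "x > 0"
  shows "\<bar>(\<Sum>k=1..N. \<phi> (x * real k)) - (LINT t:{0..real N}|lborel. \<phi> (x * t))\<bar> \<le> B"
    and "(\<lambda>N. (\<Sum>k=1..N. \<phi> (x * real k)) - (LINT t:{0..real N}|lborel. \<phi> (x * t))) \<longlonglongrightarrow> S x - I / x"
    and "(LINT t:{0..}|lborel. frac t *\<^sub>R x *\<^sub>R \<phi>' (x * t)) = S x - I / x"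
proof -
  have der': "(\<phi> has_vector_derivative \<phi>' y) (at y)" if "y > 0" for y
    using der[OF that] by (simp add: has_real_derivative_iff_has_vector_derivative)
  have zero: "((\<lambda>t. t *\<^sub>R \<phi> t) \<longlongrightarrow> 0) (at_right 0)"
  proof (rule Lim_null_comparison)
    show "\<forall>\<^sub>F t in at_right 0. norm (t *\<^sub>R \<phi> t) \<le> t * C"
      using eventually_at_right_less[of 0] by eventually_elim (simp add: abs_mult bound(1) mult_left_mono)
    show "((\<lambda>t. t * C) \<longlongrightarrow> 0) (at_right 0)" by real_asymp
  qed
  have int1: "set_integrable lborel {0..real N} (\<lambda>t. \<phi> (x * t))" for N
    using set_integrable_\<phi>_scaled(1)[OF x] by (rule set_integrable_subset) auto
  note smi = sum_minus_integral[OF x der' zero int1 frac_integrable[OF x]]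
  show "\<bar>(\<Sum>k=1..N. \<phi> (x * real k)) - (LINT t:{0..real N}|lborel. \<phi> (x * t))\<bar> \<le> B"
    using frac_integral_bound[OF x, of "{0..real N}"] smi(1)[of N] by simp
  have "(\<lambda>N. \<Sum>k=1..N. \<phi> (x * real k)) \<longlonglongrightarrow> S x"
    using sums_S[OF x] unfolding sums_def by (simp add: sum.atLeast1_atMost_eq mult.commute del: of_nat_Suc)
  moreover have "(\<lambda>N. LINT t:{0..real N}|lborel. \<phi> (x * t)) \<longlonglongrightarrow> (LINT t:{0..}|lborel. \<phi> (x * t))"
    by (rule filterlim_compose[OF tendsto_set_lebesgue_integral_at_top[OF _ set_integrable_\<phi>_scaled(1)[OF x]] filterlim_real_sequentially]) auto
  ultimately show lim: "(\<lambda>N. (\<Sum>k=1..N. \<phi> (x * real k)) - (LINT t:{0..real N}|lborel. \<phi> (x * t))) \<longlonglongrightarrow> S x - I / x"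
    unfolding set_integrable_\<phi>_scaled(2)[OF x] by (rule tendsto_diff)
  from LIMSEQ_unique[OF smi(2) lim] show "(LINT t:{0..}|lborel. frac t *\<^sub>R x *\<^sub>R \<phi>' (x * t)) = S x - I / x" .
qed

lemma abs_G_le: "x > 0 \<Longrightarrow> \<bar>S x - I / x\<bar> \<le> B"
  using frac_integral_bound[of x "{0..}"] partial_sum_minus_integral(3)[of x] by simp

lemma has_mellin_G:
  assumes s: "0 < Re s" "Re s < 1"
  shows "has_mellin (\<lambda>x. of_real (S x - I / x)) s (zeta s * mel \<phi> s)"
proof -
  have [measurable]: "(\<lambda>t. frac t / t :: real) \<in> borel_measurable borel" "(\<lambda>y. y * \<phi>' y) \<in> borel_measurable borel" by measurable
  have "s \<noteq> 0" using s by auto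
  then have val: "- zeta s / s * (- s * mel \<phi> s) = zeta s * mel \<phi> s" by simp
  have "has_mellin (\<lambda>x. of_real (LINT t|lborel. indicator {0<..} t * (frac t / t * (x * t * \<phi>' (x * t))))) s (- zeta s / s * (- s * mel \<phi> s))"
    using s \<alpha> by (intro has_mellin_convolution has_mellin_frac has_mellin_theta) auto
  then show ?thesis unfolding val
  proof (rule has_mellin_cong[THEN iffD1, rotated])
    fix x :: real assume x: "x > 0"
    have "(LINT t|lborel. indicator {0<..} t * (frac t / t * (x * t * \<phi>' (x * t)))) = (LINT t:{0..}|lborel. frac t *\<^sub>R x *\<^sub>R \<phi>' (x * t))"
      unfolding set_lebesgue_integral_def by (intro Bochner_Integration.integral_cong refl) (auto simp: indicator_def)
    then show "complex_of_real (LINT t|lborel. indicator {0<..} t * (frac t / t * (x * t * \<phi>' (x * t)))) = of_real (S x - I / x)"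
      by (simp only: partial_sum_minus_integral(3)[OF x])
  qed
qed

lemma S_measurable [measurable]: "S \<in> borel_measurable borel"
  unfolding S_def[abs_def] by measurable

lemma S_has_derivative:
  assumes x: "x > 0"
  shows "(S has_real_derivative (\<Sum>k. real (Suc k) * \<phi>' (real (Suc k) * x))) (at x)"
proof -
  let ?f = "\<lambda>k y. \<phi> (real (Suc k) * y)" and ?f' = "\<lambda>k y. real (Suc k) * \<phi>' (real (Suc k) * y)"
  \<comment> \<open>Away from 0 the derived series has a uniform majorant: the factor
    \<open>Suc k\<close> turns the decay of order \<open>- \<alpha> - 1\<close> into
    \<open>- \<alpha>\<close>, which is still summable.\<close>
  let ?T = "{x / 2<..}" and ?p = "\<lambda>k. real (Suc k) powr (- \<alpha>)"
  have p: "summable ?p" by (rule summable_Suc_powr[OF \<alpha>])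
  have "uniformly_convergent_on ?T (\<lambda>n y. \<Sum>k<n. ?f' k y)"
  proof (rule Weierstrass_m_test'[OF _ summable_mult[OF p, of "C * (x / 2) powr (- \<alpha> - 1)"]])
    fix k y assume y: "y \<in> ?T"
    then have y0: "y > 0" using x by auto
    have "norm (?f' k y) \<le> real (Suc k) * (C * (real (Suc k) * y) powr (- \<alpha> - 1))"
      unfolding real_norm_def abs_mult using y0 by (intro mult_mono bound'(2)) auto
    also have "\<dots> = C * y powr (- \<alpha> - 1) * ?p k"
      using y0 by (simp add: powr_mult powr_diff field_simps del: of_nat_Suc)
    also have "\<dots> \<le> C * (x / 2) powr (- \<alpha> - 1) * ?p k"
      using x y \<alpha> C_nonneg by (intro mult_right_mono mult_left_mono powr_mono2') auto
    finally show "norm (?f' k y) \<le> C * (x / 2) powr (- \<alpha> - 1) * ?p k" .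
  qed
  moreover have "(?f k has_real_derivative ?f' k y) (at y)" if "y \<in> ?T" for k y
  proof -
    have "real (Suc k) * y > 0" using that x by (intro mult_pos_pos) auto
    then have "(?f k has_real_derivative \<phi>' (real (Suc k) * y) * real (Suc k)) (at y)"
      by (intro DERIV_chain2[where g = "(*) (real (Suc k))" and f = \<phi>] der)
        (auto intro!: derivative_eq_intros simp del: of_nat_Suc)
    then show ?thesis by (simp only: mult.commute)
  qed
  moreover have "summable (\<lambda>k. ?f k x)" using sums_S[OF x] by (rule sums_summable)
  ultimately have "((\<lambda>y. \<Sum>k. ?f k y) has_field_derivative (\<Sum>k. ?f' k x)) (at x)"
    using x by (intro has_field_derivative_series'(2)[of ?T ?f ?f' x x]) (auto intro: has_field_derivative_at_within simp: interior_open)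
  then show ?thesis unfolding S_def[abs_def] .
qed

section \<open>The integral of the first remainder over (0, Y)\<close>

definition \<Phi> where "\<Phi> v = integral {0..v} \<phi>"
definition J where "J = (LINT u|lborel. indicator {0<..} u *\<^sub>R (\<phi> u * ln u))"
definition \<Lambda> where "\<Lambda> v = integral {0..v} (\<lambda>u. \<phi> u * ln u)"

lemma set_integrable_\<phi>: "set_integrable lborel {0..} \<phi>" and LINT_\<phi>: "(LINT u:{0..}|lborel. \<phi> u) = I"
  using set_integrable_\<phi>_scaled[of 1] by simp_all

lemma set_integrable_\<phi>_ln: "set_integrable lborel {0..} (\<lambda>u. \<phi> u * ln u)" (is ?th1)
  and LINT_\<phi>_ln: "(LINT u:{0..}|lborel. \<phi> u * ln u) = J" (is ?th2)
proof -
  have eq: "indicator {0..} u *\<^sub>R (\<phi> u * ln u) = indicator {0<..} u *\<^sub>R (\<phi> u * ln u)" for u :: real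
    by (cases "u = 0") (auto simp: indicator_def)
  \<comment> \<open>Half of the margin between \<open>\<alpha>\<close> and 1 is spent on the growth
    of the logarithm at infinity.\<close>
  define \<delta> where "\<delta> = (\<alpha> - 1) / 2"
  have \<delta>: "\<delta> > 0" using \<alpha> by (simp add: \<delta>_def)
  have "integrable lborel (\<lambda>u. indicator {0<..} u *\<^sub>R (\<phi> u * ln u))"
  proof (rule integrable_powr_bound)
    show "- 1 / 2 > (- 1 :: real)" "\<delta> - \<alpha> < - 1" using \<alpha> by (auto simp: \<delta>_def field_simps)
    show "norm (\<phi> u * ln u) \<le> C * max 2 (1 / \<delta>) * u powr (- 1 / 2)" if u: "0 < u" "u \<le> 1" for u
    proof -
      have "ln (1 / u) \<le> (1 / u) powr (1 / 2) / (1 / 2)" using u by (intro ln_powr_bound) auto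
      then have "\<bar>ln u\<bar> \<le> 2 * u powr (- 1 / 2)"
        using u by (simp add: ln_div powr_divide powr_minus field_simps abs_if)
      also have "\<dots> \<le> max 2 (1 / \<delta>) * u powr (- 1 / 2)" by (intro mult_right_mono) auto
      finally have "\<bar>\<phi> u\<bar> * \<bar>ln u\<bar> \<le> C * (max 2 (1 / \<delta>) * u powr (- 1 / 2))"
        using bound(1)[OF u(1)] C_nonneg by (intro mult_mono) auto
      then show ?thesis by (simp add: abs_mult mult.assoc)
    qed
    show "norm (\<phi> u * ln u) \<le> C * max 2 (1 / \<delta>) * u powr (\<delta> - \<alpha>)" if u: "1 < u" for u
    proof -
      have "\<bar>ln u\<bar> \<le> 1 / \<delta> * u powr \<delta>" using ln_powr_bound[of u \<delta>] u \<delta> by simp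
      also have "\<dots> \<le> max 2 (1 / \<delta>) * u powr \<delta>" by (intro mult_right_mono) auto
      finally have "\<bar>\<phi> u\<bar> * \<bar>ln u\<bar> \<le> (C * u powr (- \<alpha>)) * (max 2 (1 / \<delta>) * u powr \<delta>)"
        using bound(2)[of u] u C_nonneg by (intro mult_mono) auto
      also have "\<dots> = C * max 2 (1 / \<delta>) * u powr (\<delta> - \<alpha>)" by (simp add: powr_diff powr_minus field_simps)
      finally show ?thesis by (simp add: abs_mult)
    qed
  qed measurable
  then show ?th1 unfolding set_integrable_def eq .
  show ?th2 unfolding set_lebesgue_integral_def eq J_def ..
qed

lemma \<Phi>_LINT: "\<Phi> v = (LINT u:{0..v}|lborel. \<phi> u)"
  and \<Phi>_integrable: "\<phi> integrable_on {0..v}"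
  using set_borel_integral_eq_integral[OF set_integrable_subset[OF set_integrable_\<phi>, of "{0..v}"]] by (auto simp: \<Phi>_def)

lemma \<Lambda>_LINT: "\<Lambda> v = (LINT u:{0..v}|lborel. \<phi> u * ln u)"
  and \<Lambda>_integrable: "(\<lambda>u. \<phi> u * ln u) integrable_on {0..v}"
  using set_borel_integral_eq_integral[OF set_integrable_subset[OF set_integrable_\<phi>_ln, of "{0..v}"]] by (auto simp: \<Lambda>_def)

lemma \<Phi>_lim: "(\<Phi> \<longlongrightarrow> I) at_top"
  using tendsto_set_lebesgue_integral_at_top[OF _ set_integrable_\<phi>] unfolding LINT_\<phi> \<Phi>_LINT[abs_def] by simp

lemma \<Lambda>_lim: "(\<Lambda> \<longlongrightarrow> J) at_top"
  using tendsto_set_lebesgue_integral_at_top[OF _ set_integrable_\<phi>_ln] unfolding LINT_\<phi>_ln \<Lambda>_LINT[abs_def] by simp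

lemma integral_has_derivative_interior:
  fixes g :: "real \<Rightarrow> real"
  assumes "\<And>v. g integrable_on {0..v}" "v > 0" "isCont g v"
  shows "((\<lambda>v. integral {0..v} g) has_real_derivative g v) (at v)"
proof -
  have "((\<lambda>u. integral {0..u} g) has_vector_derivative g v) (at v within {0..v + 1} - {})"
    using assms by (intro integral_has_vector_derivative_continuous_at) (auto intro: continuous_at_imp_continuous_at_within)
  moreover have "at v within {0..v + 1} - {} = at v"
    using assms by (intro at_within_interior) simp
  ultimately show ?thesis by (simp only: has_real_derivative_iff_has_vector_derivative)
qed

lemma \<Phi>_deriv: "v > 0 \<Longrightarrow> (\<Phi> has_real_derivative \<phi> v) (at v)"
  unfolding \<Phi>_def[abs_def] by (intro integral_has_derivative_interior \<Phi>_integrable DERIV_isCont[OF der])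

lemma \<Lambda>_deriv: "v > 0 \<Longrightarrow> (\<Lambda> has_real_derivative \<phi> v * ln v) (at v)"
  unfolding \<Lambda>_def[abs_def]
  by (intro integral_has_derivative_interior[of "\<lambda>u. \<phi> u * ln u"] \<Lambda>_integrable continuous_intros DERIV_isCont[OF der]) auto

lemma \<Phi>_cont: "continuous_on {0..b} \<Phi>" and \<Lambda>_cont: "continuous_on {0..b} \<Lambda>"
  unfolding \<Phi>_def[abs_def] \<Lambda>_def[abs_def]
  by (rule indefinite_integral_continuous_1[OF \<Phi>_integrable], rule indefinite_integral_continuous_1[OF \<Lambda>_integrable])

lemma \<Phi>_0: "\<Phi> 0 = 0" and \<Lambda>_0: "\<Lambda> 0 = 0"
  by (simp_all add: \<Phi>_def \<Lambda>_def)

lemma \<Phi>_bound: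
  assumes "v > 0"
  shows "\<bar>\<Phi> v\<bar> \<le> C * v"
proof -
  have "norm (\<Phi> v - \<Phi> 0) \<le> C * v - C * 0"
  proof (rule differentiable_bound_general[OF assms \<Phi>_cont])
    fix x :: real assume x: "0 < x"
    show "(\<Phi> has_vector_derivative \<phi> x) (at x)"
      using \<Phi>_deriv[OF x] by (simp only: has_real_derivative_iff_has_vector_derivative)
    show "((\<lambda>v. C * v) has_vector_derivative C) (at x)"
      unfolding has_real_derivative_iff_has_vector_derivative[symmetric] by (auto intro!: derivative_eq_intros)
    show "norm (\<phi> x) \<le> C" using bound(1)[OF x] by simp
  qed (auto intro!: continuous_intros)
  then show ?thesis by (simp add: \<Phi>_0)
qed

lemma \<Phi>_tail:
  assumes v: "v > 0"
  shows "\<bar>I - \<Phi> v\<bar> \<le> C / (\<alpha> - 1) * v powr (1 - \<alpha>)"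
proof (rule tendsto_upperbound)
  show "((\<lambda>w. \<bar>\<Phi> w - \<Phi> v\<bar>) \<longlongrightarrow> \<bar>I - \<Phi> v\<bar>) at_top"
    by (intro tendsto_intros \<Phi>_lim)
  show "\<forall>\<^sub>F w in at_top. \<bar>\<Phi> w - \<Phi> v\<bar> \<le> C / (\<alpha> - 1) * v powr (1 - \<alpha>)"
    using eventually_gt_at_top[of v]
  proof eventually_elim
    fix w assume w: "w > v"
    let ?K = "\<lambda>w. - (C / (\<alpha> - 1)) * w powr (1 - \<alpha>)"
    have "norm (\<Phi> w - \<Phi> v) \<le> ?K w - ?K v"
    proof (rule differentiable_bound_general[OF w])
      show "continuous_on {v..w} \<Phi>" using v by (intro continuous_on_subset[OF \<Phi>_cont[of w]]) auto
      show "continuous_on {v..w} ?K" using v by (intro continuous_intros) auto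
      fix x assume "v < x"
      then have x: "x > 0" using v by simp
      show "(\<Phi> has_vector_derivative \<phi> x) (at x)"
        using \<Phi>_deriv[OF x] by (simp only: has_real_derivative_iff_has_vector_derivative)
      have "(?K has_real_derivative - (C / (\<alpha> - 1)) * ((1 - \<alpha>) * x powr (1 - \<alpha> - 1))) (at x)"
        by (intro DERIV_cmult has_real_derivative_powr x)
      also have "- (C / (\<alpha> - 1)) * ((1 - \<alpha>) * x powr (1 - \<alpha> - 1)) = C * x powr (- \<alpha>)"
        using \<alpha> by (simp add: field_simps)
      finally show "(?K has_vector_derivative C * x powr (- \<alpha>)) (at x)"
        by (simp only: has_real_derivative_iff_has_vector_derivative)
      show "norm (\<phi> x) \<le> C * x powr (- \<alpha>)" using bound(2)[OF x] by simp
    qed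
    moreover have "C / (\<alpha> - 1) * w powr (1 - \<alpha>) \<ge> 0" using \<alpha> C_nonneg by simp
    ultimately show "\<bar>\<Phi> w - \<Phi> v\<bar> \<le> C / (\<alpha> - 1) * v powr (1 - \<alpha>)" by simp
  qed
qed simp

text \<open>The integral of \<open>\<Phi> u / u\<close> over (0, v), written after integration by
  parts. This form exhibits its growth: W v = I ln v - J + o(1).\<close>

definition W where "W v = \<Phi> v * ln v - \<Lambda> v"

lemma W_deriv: "v > 0 \<Longrightarrow> (W has_real_derivative \<Phi> v / v) (at v)"
  unfolding W_def[abs_def] by (auto intro!: derivative_eq_intros \<Phi>_deriv \<Lambda>_deriv)

lemma W_cont:
  assumes "b > 0"
  shows "continuous_on {0..b} W"
  unfolding continuous_on_eq_continuous_within
proof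
  fix v assume v: "v \<in> {0..b}"
  show "continuous (at v within {0..b}) W"
  proof (cases "v = 0")
    case False
    with v have "v > 0" by simp
    from DERIV_isCont[OF W_deriv[OF this]] show ?thesis by (rule continuous_at_imp_continuous_at_within)
  next
    case True
    have "((\<lambda>v. \<Phi> v * ln v) \<longlongrightarrow> 0) (at_right 0)"
    proof (rule Lim_null_comparison)
      show "\<forall>\<^sub>F v in at_right 0. norm (\<Phi> v * ln v) \<le> C * v * \<bar>ln v\<bar>"
        using eventually_at_right_less[of 0] by eventually_elim (simp add: abs_mult mult_right_mono \<Phi>_bound)
      show "((\<lambda>v. C * v * \<bar>ln v\<bar>) \<longlongrightarrow> 0) (at_right 0)" by real_asymp
    qed
    moreover have "(\<Lambda> \<longlongrightarrow> \<Lambda> 0) (at_right 0)"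
      using \<Lambda>_cont[of b] assms unfolding continuous_on_def by (auto simp: at_within_Icc_at_right dest!: bspec[of _ _ 0])
    ultimately have "((\<lambda>v. \<Phi> v * ln v - \<Lambda> v) \<longlongrightarrow> 0 - \<Lambda> 0) (at_right 0)" by (rule tendsto_diff)
    then show ?thesis
      using True assms by (simp add: continuous_within at_within_Icc_at_right W_def[abs_def] \<Phi>_0)
  qed
qed

lemma has_integral_\<phi>_scaled:
  assumes c: "c > 0" and b: "b \<ge> 0"
  shows "((\<lambda>t. \<phi> (c * t)) has_integral \<Phi> (c * b) / c) {0..b}"
proof -
  have "(\<phi> has_integral \<Phi> (c * b)) {0..c * b}"
    using \<Phi>_integrable[of "c * b"] by (simp add: \<Phi>_def has_integral_integral[symmetric])
  from has_integral_stretch_real[OF this[folded interval_cbox], of c] c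
  have "((\<lambda>t. \<phi> (c * t)) has_integral (1 / c) * \<Phi> (c * b)) ((\<lambda>x. x / c) ` {0..c * b})" by simp
  moreover have "(\<lambda>x. x / c) ` {0..c * b} = {0..b}"
    using c b image_divide_atLeastAtMost[of c 0 "c * b"] by simp
  ultimately show ?thesis by simp
qed

lemma has_integral_W:
  assumes N: "N > 0" and Y: "Y > 0"
  shows "((\<lambda>u. \<Phi> (N * u) / u) has_integral W (N * Y)) {0..Y}"
proof -
  have "((\<lambda>u. \<Phi> (N * u) / u) has_integral W (N * Y) - W (N * 0)) {0..Y}"
  proof (rule fundamental_theorem_of_calculus_interior)
    show "continuous_on {0..Y} (\<lambda>u. W (N * u))"
      by (rule continuous_on_compose2[OF W_cont[of "N * Y"]]) (use N Y in \<open>auto intro!: continuous_intros\<close>)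
    fix u assume u: "u \<in> {0<..<Y}"
    then have "((\<lambda>u. W (N * u)) has_real_derivative \<Phi> (N * u) / (N * u) * N) (at u)"
      using N by (intro DERIV_chain2[where g = "(*) N" and f = W] W_deriv) (auto intro!: derivative_eq_intros)
    then show "((\<lambda>u. W (N * u)) has_vector_derivative \<Phi> (N * u) / u) (at u)"
      using N by (simp add: has_real_derivative_iff_has_vector_derivative)
  qed (use Y in auto)
  then show ?thesis by (simp add: W_def \<Phi>_0 \<Lambda>_0)
qed

text \<open>The error made when each \<open>\<Phi> (k * Y)\<close> in the sum of
  \<open>\<Phi> (k * Y) / k\<close> is replaced by its limit I.\<close>

definition T where "T Y = (\<Sum>k. (I - \<Phi> (real (Suc k) * Y)) / real (Suc k))"

lemma T_bound:
  obtains K where "\<And>Y. Y > 0 \<Longrightarrow> summable (\<lambda>k. (I - \<Phi> (real (Suc k) * Y)) / real (Suc k))"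
    "\<And>Y. Y > 0 \<Longrightarrow> \<bar>T Y\<bar> \<le> K * Y powr (1 - \<alpha>)"
proof -
  let ?p = "\<lambda>k. real (Suc k) powr (- \<alpha>)"
  have p: "summable ?p" by (rule summable_Suc_powr[OF \<alpha>])
  have b: "\<bar>(I - \<Phi> (real (Suc k) * Y)) / real (Suc k)\<bar> \<le> C / (\<alpha> - 1) * Y powr (1 - \<alpha>) * ?p k" if Y: "Y > 0" for Y k
  proof -
    have "\<bar>(I - \<Phi> (real (Suc k) * Y)) / real (Suc k)\<bar> = \<bar>I - \<Phi> (real (Suc k) * Y)\<bar> / real (Suc k)"
      by (simp del: of_nat_Suc)
    also have "\<dots> \<le> (C / (\<alpha> - 1) * (real (Suc k) * Y) powr (1 - \<alpha>)) / real (Suc k)"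
      using Y by (intro divide_right_mono \<Phi>_tail) auto
    also have "\<dots> = C / (\<alpha> - 1) * Y powr (1 - \<alpha>) * (real (Suc k) powr (1 - \<alpha>) / real (Suc k))"
      using Y by (simp add: powr_mult del: of_nat_Suc)
    also have "real (Suc k) powr (1 - \<alpha>) / real (Suc k) = ?p k"
      by (simp add: powr_diff powr_minus field_simps del: of_nat_Suc)
    finally show ?thesis .
  qed
  have sm: "summable (\<lambda>k. \<bar>(I - \<Phi> (real (Suc k) * Y)) / real (Suc k)\<bar>)" if Y: "Y > 0" for Y
    by (rule summable_comparison_test'[OF summable_mult[OF p]]) (use b[OF Y] in \<open>simp only: real_norm_def abs_idempotent\<close>)
  show ?thesis
  proof (rule that[of "C / (\<alpha> - 1) * suminf ?p"])
    fix Y :: real assume Y: "Y > 0"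
    show "summable (\<lambda>k. (I - \<Phi> (real (Suc k) * Y)) / real (Suc k))"
      using sm[OF Y] by (rule summable_rabs_cancel)
    have "\<bar>T Y\<bar> \<le> (\<Sum>k. \<bar>(I - \<Phi> (real (Suc k) * Y)) / real (Suc k)\<bar>)"
      unfolding T_def by (rule summable_rabs[OF sm[OF Y]])
    also have "\<dots> \<le> (\<Sum>k. C / (\<alpha> - 1) * Y powr (1 - \<alpha>) * ?p k)"
      by (rule suminf_le[OF b[OF Y] sm[OF Y] summable_mult[OF p]])
    also have "\<dots> = C / (\<alpha> - 1) * Y powr (1 - \<alpha>) * suminf ?p" by (rule suminf_mult[OF p])
    finally show "\<bar>T Y\<bar> \<le> C / (\<alpha> - 1) * suminf ?p * Y powr (1 - \<alpha>)" by (simp add: mult_ac)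
  qed
qed

text \<open>The partial remainders integrate to the sum of \<open>\<Phi> (k * Y) / k\<close> minus
  \<open>W\<close>. Writing \<Phi> = I - (I - \<Phi>), the first part is I times a harmonic number
  up to \<open>T Y\<close>, and \<open>W\<close> grows like the matching logarithm; the logarithms
  of N cancel and leave Euler's constant, \<open>- I * ln Y\<close> and J. Dominated convergence
  with the constant \<open>B\<close> passes to the limit.\<close>

lemma has_integral_G:
  assumes Y: "Y > 0"
  shows "((\<lambda>u. S u - I / u) has_integral (I * euler_mascheroni - I * ln Y + J - T Y)) {0..Y}"
proof -
  \<comment> \<open>The value 0 at u = 0 makes the uniform bound and the pointwise limit hold on the
    closed interval; one point does not affect the integrals.\<close>
  define f where "f = (\<lambda>N u. if u = 0 then 0 else (\<Sum>k=1..Suc N. \<phi> (real k * u)) - \<Phi> (real (Suc N) * u) / u)"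
  define g where "g = (\<lambda>u. if u = 0 then 0 else S u - I / u)"
  have f: "(f N has_integral (\<Sum>k=1..Suc N. \<Phi> (real k * Y) / real k) - W (real (Suc N) * Y)) {0..Y}" for N
  proof (rule has_integral_spike_finite[of "{0}"])
    show "((\<lambda>u. (\<Sum>k=1..Suc N. \<phi> (real k * u)) - \<Phi> (real (Suc N) * u) / u) has_integral
        (\<Sum>k=1..Suc N. \<Phi> (real k * Y) / real k) - W (real (Suc N) * Y)) {0..Y}"
      using Y by (intro has_integral_diff has_integral_sum has_integral_\<phi>_scaled has_integral_W) auto
  qed (auto simp: f_def)
  have feq: "f N u = (\<Sum>k=1..Suc N. \<phi> (u * real k)) - (LINT t:{0..real (Suc N)}|lborel. \<phi> (u * t))" if "u > 0" for N u
  proof -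
    have "set_integrable lborel {0..real (Suc N)} (\<lambda>t. \<phi> (u * t))"
      using set_integrable_\<phi>_scaled(1)[OF that] by (rule set_integrable_subset) auto
    from set_borel_integral_eq_integral(2)[OF this]
    have "(LINT t:{0..real (Suc N)}|lborel. \<phi> (u * t)) = \<Phi> (u * real (Suc N)) / u"
      using integral_unique[OF has_integral_\<phi>_scaled[OF that, of "real (Suc N)"]] by simp
    then show ?thesis using that by (simp add: f_def mult.commute del: of_nat_Suc)
  qed
  have dc1: "f N integrable_on {0..Y}" for N using f by blast
  have dc2: "(\<lambda>_. B) integrable_on {0..Y}" by (rule integrable_const_ivl)
  have dc3: "norm (f N u) \<le> B" if "u \<in> {0..Y}" for N u
  proof -
    have "B \<ge> 0" using abs_G_le[of 1] by (simp add: order_trans[OF abs_ge_zero])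
    then show ?thesis
      using that partial_sum_minus_integral(1)[of u "Suc N"] feq[of u N] by (cases "u = 0") (simp_all add: f_def)
  qed
  have dc4: "(\<lambda>N. f N u) \<longlonglongrightarrow> g u" if "u \<in> {0..Y}" for u
  proof (cases "u = 0")
    case False
    with that have "u > 0" by simp
    from LIMSEQ_Suc[OF partial_sum_minus_integral(2)[OF this]] show ?thesis
      using feq[OF \<open>u > 0\<close>] False by (simp add: g_def)
  qed (simp add: f_def g_def)
  note dc = dominated_convergence[OF dc1 dc2 dc3 dc4]
  obtain K where sT: "summable (\<lambda>k. (I - \<Phi> (real (Suc k) * Y)) / real (Suc k))"
    using T_bound Y by metis
  have Nlim: "filterlim (\<lambda>N. real (Suc N) * Y) at_top sequentially"
    using Y by real_asymp
  have eq: "integral {0..Y} (f N) = I * (harm (Suc N) - ln (real (Suc N))) - I * ln Y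
      - (\<Sum>k<Suc N. (I - \<Phi> (real (Suc k) * Y)) / real (Suc k)) + (I - \<Phi> (real (Suc N) * Y)) * ln (real (Suc N) * Y) + \<Lambda> (real (Suc N) * Y)" for N
  proof -
    have "(\<Sum>k=1..Suc N. \<Phi> (real k * Y) / real k) = (\<Sum>k=1..Suc N. I * (1 / real k) - (I - \<Phi> (real k * Y)) / real k)"
      by (intro sum.cong refl) (simp add: diff_divide_distrib)
    also have "\<dots> = I * harm (Suc N) - (\<Sum>k=1..Suc N. (I - \<Phi> (real k * Y)) / real k)"
      by (simp only: sum_subtractf sum_distrib_left[symmetric] harm_def inverse_eq_divide)
    also have "(\<Sum>k=1..Suc N. (I - \<Phi> (real k * Y)) / real k) = (\<Sum>k<Suc N. (I - \<Phi> (real (Suc k) * Y)) / real (Suc k))"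
      unfolding One_nat_def by (rule sum.atLeast1_atMost_eq)
    finally have 1: "(\<Sum>k=1..Suc N. \<Phi> (real k * Y) / real k) = I * harm (Suc N) - (\<Sum>k<Suc N. (I - \<Phi> (real (Suc k) * Y)) / real (Suc k))" .
    have 2: "ln (real (Suc N) * Y) = ln (real (Suc N)) + ln Y" using Y by (simp add: ln_mult del: of_nat_Suc)
    show ?thesis unfolding integral_unique[OF f] 1 W_def 2 by (simp add: algebra_simps del: of_nat_Suc sum.lessThan_Suc)
  qed
  have "(\<lambda>N. integral {0..Y} (f N)) \<longlonglongrightarrow> I * euler_mascheroni - I * ln Y - T Y + 0 + J"
    unfolding eq
  proof (intro tendsto_add tendsto_diff tendsto_mult tendsto_const)
    show "(\<lambda>N. harm (Suc N) - ln (real (Suc N))) \<longlonglongrightarrow> euler_mascheroni"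
      by (rule LIMSEQ_Suc[OF euler_mascheroni_LIMSEQ])
    show "(\<lambda>N. \<Sum>k<Suc N. (I - \<Phi> (real (Suc k) * Y)) / real (Suc k)) \<longlonglongrightarrow> T Y"
      unfolding T_def by (rule LIMSEQ_Suc[OF summable_LIMSEQ[OF sT]])
    show "(\<lambda>N. \<Lambda> (real (Suc N) * Y)) \<longlonglongrightarrow> J" by (rule filterlim_compose[OF \<Lambda>_lim Nlim])
    have "((\<lambda>v. (I - \<Phi> v) * ln v) \<longlongrightarrow> 0) at_top"
    proof (rule Lim_null_comparison)
      show "\<forall>\<^sub>F v in at_top. norm ((I - \<Phi> v) * ln v) \<le> C / (\<alpha> - 1) * v powr (1 - \<alpha>) * \<bar>ln v\<bar>"
        using eventually_gt_at_top[of 0] by eventually_elim (unfold real_norm_def abs_mult, rule mult_right_mono[OF \<Phi>_tail], auto)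
      have "((\<lambda>v::real. v powr (1 - \<alpha>) * \<bar>ln v\<bar>) \<longlongrightarrow> 0) at_top" using \<alpha> by real_asymp
      from tendsto_mult_right_zero[OF this, of "C / (\<alpha> - 1)"]
      show "((\<lambda>v. C / (\<alpha> - 1) * v powr (1 - \<alpha>) * \<bar>ln v\<bar>) \<longlongrightarrow> 0) at_top" by (simp only: mult.assoc)
    qed
    from filterlim_compose[OF this Nlim]
    show "(\<lambda>N. (I - \<Phi> (real (Suc N) * Y)) * ln (real (Suc N) * Y)) \<longlonglongrightarrow> 0" .
  qed
  with LIMSEQ_unique[OF dc(2)] dc(1) have "(g has_integral I * euler_mascheroni - I * ln Y - T Y + 0 + J) {0..Y}"
    by (auto simp: has_integral_iff)
  from has_integral_spike_finite[OF _ _ this, of "{0}" "\<lambda>u. S u - I / u"] show ?thesis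
    by (simp add: g_def algebra_simps)
qed

end

section \<open>The second application of the summation formula\<close>

lemma has_mellin_unique: "has_mellin \<phi> s v \<Longrightarrow> has_mellin \<phi> s w \<Longrightarrow> v = w"
  by (simp add: has_mellin_def)

text \<open>\<open>D0\<close> treats \<open>f\<close> and \<open>D1\<close> treats
  \<open>y * f1 y\<close>, whose derivative involves the second derivative \<open>f2\<close>.
  Multiplying the derivative by y restores the lost order of decay, so the same
  \<open>\<alpha>\<close> serves both.\<close>

locale decaying2 = D0: decaying f f1 \<alpha> C0 + D1: decaying "\<lambda>y. y * f1 y" "\<lambda>y. f1 y + y * f2 y" \<alpha> C1
  for f f1 f2 :: "real \<Rightarrow> real" and \<alpha> C0 C1
begin

lemma mel_theta:
  assumes "0 < Re s" "Re s < \<alpha>"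
  shows "mel (\<lambda>y. y * f1 y) s = - s * mel f s"
  using has_mellin_unique[OF D1.has_mellin_mel[OF assms] D0.has_mellin_theta[OF assms]] .

lemma D1_I: "D1.I = - D0.I"
proof -
  have "complex_of_real D1.I = - complex_of_real D0.I"
    using mel_theta[of 1] D0.mel_1 D1.mel_1 D0.\<alpha> by simp
  then show ?thesis by (simp flip: of_real_minus)
qed

definition h where "h x = D0.S x - D0.I / x"
definition q where "q x = D1.S x - D1.I / x"

text \<open>The operator x d/dx commutes with dilations, hence with the sum over k, and it sends 1/x
  to -1/x; this matches \<open>D1.I = - D0.I\<close>. So it maps \<open>h\<close> to the
  corresponding remainder \<open>q\<close>.\<close>

lemma h_deriv:
  assumes x: "x > 0"
  shows "(h has_real_derivative q x / x) (at x)"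
proof -
  let ?d = "\<lambda>k. real (Suc k) * f1 (real (Suc k) * x)"
  have "summable (\<lambda>k. 1 / x * (real (Suc k) * x * f1 (real (Suc k) * x)))"
    using D1.sums_S[OF x] by (intro summable_mult) (rule sums_summable)
  then have "summable ?d" using x by (simp del: of_nat_Suc)
  from suminf_mult[OF this, of x] have "D1.S x = x * (\<Sum>k. ?d k)"
    unfolding D1.S_def by (simp add: mult_ac del: of_nat_Suc)
  then have "q x / x = (\<Sum>k. ?d k) + D0.I / x\<^sup>2"
    using x by (simp add: q_def D1_I field_simps power2_eq_square)
  moreover have "((\<lambda>x. D0.I / x) has_real_derivative - (D0.I / x\<^sup>2)) (at x)"
    using x by (auto intro!: derivative_eq_intros simp: power2_eq_square)
  from DERIV_diff[OF D0.S_has_derivative[OF x] this]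
  have "(h has_real_derivative (\<Sum>k. ?d k) - - (D0.I / x\<^sup>2)) (at x)" unfolding h_def[abs_def] .
  ultimately show ?thesis by simp
qed

lemma h_bound: "x > 0 \<Longrightarrow> \<bar>h x\<bar> \<le> D0.B"
  unfolding h_def by (rule D0.abs_G_le)

lemma h_measurable [measurable]: "h \<in> borel_measurable borel" and q_measurable [measurable]: "q \<in> borel_measurable borel"
  unfolding h_def[abs_def] q_def[abs_def] by measurable

text \<open>At infinity \<open>q\<close> decays only like its main term, a multiple of 1/y. Together
  with the bound 1/t for the kernel this suffices for absolute convergence of the
  convolution.\<close>

lemma q_bound:
  obtains K where "K \<ge> 0" "\<And>y. y > 0 \<Longrightarrow> \<bar>q y\<bar> \<le> K" "\<And>y. y > 0 \<Longrightarrow> \<bar>q y\<bar> \<le> K / y"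
proof -
  obtain K1 where K1: "\<And>x. x > 0 \<Longrightarrow> \<bar>D1.S x\<bar> \<le> K1 * x powr (- \<alpha>)" using D1.S_bound by blast
  have "K1 \<ge> 0" using order_trans[OF abs_ge_zero K1[of 1]] by simp
  have B: "\<bar>q y\<bar> \<le> D1.B" if "y > 0" for y unfolding q_def using that by (rule D1.abs_G_le)
  have B0: "D1.B \<ge> 0" using order_trans[OF abs_ge_zero B[of 1]] by simp
  let ?K = "D1.B + K1 + \<bar>D1.I\<bar>"
  show ?thesis
  proof (rule that[of ?K])
    show "?K \<ge> 0" using B0 \<open>K1 \<ge> 0\<close> by simp
    fix y :: real assume y: "y > 0"
    show "\<bar>q y\<bar> \<le> ?K" using B[OF y] \<open>K1 \<ge> 0\<close> by simp
    show "\<bar>q y\<bar> \<le> ?K / y"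
    proof (cases "y \<le> 1")
      case True
      have "?K * 1 \<le> ?K * (1 / y)" using True y B0 \<open>K1 \<ge> 0\<close> by (intro mult_left_mono) auto
      then show ?thesis using B[OF y] \<open>K1 \<ge> 0\<close> by simp
    next
      case False
      have "y powr (- \<alpha>) \<le> y powr (- 1)" using False D0.\<alpha> by (intro powr_mono) auto
      then have "K1 * y powr (- \<alpha>) \<le> K1 * y powr (- 1)" using \<open>K1 \<ge> 0\<close> by (rule mult_left_mono)
      also have "\<dots> = K1 / y" using y by (simp add: powr_minus_divide)
      finally have "\<bar>D1.S y\<bar> \<le> K1 / y" using K1[OF y] by simp
      moreover have "\<bar>q y\<bar> \<le> \<bar>D1.S y\<bar> + \<bar>D1.I\<bar> / y" unfolding q_def using y abs_triangle_ineq4[of "D1.S y" "D1.I / y"] by simp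
      moreover have "D1.B / y \<ge> 0" using B0 y by simp
      ultimately show ?thesis by (simp add: add_divide_distrib)
    qed
  qed
qed

lemma frac_q_integrable:
  assumes x: "x > 0"
  shows "set_integrable lborel {0..} (\<lambda>t. frac t *\<^sub>R x *\<^sub>R (q (x * t) / (x * t)))"
proof -
  obtain K where K: "K \<ge> 0" "\<And>y. y > 0 \<Longrightarrow> \<bar>q y\<bar> \<le> K" "\<And>y. y > 0 \<Longrightarrow> \<bar>q y\<bar> \<le> K / y"
    using q_bound by blast
  have "integrable lborel (\<lambda>t. indicator {0<..} t *\<^sub>R (frac t / t * q (x * t)))"
  proof (rule integrable_powr_bound)
    show "norm (frac t / t * q (x * t)) \<le> (K + K / x) * t powr 0" if t: "0 < t" "t \<le> 1" for t
    proof -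
      have "\<bar>frac t / t\<bar> * \<bar>q (x * t)\<bar> \<le> 1 * K" using x t K by (intro mult_mono abs_frac_div_le) auto
      moreover have "K / x \<ge> 0" using K x by simp
      ultimately show ?thesis using t by (simp add: abs_mult)
    qed
    show "norm (frac t / t * q (x * t)) \<le> (K + K / x) * t powr (- 2)" if t: "1 < t" for t
    proof -
      have "\<bar>frac t / t\<bar> * \<bar>q (x * t)\<bar> \<le> 1 / t * (K / (x * t))" using x t K by (intro mult_mono abs_frac_div_le) auto
      also have "\<dots> = K / x * t powr (- 2)" using t x by (simp add: powr_minus_divide power2_eq_square)
      also have "\<dots> \<le> (K + K / x) * t powr (- 2)" using K by (intro mult_right_mono) auto
      finally show ?thesis by (simp add: abs_mult)
    qed
  qed (auto simp: measurable_compose)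
  moreover have "indicator {0<..} t *\<^sub>R (frac t / t * q (x * t)) = indicator {0..} t *\<^sub>R (frac t *\<^sub>R x *\<^sub>R (q (x * t) / (x * t)))" for t
    using x by (cases "t = 0") (auto simp: indicator_def)
  ultimately show ?thesis unfolding set_integrable_def by simp
qed

text \<open>The sum of \<open>f (n * x)\<close> weighted with the number of divisors of n, kept as
  an iterated sum so that it can be regrouped in two stages.\<close>

definition S2 where "S2 x = (\<Sum>k. D0.S (real (Suc k) * x))"

lemma S2_summable: "x > 0 \<Longrightarrow> summable (\<lambda>k. \<bar>D0.S (real (Suc k) * x)\<bar>)"
proof -
  assume x: "x > 0"
  obtain K where K: "\<And>x. x > 0 \<Longrightarrow> \<bar>D0.S x\<bar> \<le> K * x powr (- \<alpha>)" using D0.S_bound by blast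
  show ?thesis
    using sum_over_multiples(2)[of \<alpha> D0.S K "\<lambda>_. 0" 1 x] D0.\<alpha> K x by simp
qed

definition G2 where "G2 x = S2 x - (2 * euler_mascheroni * D0.I + D0.J - D0.I * ln x) / x"

text \<open>The sum of \<open>h (k * x)\<close> contributes \<open>- D0.I / x\<close> times a
  harmonic number, and the integral, known from \<open>has_integral_G\<close>, contributes minus the
  logarithm with the same coefficient. In their difference these combine to a second Euler constant,
  besides the one already present in the integral.\<close>

lemma frac_q_integral:
  assumes x: "x > 0"
  shows "(LINT t:{0..}|lborel. frac t *\<^sub>R x *\<^sub>R (q (x * t) / (x * t))) = G2 x"
proof -
  have hder: "(h has_vector_derivative q y / y) (at y)" if "y > 0" for y
    using h_deriv[OF that] by (simp only: has_real_derivative_iff_has_vector_derivative)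
  have zero: "((\<lambda>t. t *\<^sub>R h t) \<longlongrightarrow> 0) (at_right 0)"
  proof (rule Lim_null_comparison)
    show "\<forall>\<^sub>F t in at_right 0. norm (t *\<^sub>R h t) \<le> t * D0.B"
      using eventually_at_right_less[of 0] by eventually_elim (simp add: abs_mult h_bound mult_left_mono)
    show "((\<lambda>t. t * D0.B) \<longlongrightarrow> 0) (at_right 0)" by (rule tendsto_mult_left_zero) (rule tendsto_ident_at)
  qed
  have int1: "set_integrable lborel {0..real N} (\<lambda>t. h (x * t))" for N
  proof (rule set_integrable_Icc_powr_bound)
    show "norm (h (x * t)) \<le> D0.B * t powr 0" if "0 < t" for t using h_bound[of "x * t"] x that by simp
  qed auto
  have val: "(LINT t:{0..real N}|lborel. h (x * t)) =
      (D0.I * euler_mascheroni - D0.I * ln (x * real N) + D0.J - D0.T (x * real N)) / x" if N: "N > 0" for N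
  proof -
    have xN: "x * real N > 0" using x N by simp
    from has_integral_stretch_real[OF D0.has_integral_G[OF xN, folded h_def, folded interval_cbox], of x] x
    have "((\<lambda>t. h (x * t)) has_integral 1 / x * (D0.I * euler_mascheroni - D0.I * ln (x * real N) + D0.J - D0.T (x * real N))) ((\<lambda>t. t / x) ` {0..x * real N})"
      by simp
    moreover have "(\<lambda>t. t / x) ` {0..x * real N} = {0..real N}"
      using x image_divide_atLeastAtMost[of x 0 "x * real N"] by simp
    ultimately show ?thesis
      using set_borel_integral_eq_integral(2)[OF int1[of N]] by (simp add: integral_unique)
  qed
  obtain K where K: "\<And>Y. Y > 0 \<Longrightarrow> \<bar>D0.T Y\<bar> \<le> K * Y powr (1 - \<alpha>)" using D0.T_bound by metis
  have Tlim: "(\<lambda>N. D0.T (x * real (Suc N))) \<longlonglongrightarrow> 0"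
  proof (rule Lim_null_comparison)
    show "\<forall>\<^sub>F N in sequentially. norm (D0.T (x * real (Suc N))) \<le> K * (x * real (Suc N)) powr (1 - \<alpha>)"
      using x K by (intro always_eventually allI) (simp del: of_nat_Suc)
    have "(\<lambda>N. (x * real (Suc N)) powr (1 - \<alpha>)) \<longlonglongrightarrow> 0" using x D0.\<alpha> by real_asymp
    from tendsto_mult_right_zero[OF this] show "(\<lambda>N. K * (x * real (Suc N)) powr (1 - \<alpha>)) \<longlonglongrightarrow> 0" .
  qed
  have Slim: "(\<lambda>N. \<Sum>k<Suc N. D0.S (real (Suc k) * x)) \<longlonglongrightarrow> S2 x"
    unfolding S2_def by (rule LIMSEQ_Suc[OF summable_LIMSEQ[OF summable_rabs_cancel[OF S2_summable[OF x]]]])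
  have eq: "(\<Sum>k=1..Suc N. h (x * real k)) - (LINT t:{0..real (Suc N)}|lborel. h (x * t)) =
     (\<Sum>k<Suc N. D0.S (real (Suc k) * x)) - D0.I / x * (harm (Suc N) - ln (real (Suc N)))
       - (D0.I * euler_mascheroni - D0.I * ln x + D0.J - D0.T (x * real (Suc N))) / x" for N
  proof -
    have "(\<Sum>k=1..Suc N. h (x * real k)) = (\<Sum>k=1..Suc N. D0.S (real k * x) - D0.I / x * (1 / real k))"
      using x by (intro sum.cong refl) (simp add: h_def mult.commute)
    also have "\<dots> = (\<Sum>k=1..Suc N. D0.S (real k * x)) - D0.I / x * harm (Suc N)"
      by (simp only: sum_subtractf sum_distrib_left[symmetric] harm_def inverse_eq_divide)
    also have "(\<Sum>k=1..Suc N. D0.S (real k * x)) = (\<Sum>k<Suc N. D0.S (real (Suc k) * x))"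
      unfolding One_nat_def by (rule sum.atLeast1_atMost_eq)
    finally have 1: "(\<Sum>k=1..Suc N. h (x * real k)) = (\<Sum>k<Suc N. D0.S (real (Suc k) * x)) - D0.I / x * harm (Suc N)" .
    have 2: "ln (x * real (Suc N)) = ln x + ln (real (Suc N))" using x by (simp add: ln_mult del: of_nat_Suc)
    have 3: "s - I' / x * H - (I' * g - I' * (a + b) + j - T') / x = s - I' / x * (H - b) - (I' * g - I' * a + j - T') / x"
      for s I' H g a b j T' :: real using x by (simp add: field_simps)
    show ?thesis unfolding 1 val[OF zero_less_Suc] 2 by (rule 3)
  qed
  have "(\<lambda>N. (\<Sum>k=1..Suc N. h (x * real k)) - (LINT t:{0..real (Suc N)}|lborel. h (x * t))) \<longlonglongrightarrow>
     S2 x - D0.I / x * euler_mascheroni - (D0.I * euler_mascheroni - D0.I * ln x + D0.J - 0) / x"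
    unfolding eq using x
    by (intro tendsto_intros Slim Tlim LIMSEQ_Suc[OF euler_mascheroni_LIMSEQ]) auto
  from LIMSEQ_unique[OF LIMSEQ_Suc[OF sum_minus_integral(2)[OF x hder zero int1 frac_q_integrable[OF x]]] this]
  have "(LINT t:{0..}|lborel. frac t *\<^sub>R x *\<^sub>R (q (x * t) / (x * t))) =
     S2 x - D0.I / x * euler_mascheroni - (D0.I * euler_mascheroni - D0.I * ln x + D0.J - 0) / x" .
  also have "\<dots> = G2 x" unfolding G2_def using x by (simp add: field_simps)
  finally show ?thesis .
qed

lemma has_mellin_G2:
  assumes s: "0 < Re s" "Re s < 1"
  shows "has_mellin (\<lambda>x. of_real (G2 x)) s (zeta s ^ 2 * mel f s)"
proof -
  have [measurable]: "(\<lambda>t. frac t / t :: real) \<in> borel_measurable borel" by measurable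
  have s': "Re s < \<alpha>" using s D0.\<alpha> by simp
  have "s \<noteq> 0" using s by auto
  \<comment> \<open>One factor \<open>zeta s\<close> comes from the kernel, the other from the first
    formula for \<open>y * f1 y\<close>; the -s of that function cancels the -1/s of the
    kernel.\<close>
  then have val: "- zeta s / s * (zeta s * mel (\<lambda>y. y * f1 y) s) = zeta s ^ 2 * mel f s"
    by (simp add: mel_theta[OF s(1) s'] power2_eq_square)
  have "has_mellin (\<lambda>x. of_real (LINT t|lborel. indicator {0<..} t * (frac t / t * q (x * t)))) s (- zeta s / s * (zeta s * mel (\<lambda>y. y * f1 y) s))"
    using D1.has_mellin_G[OF s] unfolding q_def[symmetric]
    by (intro has_mellin_convolution has_mellin_frac s) auto
  then show ?thesis unfolding val
  proof (rule has_mellin_cong[THEN iffD1, rotated])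
    fix x :: real assume x: "x > 0"
    have "(LINT t|lborel. indicator {0<..} t * (frac t / t * q (x * t))) = (LINT t:{0..}|lborel. frac t *\<^sub>R x *\<^sub>R (q (x * t) / (x * t)))"
      unfolding set_lebesgue_integral_def using x by (intro Bochner_Integration.integral_cong refl) (auto simp: indicator_def)
    then show "complex_of_real (LINT t|lborel. indicator {0<..} t * (frac t / t * q (x * t))) = of_real (G2 x)"
      by (simp only: frac_q_integral[OF x])
  qed
qed

end

subsection \<open>Summation against the Moebius function\<close>

text \<open>Dilation by n^2 multiplies the transform by n^(-2s) and the norm by n^(-2 Re s), so
  \<open>Re s > 1/2\<close> makes the norms summable. The series theorems require pointwise absolute
  summability as well, which enters as a separate assumption.\<close>

lemma has_mellin_moebius_sum:
  assumes s: "1 / 2 < Re s" and g: "has_mellin (\<lambda>x. of_real (g x)) s V"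
    and sm: "\<And>x. x > 0 \<Longrightarrow> summable (\<lambda>n. \<bar>of_int (moebius_mu (Suc n)) * g (real (Suc n) ^ 2 * x)\<bar>)"
  shows "has_mellin (\<lambda>x. of_real (\<Sum>n. of_int (moebius_mu (Suc n)) * g (real (Suc n) ^ 2 * x))) s (V / zeta (2 * s))"
proof -
  let ?c = "\<lambda>n. complex_of_int (moebius_mu (Suc n))"
  let ?g = "\<lambda>x. indicator {0<..} x *\<^sub>R (complex_of_real (g x) * complex_of_real x powr (s - 1))"
  let ?h = "\<lambda>n x. indicator {0<..} x *\<^sub>R (complex_of_real (g (real (Suc n) ^ 2 * x)) * complex_of_real x powr (s - 1))"
  let ?p = "\<lambda>n. complex_of_nat (Suc n) powr (- (2 * s))"
  have s2: "Re (2 * s) > 1" using s by simp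
  have pos: "real (Suc n) ^ 2 > 0" for n by simp
  have h: "integrable lborel (?h n)" "integral\<^sup>L lborel (?h n) = of_real (real (Suc n) ^ 2) powr (- s) * V" for n
    using has_mellin_scale[OF g pos[of n]] unfolding has_mellin_def by auto
  have hn: "(LINT x|lborel. norm (?h n x)) = (real (Suc n) ^ 2) powr (- Re s) * (LINT x|lborel. norm (?g x))" for n
    by (rule has_mellin_norm_scale[OF g pos])
  have sq: "complex_of_real (real (Suc n) ^ 2) powr (- s) = ?p n" for n
  proof -
    have "complex_of_real (real (Suc n) ^ 2) powr (- s) = complex_of_real (real (Suc n)) powr (- s) * of_real (real (Suc n)) powr (- s)"
      unfolding power2_eq_square of_real_mult by (rule powr_times_real) auto
    also have "\<dots> = ?p n" by (simp add: powr_add[symmetric] del: of_nat_Suc)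
    finally show ?thesis .
  qed
  have sq': "(real (Suc n) ^ 2) powr (- Re s) = norm (?p n)" for n
    using arg_cong[OF sq[of n], of norm] norm_of_real_powr[OF pos[of n], of "- s"] by simp
  let ?f = "\<lambda>n x. ?c n * ?h n x"
  have f: "integrable lborel (?f n)" for n using h(1) by (rule integrable_mult_right)
  have feq: "?f n x = indicator {0<..} x *\<^sub>R (complex_of_real (of_int (moebius_mu (Suc n)) * g (real (Suc n) ^ 2 * x)) * complex_of_real x powr (s - 1))" for n x
    by simp
  have AE: "AE x in lborel. summable (\<lambda>n. norm (?f n x))"
  proof (rule AE_I2)
    fix x :: real
    show "summable (\<lambda>n. norm (?f n x))"
    proof (cases "x > 0")
      case True
      have "summable (\<lambda>n. \<bar>of_int (moebius_mu (Suc n)) * g (real (Suc n) ^ 2 * x)\<bar> * norm (complex_of_real x powr (s - 1)))"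
        by (intro summable_mult2 sm True)
      then show ?thesis using True unfolding feq by (simp add: norm_mult abs_mult mult_ac del: of_nat_Suc)
    next
      case False then show ?thesis by simp
    qed
  qed
  have sn: "summable (\<lambda>n. LINT x|lborel. norm (?f n x))"
  proof (rule summable_comparison_test')
    show "summable (\<lambda>n. norm (?p n) * (LINT x|lborel. norm (?g x)))"
      by (intro summable_mult2 summable_norm_Suc_powr s2)
    fix n
    have "(LINT x|lborel. norm (?f n x)) = norm (?c n) * (norm (?p n) * (LINT x|lborel. norm (?g x)))"
      unfolding norm_mult[of "?c n"] integral_mult_right_zero hn sq' ..
    also have "\<dots> \<le> 1 * (norm (?p n) * (LINT x|lborel. norm (?g x)))"
      by (intro mult_right_mono norm_moebius_mu_le) (simp add: integral_nonneg_AE)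
    finally show "norm (LINT x|lborel. norm (?f n x)) \<le> norm (?p n) * (LINT x|lborel. norm (?g x))"
      by (simp add: integral_nonneg_AE)
  qed
  have lim: "(\<Sum>n. ?f n x) = indicator {0<..} x *\<^sub>R (complex_of_real (\<Sum>n. of_int (moebius_mu (Suc n)) * g (real (Suc n) ^ 2 * x)) * complex_of_real x powr (s - 1))" for x
  proof (cases "x > 0")
    case True
    from sm[OF this] have "(\<lambda>n. of_int (moebius_mu (Suc n)) * g (real (Suc n) ^ 2 * x)) sums (\<Sum>n. of_int (moebius_mu (Suc n)) * g (real (Suc n) ^ 2 * x))"
      by (rule summable_sums[OF summable_rabs_cancel])
    from sums_mult2[OF sums_of_real[OF this], of "complex_of_real x powr (s - 1)"] True show ?thesis
      unfolding feq by (simp add: sums_iff)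
  next
    case False then show ?thesis by simp
  qed
  have "(\<Sum>n. integral\<^sup>L lborel (?f n)) = (\<Sum>n. ?c n * ?p n * V)"
    by (simp only: integral_mult_right_zero h(2) sq mult.assoc)
  also have "\<dots> = (\<Sum>n. ?c n * ?p n) * V"
    by (rule suminf_mult2[symmetric]) (rule summable_norm_cancel[OF moebius_Dirichlet_series(2)[OF s2]])
  also have "(\<Sum>n. ?c n * ?p n) = 1 / zeta (2 * s)"
  proof -
    have "zeta (2 * s) \<noteq> 0" using moebius_Dirichlet_series(1)[OF s2] by auto
    then show ?thesis using moebius_Dirichlet_series(1)[OF s2] by (simp add: field_simps del: of_nat_Suc)
  qed
  finally have val: "(\<Sum>n. integral\<^sup>L lborel (?f n)) = V / zeta (2 * s)" by simp
  show ?thesis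
    unfolding has_mellin_def
    using integrable_suminf[OF f AE sn] integral_suminf[OF f AE sn] unfolding val lim by blast
qed

context decaying2
begin

lemma summable_abs_moebius_square:
  "summable (\<lambda>n. \<bar>of_int (moebius_mu (Suc n)) / (real (Suc n))\<^sup>2\<bar>)"
  "summable (\<lambda>n. \<bar>of_int (moebius_mu (Suc n)) * ln (real (Suc n)) / (real (Suc n))\<^sup>2\<bar>)"
proof -
  show "summable (\<lambda>n. \<bar>of_int (moebius_mu (Suc n)) / (real (Suc n))\<^sup>2\<bar>)"
    by (rule summable_comparison_test'[OF summable_inverse_Suc_square[of 1]])
      (use abs_moebius_mu_le in \<open>auto simp: divide_right_mono\<close>)
  show "summable (\<lambda>n. \<bar>of_int (moebius_mu (Suc n)) * ln (real (Suc n)) / (real (Suc n))\<^sup>2\<bar>)"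
  proof (rule summable_comparison_test'[OF summable_ln_div_square])
    show "norm \<bar>of_int (moebius_mu (Suc n)) * ln (real (Suc n)) / (real (Suc n))\<^sup>2\<bar> \<le> ln (real (Suc n)) / (real (Suc n))\<^sup>2" for n
      using mult_right_mono[OF abs_moebius_mu_le[of "Suc n"], of "ln (real (Suc n))"]
      by (simp add: abs_mult divide_right_mono del: of_nat_Suc)
  qed
qed

text \<open>The two parts of \<open>h\<close> are summed separately: the sums over multiples
  regroup, and \<open>D0.I / x\<close> is multiplied by the sum of the Moebius function over n^2,
  that is 1/zeta(2).\<close>

lemma first_integrand:
  assumes x: "x > 0"
  shows "(\<Sum>n. of_int (moebius_mu (Suc n)) * h (real (Suc n) ^ 2 * x)) =
      (\<Sum>n. \<bar>real_of_int (moebius_mu (Suc n))\<bar> * f (real (Suc n) * x)) - 6 * D0.I / (pi\<^sup>2 * x)" (is ?th1)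
    and "summable (\<lambda>n. \<bar>of_int (moebius_mu (Suc n)) * h (real (Suc n) ^ 2 * x)\<bar>)" (is ?th2)
proof -
  let ?m = "\<lambda>n. real_of_int (moebius_mu n)"
  have mom: "(\<Sum>d | d ^ 2 dvd Suc n. ?m d) = \<bar>?m (Suc n)\<bar>" for n
    using arg_cong[OF sum_moebius_square_divisors[of "Suc n"], of real_of_int] by simp
  have two: "0 < (2::nat)" by simp
  note mult = sum_over_multiples[where b = ?m, OF D0.\<alpha> D0.bound(2) abs_moebius_mu_le two x, folded D0.S_def, unfolded mom]
  have eq: "?m (Suc n) * h (real (Suc n) ^ 2 * x) = ?m (Suc n) * D0.S (real (Suc n) ^ 2 * x) - ?m (Suc n) / (real (Suc n))\<^sup>2 * (D0.I / x)" for n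
    using x by (simp add: h_def field_simps del: of_nat_Suc)
  have "(\<lambda>n. ?m (Suc n) * h (real (Suc n) ^ 2 * x)) sums
    ((\<Sum>n. \<bar>?m (Suc n)\<bar> * f (real (Suc n) * x)) - 6 / pi\<^sup>2 * (D0.I / x))"
    unfolding eq by (intro sums_diff mult(1) sums_mult2 moebius_sums_square(1))
  then show ?th1 by (simp add: sums_iff)
  have "summable (\<lambda>n. \<bar>?m (Suc n) * D0.S (real (Suc n) ^ 2 * x)\<bar> + \<bar>?m (Suc n) / (real (Suc n))\<^sup>2\<bar> * \<bar>D0.I / x\<bar>)"
    by (intro summable_add mult(3) summable_mult2 summable_abs_moebius_square(1))
  then show ?th2
  proof (rule summable_comparison_test')
    show "norm \<bar>?m (Suc n) * h (real (Suc n) ^ 2 * x)\<bar> \<le> \<bar>?m (Suc n) * D0.S (real (Suc n) ^ 2 * x)\<bar> + \<bar>?m (Suc n) / (real (Suc n))\<^sup>2\<bar> * \<bar>D0.I / x\<bar>" for n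
      unfolding eq abs_mult[of "?m (Suc n) / (real (Suc n))\<^sup>2", symmetric] real_norm_def abs_idempotent by (rule abs_triangle_ineq4)
  qed
qed

text \<open>The iterated sum is regrouped twice, over square divisors of n and then over divisors.
  In the main term ln (n^2 x) = 2 ln n + ln x, so the Moebius sum with a logarithm appears; it is a
  multiple of the series in \<open>glaisher_eq\<close>, which exchanges that series and Euler's
  constant for the logarithm of A.\<close>

lemma second_integrand:
  assumes x: "x > 0"
  shows "(\<Sum>n. of_int (moebius_mu (Suc n)) * G2 (real (Suc n) ^ 2 * x)) =
      (\<Sum>n. 2 ^ omega (Suc n) * f (real (Suc n) * x)) + 6 / (pi\<^sup>2 * x) * (D0.I * ln (4 * pi\<^sup>2 * x / glaisher ^ 24) - D0.J)" (is ?th1)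
    and "summable (\<lambda>n. \<bar>of_int (moebius_mu (Suc n)) * G2 (real (Suc n) ^ 2 * x)\<bar>)" (is ?th2)
proof -
  let ?m = "\<lambda>n. real_of_int (moebius_mu n)"
  obtain K where K: "\<And>x. x > 0 \<Longrightarrow> \<bar>D0.S x\<bar> \<le> K * x powr (- \<alpha>)" using D0.S_bound by blast
  have mom: "(\<Sum>d | d ^ 2 dvd Suc n. ?m d) = \<bar>?m (Suc n)\<bar>" for n
    using arg_cong[OF sum_moebius_square_divisors[of "Suc n"], of real_of_int] by simp
  have om: "(\<Sum>d | d ^ 1 dvd Suc n. \<bar>?m d\<bar>) = 2 ^ omega (Suc n)" for n
    using arg_cong[OF sum_abs_moebius_divisors[of "Suc n"], of real_of_int] by simp
  have two: "0 < (2::nat)" and one: "0 < (1::nat)" by simp_all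
  have abs_le: "\<bar>\<bar>?m n\<bar>\<bar> \<le> 1" for n using abs_moebius_mu_le by simp
  note mult = sum_over_multiples[where b = ?m, OF D0.\<alpha> K abs_moebius_mu_le two x, folded S2_def, unfolded mom]
  note mult1 = sum_over_multiples(1)[where b = "\<lambda>n. \<bar>?m n\<bar>", OF D0.\<alpha> D0.bound(2) abs_le one x, folded D0.S_def, unfolded om]
  have S2sums: "(\<lambda>n. ?m (Suc n) * S2 (real (Suc n) ^ 2 * x)) sums (\<Sum>n. 2 ^ omega (Suc n) * f (real (Suc n) * x))"
    using mult(1) sums_unique[OF mult1] by (simp only: power_one_right)
  define A where "A = (2 * euler_mascheroni * D0.I + D0.J - D0.I * ln x) / x"
  define L where "L = (\<Sum>n. ln (real (Suc n)) / (real (Suc n))\<^sup>2)"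
  have eq: "?m (Suc n) * G2 (real (Suc n) ^ 2 * x) = ?m (Suc n) * S2 (real (Suc n) ^ 2 * x)
     - ?m (Suc n) / (real (Suc n))\<^sup>2 * A + ?m (Suc n) * ln (real (Suc n)) / (real (Suc n))\<^sup>2 * (2 * D0.I / x)" for n
  proof -
    have l: "ln ((real (Suc n))\<^sup>2 * x) = 2 * ln (real (Suc n)) + ln x"
      using x by (simp add: ln_mult ln_realpow del: of_nat_Suc)
    have "m * (S - (g + j - i * (2 * l + lx)) / (d * x)) = m * S - m / d * ((g + j - i * lx) / x) + m * l / d * (2 * i / x)"
      if "d > 0" for m S g j i l lx d :: real
      using that x by (simp add: field_simps)
    then show ?thesis unfolding G2_def l A_def by simp
  qed
  have "(\<lambda>n. ?m (Suc n) * G2 (real (Suc n) ^ 2 * x)) sums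
    ((\<Sum>n. 2 ^ omega (Suc n) * f (real (Suc n) * x)) - 6 / pi\<^sup>2 * A + - 36 / pi ^ 4 * L * (2 * D0.I / x))"
    unfolding eq L_def by (intro sums_add sums_diff S2sums sums_mult2 moebius_sums_square)
  moreover have "- 6 / pi\<^sup>2 * A + - 36 / pi ^ 4 * L * (2 * D0.I / x) =
      6 / (pi\<^sup>2 * x) * (D0.I * ln (4 * pi\<^sup>2 * x / glaisher ^ 24) - D0.J)"
  proof -
    have "4 * pi\<^sup>2 = (2 * pi)\<^sup>2" by (simp add: power2_eq_square)
    moreover have "ln ((2 * pi)\<^sup>2 * x / glaisher ^ 24) = ln ((2 * pi)\<^sup>2) + ln x - ln (glaisher ^ 24)"
      using x glaisher_eq(1) by (subst ln_div, simp, simp, subst ln_mult) auto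
    moreover have "ln ((2 * pi)\<^sup>2) = 2 * ln (2 * pi)" "ln (glaisher ^ 24) = 24 * ln glaisher"
      using glaisher_eq(1) ln_realpow[of "2 * pi" 2] ln_realpow[of glaisher 24] pi_gt_zero by simp_all
    ultimately have "ln (4 * pi\<^sup>2 * x / glaisher ^ 24) = 2 * ln (2 * pi) + ln x - 24 * ln glaisher"
      by (simp only:)
    also have "\<dots> = ln x - 2 * euler_mascheroni - 12 / pi\<^sup>2 * L"
      unfolding glaisher_eq(2) L_def by simp
    finally have ln: "ln (4 * pi\<^sup>2 * x / glaisher ^ 24) = ln x - 2 * euler_mascheroni - 12 / pi\<^sup>2 * L" .
    have pi4: "pi ^ 4 = pi\<^sup>2 * pi\<^sup>2" by (simp add: power4_eq_xxxx power2_eq_square)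
    have alg: "- 6 / p * ((2 * g * i + j - i * lx) / x) + - 36 / (p * p) * L * (2 * i / x) = 6 / (p * x) * (i * (lx - 2 * g - 12 / p * L) - j)"
      if "p > 0" for p g i j lx :: real
      using that x by (simp add: field_simps)
    show ?thesis unfolding ln A_def pi4 by (rule alg) simp
  qed
  ultimately show ?th1 by (simp add: sums_iff)
  have "summable (\<lambda>n. \<bar>?m (Suc n) * S2 (real (Suc n) ^ 2 * x)\<bar> + \<bar>?m (Suc n) / (real (Suc n))\<^sup>2\<bar> * \<bar>A\<bar>
     + \<bar>?m (Suc n) * ln (real (Suc n)) / (real (Suc n))\<^sup>2\<bar> * \<bar>2 * D0.I / x\<bar>)"
    by (intro summable_add mult(3) summable_mult2 summable_abs_moebius_square)
  then show ?th2
  proof (rule summable_comparison_test')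
    fix n
    have "\<bar>a - b * c + d * e\<bar> \<le> \<bar>a\<bar> + \<bar>b\<bar> * \<bar>c\<bar> + \<bar>d\<bar> * \<bar>e\<bar>" for a b c d e :: real
      using abs_triangle_ineq[of "a - b * c" "d * e"] abs_triangle_ineq4[of a "b * c"] by (simp add: abs_mult)
    then show "norm \<bar>?m (Suc n) * G2 (real (Suc n) ^ 2 * x)\<bar> \<le> \<bar>?m (Suc n) * S2 (real (Suc n) ^ 2 * x)\<bar> + \<bar>?m (Suc n) / (real (Suc n))\<^sup>2\<bar> * \<bar>A\<bar>
     + \<bar>?m (Suc n) * ln (real (Suc n)) / (real (Suc n))\<^sup>2\<bar> * \<bar>2 * D0.I / x\<bar>"
      unfolding eq real_norm_def abs_idempotent by blast
  qed
qed

lemma mellin_identities: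
  assumes s: "1 / 2 < Re s" "Re s < 1"
  shows "has_mellin (\<lambda>x. of_real ((\<Sum>n. \<bar>real_of_int (moebius_mu (Suc n))\<bar> * f (real (Suc n) * x)) - 6 * D0.I / (pi\<^sup>2 * x)))
     s (zeta s * mel f s / zeta (2 * s))"
    and "has_mellin (\<lambda>x. of_real ((\<Sum>n. 2 ^ omega (Suc n) * f (real (Suc n) * x)) + 6 / (pi\<^sup>2 * x) * (D0.I * ln (4 * pi\<^sup>2 * x / glaisher ^ 24) - D0.J)))
     s (zeta s ^ 2 * mel f s / zeta (2 * s))"
proof -
  have s0: "0 < Re s" using s by simp
  have "has_mellin (\<lambda>x. of_real (h x)) s (zeta s * mel f s)"
    unfolding h_def by (rule D0.has_mellin_G[OF s0 s(2)])
  from has_mellin_moebius_sum[OF s(1) this first_integrand(2)]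
  show "has_mellin (\<lambda>x. of_real ((\<Sum>n. \<bar>real_of_int (moebius_mu (Suc n))\<bar> * f (real (Suc n) * x)) - 6 * D0.I / (pi\<^sup>2 * x)))
     s (zeta s * mel f s / zeta (2 * s))"
  proof (rule has_mellin_cong[THEN iffD1, rotated])
    fix x :: real assume "x > 0"
    from first_integrand(1)[OF this] show "complex_of_real (\<Sum>n. of_int (moebius_mu (Suc n)) * h (real (Suc n) ^ 2 * x)) = of_real ((\<Sum>n. \<bar>real_of_int (moebius_mu (Suc n))\<bar> * f (real (Suc n) * x)) - 6 * D0.I / (pi\<^sup>2 * x))" by (rule arg_cong)
  qed
  from has_mellin_moebius_sum[OF s(1) has_mellin_G2[OF s0 s(2)] second_integrand(2)]
  show "has_mellin (\<lambda>x. of_real ((\<Sum>n. 2 ^ omega (Suc n) * f (real (Suc n) * x)) + 6 / (pi\<^sup>2 * x) * (D0.I * ln (4 * pi\<^sup>2 * x / glaisher ^ 24) - D0.J)))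
     s (zeta s ^ 2 * mel f s / zeta (2 * s))"
  proof (rule has_mellin_cong[THEN iffD1, rotated])
    fix x :: real assume "x > 0"
    from second_integrand(1)[OF this] show "complex_of_real (\<Sum>n. of_int (moebius_mu (Suc n)) * G2 (real (Suc n) ^ 2 * x)) = of_real ((\<Sum>n. 2 ^ omega (Suc n) * f (real (Suc n) * x)) + 6 / (pi\<^sup>2 * x) * (D0.I * ln (4 * pi\<^sup>2 * x / glaisher ^ 24) - D0.J))" by (rule arg_cong)
  qed
qed

end

section \<open>From the class of functions to the locale conditions\<close>

lemma bigo_decay_bound:
  fixes F :: "real \<Rightarrow> real"
  assumes cont: "continuous_on {0..} F" and bigo: "F \<in> O[at_top](\<lambda>x. x powr (- b))" and b: "b \<ge> 0"
  obtains C where "C \<ge> 0" "\<And>x. x > 0 \<Longrightarrow> \<bar>F x\<bar> \<le> C" "\<And>x. x > 0 \<Longrightarrow> \<bar>F x\<bar> \<le> C * x powr (- b)"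
proof -
  obtain c where c: "c > 0" "\<forall>\<^sub>F x in at_top. norm (F x) \<le> c * norm (x powr (- b))"
    using bigo by (elim landau_o.bigE)
  then obtain X0 where X0: "\<And>x. x \<ge> X0 \<Longrightarrow> \<bar>F x\<bar> \<le> c * x powr (- b)"
    by (auto simp: eventually_at_top_linorder)
  define X where "X = max 1 X0"
  have X: "X \<ge> 1" "\<And>x. x \<ge> X \<Longrightarrow> \<bar>F x\<bar> \<le> c * x powr (- b)" using X0 by (auto simp: X_def)
  have "compact (F ` {0..X})"
    by (rule compact_continuous_image[OF continuous_on_subset[OF cont]]) auto
  then have "bounded (F ` {0..X})" by (rule compact_imp_bounded)
  then obtain M where "\<forall>y\<in>F ` {0..X}. norm y \<le> M" unfolding bounded_iff by (elim exE)
  then have M: "\<bar>F x\<bar> \<le> M" if "x \<in> {0..X}" for x using that by simp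
  have M0: "M \<ge> 0" using order_trans[OF abs_ge_zero M[of 0]] X by simp
  have Xb: "X powr b \<ge> 1" using X b by (simp add: ge_one_powr_ge_zero)
  \<comment> \<open>Up to X the function is bounded by M, and \<open>x powr (- b)\<close> is at
    least \<open>X powr (- b)\<close> there, so the factor \<open>X powr b\<close> makes the decay
    bound valid on that part as well.\<close>
  define C where "C = c + M * X powr b"
  have MC: "M \<le> M * X powr b" using M0 Xb by (simp add: mult_le_cancel_left1)
  show ?thesis
  proof (rule that[of C])
    show "C \<ge> 0" using c(1) M0 by (simp add: C_def)
    fix x :: real assume x: "x > 0"
    show "\<bar>F x\<bar> \<le> C"
    proof (cases "x \<le> X")
      case True then show ?thesis using M[of x] x MC c(1) by (simp add: C_def)
    next
      case False
      then have "x powr (- b) \<le> x powr 0" using X b by (intro powr_mono) auto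
      then have "c * x powr (- b) \<le> c * 1" using c(1) x by (intro mult_left_mono) auto
      then show ?thesis using X(2)[of x] False M0 by (simp add: C_def add_increasing2)
    qed
    show "\<bar>F x\<bar> \<le> C * x powr (- b)"
    proof (cases "x \<le> X")
      case True
      have "X powr b * x powr (- b) = (X / x) powr b" using x X by (simp add: powr_divide powr_minus_divide)
      also have "\<dots> \<ge> 1" using True x b by (intro ge_one_powr_ge_zero) auto
      finally have "M * 1 \<le> M * (X powr b * x powr (- b))" using M0 by (intro mult_left_mono) auto
      then show ?thesis using M[of x] True x c(1) by (simp add: C_def distrib_right mult.assoc add_increasing)
    next
      case False
      then show ?thesis using X(2)[of x] M0 by (simp add: C_def distrib_right add_increasing2)
    qed
  qed
qed

lemma M_class_decaying2:
  assumes \<alpha>: "\<alpha> > 1" and m: "m \<ge> 2" and M: "M_class \<alpha> m f"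
  obtains f0 f1 f2 C0 C1 where "decaying2 f0 f1 f2 \<alpha> C0 C1" "\<And>x. x > 0 \<Longrightarrow> f0 x = f x"
proof -
  from M[unfolded M_class_def] obtain F where F: "(\<forall>x\<ge>0. F 0 x = f x) \<and>
      (\<forall>j<m. \<forall>x\<ge>0. (F j has_real_derivative F (Suc j) x) (at x within {0..})) \<and>
      (\<forall>j\<le>m. continuous_on {0..} (F j)) \<and>
      (\<forall>j\<le>m. F j \<in> O[at_top](\<lambda>x. x powr (- \<alpha> - real j)))"
    by (elim exE)
  have F0: "x \<ge> 0 \<Longrightarrow> F 0 x = f x"
    and der: "j < m \<Longrightarrow> x \<ge> 0 \<Longrightarrow> (F j has_real_derivative F (Suc j) x) (at x within {0..})"
    and cont: "j \<le> m \<Longrightarrow> continuous_on {0..} (F j)"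
    and bigo: "j \<le> m \<Longrightarrow> F j \<in> O[at_top](\<lambda>x. x powr (- \<alpha> - real j))" for j x
    using F by simp_all
  \<comment> \<open>The derivatives are controlled on [0, \<infinity>) only. Extending them by their
    values at 0 makes them continuous, hence Borel measurable, on the whole line and changes nothing
    for positive x.\<close>
  define g where "g = (\<lambda>j x. F j (max 0 x))"
  have gF: "g j x = F j x" if "x > 0" for j x using that by (simp add: g_def)
  have gcont: "continuous_on UNIV (g j)" if "j \<le> m" for j
    unfolding g_def by (rule continuous_on_compose2[OF cont[OF that]]) (auto intro!: continuous_intros)
  have gmeas: "g j \<in> borel_measurable borel" if "j \<le> m" for j
    using gcont[OF that] by (rule borel_measurable_continuous_onI)
  have gder: "(g j has_real_derivative g (Suc j) x) (at x)" if "j < m" "x > 0" for j x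
  proof -
    have "(F j has_real_derivative F (Suc j) x) (at x within {0..})" using that by (intro der) auto
    moreover have "at x within {0..} = at x" using that by (intro at_within_interior) simp
    ultimately have "(F j has_real_derivative g (Suc j) x) (at x)" using gF[OF that(2)] by simp
    then show ?thesis
      by (rule has_field_derivative_transform_within_open[of _ _ _ "{0<..}"]) (use that gF in auto)
  qed
  have ex: "\<exists>C\<ge>0. \<forall>x>0. \<bar>g j x\<bar> \<le> C \<and> \<bar>g j x\<bar> \<le> C * x powr (- \<alpha> - real j)" if jm: "j \<le> m" for j
  proof -
    have e: "- (\<alpha> + real j) = - \<alpha> - real j" by simp
    obtain C where "C \<ge> 0" "\<And>x. x > 0 \<Longrightarrow> \<bar>F j x\<bar> \<le> C" "\<And>x. x > 0 \<Longrightarrow> \<bar>F j x\<bar> \<le> C * x powr (- (\<alpha> + real j))"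
      by (rule bigo_decay_bound[OF cont[OF jm], of "\<alpha> + real j"]) (use bigo[OF jm] \<alpha> in \<open>auto simp: e\<close>)
    then show ?thesis using gF by (intro exI[of _ C]) (auto simp: e)
  qed
  then have "\<forall>j. \<exists>C. j \<le> m \<longrightarrow> C \<ge> 0 \<and> (\<forall>x>0. \<bar>g j x\<bar> \<le> C \<and> \<bar>g j x\<bar> \<le> C * x powr (- \<alpha> - real j))"
    by blast
  from choice[OF this] obtain c where
    c': "\<forall>j. j \<le> m \<longrightarrow> c j \<ge> 0 \<and> (\<forall>x>0. \<bar>g j x\<bar> \<le> c j \<and> \<bar>g j x\<bar> \<le> c j * x powr (- \<alpha> - real j))"
    by (elim exE)
  have c: "j \<le> m \<Longrightarrow> c j \<ge> 0" "j \<le> m \<Longrightarrow> x > 0 \<Longrightarrow> \<bar>g j x\<bar> \<le> c j"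
    "j \<le> m \<Longrightarrow> x > 0 \<Longrightarrow> \<bar>g j x\<bar> \<le> c j * x powr (- \<alpha> - real j)" for j x
    using c' by simp_all
  have m012: "0 \<le> m" "1 \<le> m" "2 \<le> m" "0 < m" "1 < m" using m by auto
  define C where "C = c 0 + c 1 + c 2"
  have cC: "c 0 \<le> C" "c 1 \<le> C" "c 2 \<le> C" using c(1)[OF m012(1)] c(1)[OF m012(2)] c(1)[OF m012(3)] by (auto simp: C_def)
  have C0: "C \<ge> 0" using cC(1) c(1)[OF m012(1)] by simp
  have b: "\<bar>g j x\<bar> \<le> C" "\<bar>g j x\<bar> \<le> C * x powr (- \<alpha> - real j)" if "x > 0" "j \<in> {0, 1, 2}" for j x
  proof -
    have j: "j \<le> m" "c j \<le> C" using that m cC by auto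
    show "\<bar>g j x\<bar> \<le> C" using c(2)[OF j(1) that(1)] j(2) by simp
    have "c j * x powr (- \<alpha> - real j) \<le> C * x powr (- \<alpha> - real j)" using j(2) by (rule mult_right_mono) simp
    then show "\<bar>g j x\<bar> \<le> C * x powr (- \<alpha> - real j)" using c(3)[OF j(1) that(1)] by simp
  qed
  \<comment> \<open>Multiplication by x costs exactly the one order of decay gained by
    differentiation. The uniform bound uses boundedness of the derivative for x up to 1 and the
    decay beyond.\<close>
  have yb: "x * \<bar>g (Suc j) x\<bar> \<le> C" "x * \<bar>g (Suc j) x\<bar> \<le> C * x powr (- \<alpha> - real j)" if x: "x > 0" and j: "j \<in> {0, 1}" for j x
  proof -
    have j': "Suc j \<in> {0, 1, 2}" using j by auto
    have "x * \<bar>g (Suc j) x\<bar> \<le> x * (C * x powr (- \<alpha> - real (Suc j)))" using b(2)[OF x j'] x by (intro mult_left_mono) auto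
    also have "\<dots> = C * (x * x powr (- \<alpha> - real (Suc j)))" by simp
    also have "x * x powr (- \<alpha> - real (Suc j)) = x powr (- \<alpha> - real j)" using x by (simp add: powr_mult_base)
    finally show *: "x * \<bar>g (Suc j) x\<bar> \<le> C * x powr (- \<alpha> - real j)" .
    show "x * \<bar>g (Suc j) x\<bar> \<le> C"
    proof (cases "x \<le> 1")
      case True
      have "x * \<bar>g (Suc j) x\<bar> \<le> 1 * C" using True x b(1)[OF x j'] by (intro mult_mono) auto
      then show ?thesis by simp
    next
      case False
      have "x powr (- \<alpha> - real j) \<le> x powr 0" using False \<alpha> by (intro powr_mono) auto
      then have "C * x powr (- \<alpha> - real j) \<le> C * 1" using C0 x by (intro mult_left_mono) auto
      then show ?thesis using * by simp
    qed
  qed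
  have D0: "decaying (g 0) (g 1) \<alpha> C"
  proof
    fix y :: real assume y: "y > 0"
    show "(g 0 has_real_derivative g 1 y) (at y)" using gder[OF m012(4) y] by simp
    show "isCont (g 1) y" using gcont[OF m012(2)] by (simp add: continuous_on_eq_continuous_at)
    show "\<bar>g 0 y\<bar> \<le> C" "\<bar>g 0 y\<bar> \<le> C * y powr - \<alpha>" "\<bar>g 1 y\<bar> \<le> C" "\<bar>g 1 y\<bar> \<le> C * y powr (- \<alpha> - 1)"
      using b[OF y, of 0] b[OF y, of 1] by simp_all
  qed (use \<alpha> gmeas m012 in auto)
  \<comment> \<open>The constant doubles because the derivative is a sum of two terms, each bounded
    by C.\<close>
  have D1: "decaying (\<lambda>y. y * g 1 y) (\<lambda>y. g 1 y + y * g 2 y) \<alpha> (2 * C)"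
  proof
    have [measurable]: "g 1 \<in> borel_measurable borel" "g 2 \<in> borel_measurable borel" using gmeas m012 by auto
    show "(\<lambda>y. y * g 1 y) \<in> borel_measurable borel" "(\<lambda>y. g 1 y + y * g 2 y) \<in> borel_measurable borel" by measurable
    fix y :: real assume y: "y > 0"
    have "(g 1 has_real_derivative g 2 y) (at y)" using gder[OF m012(5) y] by (simp add: numeral_2_eq_2)
    then show "((\<lambda>y. y * g 1 y) has_real_derivative g 1 y + y * g 2 y) (at y)"
      by (auto intro!: derivative_eq_intros)
    show "isCont (\<lambda>y. g 1 y + y * g 2 y) y"
      using gcont[OF m012(2)] gcont[OF m012(3)] by (auto simp: continuous_on_eq_continuous_at intro!: continuous_intros)
    have C': "C * y powr c \<ge> 0" for c using C0 by simp
    have y0: "y * \<bar>g 1 y\<bar> \<le> C" "y * \<bar>g 1 y\<bar> \<le> C * y powr (- \<alpha>)" using yb[OF y, of 0] by simp_all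
    have y1: "y * \<bar>g 2 y\<bar> \<le> C" "y * \<bar>g 2 y\<bar> \<le> C * y powr (- \<alpha> - 1)" using yb[OF y, of 1] by (simp_all add: numeral_2_eq_2)
    have b1: "\<bar>g 1 y\<bar> \<le> C" "\<bar>g 1 y\<bar> \<le> C * y powr (- \<alpha> - 1)" using b[OF y, of 1] by simp_all
    have a: "\<bar>y * g 1 y\<bar> = y * \<bar>g 1 y\<bar>" using y by (simp add: abs_mult)
    have a2: "\<bar>g 1 y + y * g 2 y\<bar> \<le> \<bar>g 1 y\<bar> + y * \<bar>g 2 y\<bar>" using y abs_triangle_ineq[of "g 1 y" "y * g 2 y"] by (simp add: abs_mult)
    show "\<bar>y * g 1 y\<bar> \<le> 2 * C" using a y0(1) C0 by linarith
    show "\<bar>y * g 1 y\<bar> \<le> 2 * C * y powr - \<alpha>" using a y0(2) C'[of "- \<alpha>"] by linarith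
    show "\<bar>g 1 y + y * g 2 y\<bar> \<le> 2 * C" using a2 b1(1) y1(1) by linarith
    show "\<bar>g 1 y + y * g 2 y\<bar> \<le> 2 * C * y powr (- \<alpha> - 1)" using a2 b1(2) y1(2) by linarith
  qed (rule \<alpha>)
  show ?thesis
  proof (rule that)
    show "decaying2 (g 0) (g 1) (g 2) \<alpha> C (2 * C)" by (intro decaying2.intro D0 D1)
    show "g 0 x = f x" if "x > 0" for x using that gF[OF that] F0[of x] by simp
  qed
qed

theorem theorem5:
  fixes \<alpha> :: real and m :: nat and f :: "real \<Rightarrow> real" and s :: complex
  assumes "\<alpha> > 1" and "m \<ge> 2" and "M_class \<alpha> m f"
    and "1/2 < Re s" and "Re s < 1"
  shows "((\<lambda>x. complex_of_real
            ((\<Sum>n. \<bar>real_of_int (moebius_mu (Suc n))\<bar> * f (real (Suc n) * x))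
              - 6 * (integral {0<..} f) / (pi ^ 2 * x))
          * (complex_of_real x) powr (s - 1))
         has_integral (zeta s / zeta (2 * s) * mellin f s)) {0<..} \<and>
         ((\<lambda>x. complex_of_real
            ((\<Sum>n. 2 ^ omega (Suc n) * f (real (Suc n) * x))
              + 6 / (pi ^ 2 * x) * ((integral {0<..} f) * ln (4 * pi ^ 2 * x / glaisher ^ 24)
                                    - integral {0<..} (\<lambda>t. f t * ln t)))
          * (complex_of_real x) powr (s - 1))
         has_integral (zeta s ^ 2 / zeta (2 * s) * mellin f s)) {0<..}"
proof -
  obtain f0 f1 f2 C0 C1 where "decaying2 f0 f1 f2 \<alpha> C0 C1" and f0: "\<And>x. x > 0 \<Longrightarrow> f0 x = f x"
    using M_class_decaying2[OF assms(1-3)] by metis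
  then interpret decaying2 f0 f1 f2 \<alpha> C0 C1 by simp
  have sr: "0 < Re s" "Re s < \<alpha>" using assms by auto
  \<comment> \<open>The statement uses gauge integrals of \<open>f\<close>, the locale Lebesgue
    integrals of \<open>f0\<close>. They agree since the integrands are absolutely integrable and
    \<open>f0\<close> equals \<open>f\<close> on the positive half-line.\<close>
  have "integral {0<..} f0 = D0.I"
    using D0.integrable_\<phi> set_borel_integral_eq_integral(2)[of "{0<..}" f0]
    by (simp add: set_integrable_def set_lebesgue_integral_def D0.I_def)
  then have I: "integral {0<..} f = D0.I"
    using integral_cong[of "{0<..}" f0 f] f0 by simp
  have "set_integrable lborel {0<..} (\<lambda>t. f0 t * ln t)"
    using D0.set_integrable_\<phi>_ln by (rule set_integrable_subset) auto
  from set_borel_integral_eq_integral(2)[OF this]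
  have "integral {0<..} (\<lambda>t. f0 t * ln t) = D0.J"
    by (simp add: set_lebesgue_integral_def D0.J_def)
  then have J: "integral {0<..} (\<lambda>t. f t * ln t) = D0.J"
    using integral_cong[of "{0<..}" "\<lambda>t. f0 t * ln t" "\<lambda>t. f t * ln t"] f0 by simp
  have "has_mellin (\<lambda>x. of_real (f x)) s (mel f0 s)"
    using D0.has_mellin_mel[OF sr] by (subst has_mellin_cong[of _ "\<lambda>x. of_real (f0 x)"]) (simp_all add: f0)
  from integral_unique[OF has_mellin_imp_has_integral[OF this]]
  have mel: "mellin f s = mel f0 s" by (simp add: mellin_def)
  have arg: "f (real (Suc n) * x) = f0 (real (Suc n) * x)" if "x > 0" for x n
    using that by (intro f0[symmetric]) simp
  have "has_mellin (\<lambda>x. of_real ((\<Sum>n. \<bar>real_of_int (moebius_mu (Suc n))\<bar> * f (real (Suc n) * x)) - 6 * D0.I / (pi ^ 2 * x))) s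
     (zeta s * mel f0 s / zeta (2 * s))"
    using mellin_identities(1)[OF assms(4,5)]
    by (rule has_mellin_cong[THEN iffD1, rotated]) (simp only: arg)
  moreover have "has_mellin (\<lambda>x. of_real ((\<Sum>n. 2 ^ omega (Suc n) * f (real (Suc n) * x)) +
      6 / (pi ^ 2 * x) * (D0.I * ln (4 * pi ^ 2 * x / glaisher ^ 24) - D0.J))) s (zeta s ^ 2 * mel f0 s / zeta (2 * s))"
    using mellin_identities(2)[OF assms(4,5)]
    by (rule has_mellin_cong[THEN iffD1, rotated]) (simp only: arg)
  ultimately show ?thesis
    unfolding I J mel times_divide_eq_left by (intro conjI has_mellin_imp_has_integral)
qed

end
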